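(* Let $S$ be the $(5,5)$-spectrum and let $A=\{30,32\}\cup\{n : n\text{ even},\ n\ge 36\}$. Then $A\subseteq S\subseteq A\cup\{34\}$. In particular $N(5,5)\le 36$.
   Context: Graphs are finite and simple. For integers $k\ge 3$, $g\ge 3$, a $(k,g)$-graph is a $k$-regular graph of girth exactly $g$. The $(k,g)$-spectrum is the set of all integers $n$ such that there exists a connected $(k,g)$-graph of order $n$. For odd $k$, $N(k,g)$ denotes the smallest element $N$ of the $(k,g)$-spectrum such that all even integers $n\ge N$ belong to the $(k,g)$-spectrum. *)

theory Defs
  imports "Graph_Theory.Graph_Theory" "HOL-Library.Extended_Nat"
begin

text \<open>
  Following \<^theory>\<open>Graph_Theory.Pair_Digraph\<close>, a finite simple graph is a
  \<^const>\<open>pair_graph\<close>: a finite symmetric loopless digraph without parallel arcs, in which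
  each undirected edge is represented by the two arcs between its end vertices.
  Hence the degree of a vertex is its out-degree.
\<close>

definition regular_graph :: "nat \<Rightarrow> 'a pair_pre_digraph \<Rightarrow> bool" where
  "regular_graph k G \<longleftrightarrow> (\<forall>v \<in> pverts G. out_degree (with_proj G) v = k)"

text \<open>
  The directed cycles of the representing digraph include the walks going back and forth along
  a single edge; these have length 2 and are not cycles of the undirected graph, hence the
  bound on the length. An acyclic graph has girth \<open>\<infinity>\<close>.
\<close>

definition girth :: "'a pair_pre_digraph \<Rightarrow> enat" where
  "girth G = (INF p \<in> {p. pre_digraph.cycle (with_proj G) p \<and> 3 \<le> length p}. enat (length p))"

definition kg_graph :: "nat \<Rightarrow> nat \<Rightarrow> 'a pair_pre_digraph \<Rightarrow> bool" where
  "kg_graph k g G \<longleftrightarrow> pair_graph G \<and> regular_graph k G \<and> girth G = enat g"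

text \<open>
  Every finite graph is isomorphic to one whose vertices are natural numbers, so restricting the
  vertex type loses no orders.
\<close>

definition kg_spectrum :: "nat \<Rightarrow> nat \<Rightarrow> nat set" where
  "kg_spectrum k g =
     {n. \<exists>G :: nat pair_pre_digraph.
           kg_graph k g G \<and> Digraph_Component.connected (with_proj G) \<and> card (pverts G) = n}"

text \<open>Meaningful only for odd \<open>k\<close>, and only if a number with the required property exists.\<close>

definition kg_N :: "nat \<Rightarrow> nat \<Rightarrow> nat" where
  "kg_N k g =
     (LEAST N. N \<in> kg_spectrum k g \<and> (\<forall>n \<ge> N. even n \<longrightarrow> n \<in> kg_spectrum k g))"

end

theory Submission
  imports Defs "HOL-Library.Countable" "HOL-Number_Theory.Cong"
begin

text \<open>
  \<^bold>\<open>Existence.\<close> The graphs are lifts of small base graphs whose darts carry integers (voltages) taken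
  modulo \<open>m\<close>. A lift has girth at least 5 if no sum of voltages along certain closed walks of length
  at most 4 is a multiple of \<open>m\<close>, which is a finite computation (locale \<open>voltage_graph\<close>).
  Two base vertices and a fixed choice of voltages serve for all \<open>m \<ge> 23\<close>, hence for all even orders
  from 46 on. Two base vertices also give the orders 36 to 44 and 30, and a base graph with four
  vertices gives 32.

  \<^bold>\<open>Orders below 30.\<close> In a 5-regular graph of girth at least 5 (locale \<open>girth5\<close>) a vertex has 5
  neighbours and 20 vertices at distance 2; call the others \<^emph>\<open>far\<close> from it. So there are \<open>n - 26\<close>
  far vertices for each vertex, and \<open>n\<close> is even because the degree is odd. It remains to exclude
  \<open>n = 26\<close> and \<open>n = 28\<close>.

  For \<open>n = 26\<close> the adjacency matrix satisfies \<open>A\<^sup>2 + A = 4I + J\<close>. This determines the number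
  of closed walks of every length. For length 7 it is not divisible by 7, although rotation permutes
  these walks in classes of 7 elements (\<open>closed_walks_dvd\<close>, \<open>no_moore_graph_5\<close>).

  For \<open>n = 28\<close> every vertex has two far vertices, so the far relation splits the vertices into cycles,
  called orbits. The far relation commutes with adjacency (\<open>far_commute\<close>). In integer coordinates along two
  orbits, adjacency is therefore a 0-1-valued solution of the wave equation
  \<open>a(i+1, j) + a(i-1, j) = a(i, j+1) + a(i, j-1)\<close> (\<open>wave\<close>). This rigidity has the following consequences:

  \<^item> Inside an orbit adjacency is invariant under rotation, and there are at most two neighbours
    (\<open>circulant\<close>, \<open>deg_in_self\<close>).

  \<^item> All vertices of an orbit have the same number of neighbours in another one (\<open>deg_in_orbit\<close>).

  \<^item> If adjacent orbits have different lengths, then the shorter length divides the longer one, and a vertex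
    of the longer orbit has one neighbour in the shorter one (\<open>short_orbit\<close>). The lengths of two shorter
    orbits adjacent to an orbit of length \<open>m\<close> have a least common multiple divisible by \<open>m\<close>
    (\<open>dvd_lcm_orbits\<close>).

  Now fix a vertex \<open>x\<close> in an orbit of maximal length \<open>m\<close>. Counting its neighbours, the walks of
  length 2 from \<open>x\<close> to its own orbit, and all the vertices leaves few possibilities for the distribution
  of its neighbours over the orbits (\<open>row_cases\<close>, \<open>longest_row\<close>). Most of them die because no orbit of a length compatible
  with divisibility fits into the remaining vertices. The orbit lengths 7, 7, 7, 7 and 8, 8, 8, 4 survive and
  need a parity argument: attach to \<open>x\<close> its \<^emph>\<open>partner\<close>, the common neighbour of the two vertices far
  from \<open>x\<close>. This is a symmetric relation by the wave equation, and it would match up 21 vertices in the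
  first case (unless no orbit has inner edges, which counting excludes) and three orbits in the second.
\<close>

section \<open>Spectra and graphs of girth at least 5\<close>

locale girth5 =
  fixes V :: "'a set" and E :: "'a \<Rightarrow> 'a \<Rightarrow> bool" and k :: nat
  assumes finite_V: "finite V"
    and E_sym: "E x y \<Longrightarrow> E y x"
    and E_V: "E x y \<Longrightarrow> x \<in> V"
    and no_loop: "\<not> E x x"
    and degree: "x \<in> V \<Longrightarrow> card {y. E x y} = k"
    and no_triangle: "E x y \<Longrightarrow> E y z \<Longrightarrow> \<not> E z x"
    and no_quad: "E x y \<Longrightarrow> E y z \<Longrightarrow> E x w \<Longrightarrow> E w z \<Longrightarrow> x \<noteq> z \<Longrightarrow> y = w"

lemma cycle_pair:
  "pre_digraph.cycle (with_proj G) p \<longleftrightarrow> p \<noteq> [] \<and> (\<exists>u\<in>pverts G. set p \<subseteq> parcs G \<and> pcas u p u) \<and> distinct (map snd p)"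
proof (cases p)
  case Nil then show ?thesis by (auto simp: pre_digraph.cycle_def)
next
  case (Cons e es)
  have tl: "tl (pawalk_verts u p) = map snd p" if "pcas u p w" for u w
    using that by (induction p arbitrary: u) (auto, (case_tac p; auto)+)
  show ?thesis unfolding pre_digraph.cycle_def pre_digraph.awalk_def awalk_verts_with_proj_eq cas_with_proj_eq
    using tl Cons by (auto; metis image_eqI snd_conv)
qed

lemma spectrum_girth5:
  assumes "n \<in> kg_spectrum k 5"
  obtains V :: "nat set" and E where "girth5 V E k" "card V = n" "V \<noteq> {}"
proof -
  obtain G :: "nat pair_pre_digraph" where G: "pair_graph G" "regular_graph k G" "girth G = enat 5"
    "connected (with_proj G)" "card (pverts G) = n"
    using assms by (auto simp: kg_spectrum_def kg_graph_def)
  interpret pair_graph G by fact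
  have ne: "pverts G \<noteq> {}"
    using G(4) by (auto simp: connected_def strongly_connected_def mk_symmetric_def)
  have long: "5 \<le> length p" if "cycle p" "3 \<le> length p" for p
  proof -
    have "girth G \<le> enat (length p)"
      unfolding girth_def by (rule INF_lower) (use that in auto)
    then show ?thesis using G(3) by simp
  qed
  have "girth5 (pverts G) (\<lambda>u v. (u,v) \<in> parcs G) k"
  proof
    show "finite (pverts G)" by simp
    fix x y z w
    show "(x,y) \<in> parcs G \<Longrightarrow> (y,x) \<in> parcs G" by (rule arcs_symmetric)
    show "(x,y) \<in> parcs G \<Longrightarrow> x \<in> pverts G" by (rule in_arcsD1)
    show "(x,x) \<notin> parcs G" using no_loops' by blast
    show "card {y. (x,y) \<in> parcs G} = k" if "x \<in> pverts G"
    proof -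
      have "out_arcs (with_proj G) x = Pair x ` {y. (x,y) \<in> parcs G}"
        by (auto simp: out_arcs_def)
      then have "out_degree (with_proj G) x = card {y. (x,y) \<in> parcs G}"
        by (simp add: out_degree_def card_image inj_on_def)
      then show ?thesis using G(2) that by (simp add: regular_graph_def)
    qed
    show "(z,x) \<notin> parcs G" if "(x,y) \<in> parcs G" "(y,z) \<in> parcs G"
    proof
      assume "(z,x) \<in> parcs G"
      then have "cycle [(x,y),(y,z),(z,x)]"
        using that no_loops' by (auto simp: cycle_pair intro: in_arcsD1)
      from long[OF this] show False by simp
    qed
    show "y = w" if "(x,y) \<in> parcs G" "(y,z) \<in> parcs G" "(x,w) \<in> parcs G" "(w,z) \<in> parcs G" "x \<noteq> z"
    proof (rule ccontr)
      assume "y \<noteq> w"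
      then have "cycle [(x,y),(y,z),(z,w),(w,x)]"
        using that no_loops' by (auto simp: cycle_pair intro: in_arcsD1 arcs_symmetric)
      from long[OF this] show False by simp
    qed
  qed
  then show thesis using that G(5) ne by blast
qed

text \<open>
  A closed walk of length 5 suffices as a witness for the girth: without loops and triangles its
  five vertices are distinct.
\<close>
lemma (in girth5) in_spectrum:
  assumes inj: "inj_on (f :: 'a \<Rightarrow> nat) V"
    and walk: "E v0 v1" "E v1 v2" "E v2 v3" "E v3 v4" "E v4 v0"
    and conn: "\<And>x y. x \<in> V \<Longrightarrow> y \<in> V \<Longrightarrow> E\<^sup>*\<^sup>* x y"
  shows "card V \<in> kg_spectrum k 5"
proof -
  define G where "G = \<lparr>pverts = f ` V, parcs = {(f x, f y) | x y. E x y}\<rparr>"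
  have EV2: "y \<in> V" if "E x y" for x y using that E_sym E_V by blast
  have G_simps [simp]: "pverts G = f ` V" "parcs G = {(f x, f y) | x y. E x y}"
    by (simp_all add: G_def)
  have arc: "(f x, f y) \<in> parcs G \<longleftrightarrow> E x y" if "x \<in> V" "y \<in> V" for x y
    using that inj E_V EV2 by (auto simp: inj_on_eq_iff)
  have fin: "finite {(f x, f y) | x y. E x y}"
    by (rule finite_subset[of _ "f ` V \<times> f ` V"]) (use finite_V E_V EV2 in auto)
  have pg: "pair_graph G"
  proof
    show "symmetric (with_proj G)" unfolding symmetric_def sym_def using E_sym by auto
    fix e assume "e \<in> parcs G"
    then obtain x y where "e = (f x, f y)" "E x y" by auto
    then show "fst e \<noteq> snd e" using inj E_V EV2 no_loop by (metis fst_conv inj_onD snd_conv)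
  qed (use finite_V fin E_V EV2 in auto)
  have reg: "regular_graph k G"
    unfolding regular_graph_def
  proof
    fix v assume "v \<in> pverts G"
    then obtain x where x: "x \<in> V" "v = f x" by auto
    have "E x y" if "E x' y" "f x' = f x" for x' y
      using that x(1) inj E_V by (metis inj_onD)
    then have "out_arcs (with_proj G) v = (\<lambda>y. (f x, f y)) ` {y. E x y}"
      using x by (fastforce simp: out_arcs_def)
    moreover have "inj_on (\<lambda>y. (f x, f y)) {y. E x y}"
      using inj EV2 by (auto simp: inj_on_def)
    ultimately show "out_degree (with_proj G) v = k"
      using degree[OF x(1)] by (simp add: out_degree_def card_image)
  qed
  have short: False if cyc: "pre_digraph.cycle (with_proj G) p" "3 \<le> length p" "length p < 5" for p
  proof -
    have "length p = 3 \<or> length p = 4" using cyc(2,3) by auto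
    then show False
    proof
      assume "length p = 3"
      then obtain a b c where p: "p = [a,b,c]" by (auto simp: length_Suc_conv numeral_3_eq_3)
      obtain x y z x' y' z' where abc: "a = (f x, f x')" "b = (f y, f y')" "c = (f z, f z')"
        and E: "E x x'" "E y y'" "E z z'"
      proof -
        have "set p \<subseteq> {(f x, f y) | x y. E x y}" using cyc by (auto simp: cycle_pair)
        then show thesis using that p by auto
      qed
      with cyc p have "f x' = f y" "f y' = f z" "f z' = f x" unfolding abc by (auto simp: cycle_pair)
      then have "x' = y" "y' = z" "z' = x" using inj E E_V EV2 by (meson inj_onD)+
      then show False using E no_triangle by blast
    next
      assume "length p = 4"
      then obtain a b c d where p: "p = [a,b,c,d]" by (auto simp: length_Suc_conv eval_nat_numeral)
      obtain x y z w x' y' z' w' where abcd: "a = (f x, f x')" "b = (f y, f y')" "c = (f z, f z')" "d = (f w, f w')"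
        and E: "E x x'" "E y y'" "E z z'" "E w w'"
      proof -
        have "set p \<subseteq> {(f x, f y) | x y. E x y}" using cyc by (auto simp: cycle_pair)
        then show thesis using that p by auto
      qed
      with cyc p have "f x' = f y" "f y' = f z" "f z' = f w" "f w' = f x" unfolding abcd by (auto simp: cycle_pair)
      then have eq: "x' = y" "y' = z" "z' = w" "w' = x" using inj E E_V EV2 by (meson inj_onD)+
      have "distinct [f x', f y', f z', f w']" using cyc p abcd by (auto simp: cycle_pair)
      then have "y \<noteq> w" "x \<noteq> z" using eq by auto
      then show False using E no_quad[of x y z w] E_sym eq by blast
    qed
  qed
  have ne: "v0 \<noteq> v1" "v1 \<noteq> v2" "v2 \<noteq> v3" "v3 \<noteq> v4" "v4 \<noteq> v0" 
       "v0 \<noteq> v2" "v1 \<noteq> v3" "v2 \<noteq> v4" "v3 \<noteq> v0" "v4 \<noteq> v1"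
    using walk no_loop no_triangle by blast+
  have "pre_digraph.cycle (with_proj G) (map (\<lambda>(x,y). (f x, f y)) [(v0,v1),(v1,v2),(v2,v3),(v3,v4),(v4,v0)])"
    using walk ne E_V inj by (auto simp: cycle_pair dest: inj_onD)
  from this have "girth G \<le> enat (length (map (\<lambda>(x,y). (f x, f y)) [(v0,v1),(v1,v2),(v2,v3),(v3,v4),(v4,v0)]))"
    unfolding girth_def by (intro INF_lower) auto
  moreover have "enat 5 \<le> girth G"
    unfolding girth_def by (rule INF_greatest) (use short in force)
  ultimately have girth: "girth G = enat 5" by (simp add: eval_nat_numeral)
  have "(f x, f y) \<in> rtrancl_on (f ` V) (parcs G)" if "E\<^sup>*\<^sup>* x y" "x \<in> V" for x y
    using that
  proof (induction rule: rtranclp_induct)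
    case (step y z)
    then have "(f x, f y) \<in> rtrancl_on (f ` V) (parcs G)" by blast
    moreover have "(f y, f z) \<in> parcs G" "f z \<in> f ` V" using step EV2 by auto
    ultimately show ?case by (rule rtrancl_on_into_rtrancl_on)
  qed auto
  moreover have "parcs (mk_symmetric (with_proj G)) = parcs G"
    using E_sym by (fastforce simp: mk_symmetric_def)
  moreover have "pverts (mk_symmetric (with_proj G)) = f ` V" by (simp add: mk_symmetric_def)
  ultimately have "connected (with_proj G)"
    unfolding connected_def strongly_connected_def using conn walk(1) E_V
    by (auto simp: reachable_def simp del: G_simps)
  then show ?thesis
    using pg reg girth card_image[OF inj] unfolding kg_spectrum_def kg_graph_def by fastforce
qed

section \<open>Voltage graphs\<close>

text \<open>
  A dart \<open>(i, j, s)\<close> is an arc from \<open>i\<close> to \<open>j\<close> of a base graph, carrying the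
  voltage \<open>s\<close>. It lifts to the arcs from \<open>(i, a)\<close> to \<open>(j, a + s)\<close>, for all residues
  \<open>a\<close> modulo \<open>m\<close>. Thus a closed walk in the lifted graph is a closed walk of darts whose voltages sum
  to a multiple of \<open>m\<close>.
\<close>
fun dart_walk :: "(nat \<times> nat \<times> int) list \<Rightarrow> nat \<Rightarrow> (nat \<times> nat \<times> int) list \<Rightarrow> nat \<Rightarrow> bool" where
  "dart_walk L i [] j \<longleftrightarrow> i = j"
| "dart_walk L i ((i', l, s) # ds) j \<longleftrightarrow> i' = i \<and> (i', l, s) \<in> set L \<and> dart_walk L l ds j"

definition voltage :: "(nat \<times> nat \<times> int) list \<Rightarrow> int" where
  "voltage ds = sum_list (map (\<lambda>(i, j, s). s) ds)"

abbreviation source :: "nat \<times> nat \<times> int \<Rightarrow> nat" where "source d \<equiv> fst d"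

abbreviation target :: "nat \<times> nat \<times> int \<Rightarrow> nat" where "target d \<equiv> fst (snd d)"

abbreviation shift :: "nat \<times> nat \<times> int \<Rightarrow> int" where "shift d \<equiv> snd (snd d)"

text \<open>
  The predicates \<open>Z\<close> and \<open>Z'\<close> bound the multiples of \<open>m\<close> from above and from below. For a
  single \<open>m\<close> both are divisibility by \<open>m\<close>, and for a family of graphs they may be chosen independently
  of \<open>m\<close>, so that all its members are covered by a single computation.
\<close>
definition regular_darts :: "(int \<Rightarrow> bool) \<Rightarrow> (int \<Rightarrow> bool) \<Rightarrow> nat \<Rightarrow> nat \<Rightarrow> (nat \<times> nat \<times> int) list \<Rightarrow> bool" where
  "regular_darts Z Z' r k L \<longleftrightarrow> 0 < r \<and> distinct L \<and>
     (\<forall>i \<in> {..<r}. length (filter (\<lambda>d. source d = i) L) = k) \<and>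
     (\<forall>d \<in> set L. source d < r \<and> target d < r \<and> (source d = target d \<longrightarrow> \<not> Z (shift d)) \<and>
        (\<exists>e \<in> set L. source e = target d \<and> target e = source d \<and> Z' (shift d + shift e)) \<and>
        (\<forall>e \<in> set L. source e = source d \<longrightarrow> target e = target d \<longrightarrow> Z (shift d - shift e) \<longrightarrow> shift d = shift e))"

definition no_dart_triangle :: "(int \<Rightarrow> bool) \<Rightarrow> (nat \<times> nat \<times> int) list \<Rightarrow> bool" where
  "no_dart_triangle Z L \<longleftrightarrow> (\<forall>d \<in> set L. \<forall>e \<in> set L. target d = source e \<longrightarrow>
     (\<forall>f \<in> set L. target e = source f \<longrightarrow> target f = source d \<longrightarrow> \<not> Z (shift d + shift e + shift f)))"

definition no_dart_quad :: "(int \<Rightarrow> bool) \<Rightarrow> (int \<Rightarrow> bool) \<Rightarrow> (nat \<times> nat \<times> int) list \<Rightarrow> bool" where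
  "no_dart_quad Z Z' L \<longleftrightarrow> (\<forall>d \<in> set L. \<forall>e \<in> set L. target d = source e \<longrightarrow>
     (\<forall>d' \<in> set L. source d' = source d \<longrightarrow> (\<forall>e' \<in> set L. target d' = source e' \<longrightarrow> target e' = target e \<longrightarrow>
        Z (shift d + shift e - shift d' - shift e') \<longrightarrow>
        (target d' = target d \<and> shift d = shift d') \<or> (target e = source d \<and> Z' (shift d + shift e)))))"

definition voltages ::
  "(int \<Rightarrow> bool) \<Rightarrow> (int \<Rightarrow> bool) \<Rightarrow> nat \<Rightarrow> nat \<Rightarrow> (nat \<times> nat \<times> int) list \<Rightarrow> bool" where
  "voltages Z Z' r k L \<longleftrightarrow> regular_darts Z Z' r k L \<and> no_dart_triangle Z L \<and> no_dart_quad Z Z' L"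

lemma voltages_mono:
  assumes "voltages Z Z' r k L" "\<And>d. Y d \<Longrightarrow> Z d" "\<And>d. Z' d \<Longrightarrow> Y' d"
  shows "voltages Y Y' r k L"
proof -
  have "regular_darts Y Y' r k L"
    using assms unfolding voltages_def regular_darts_def by meson
  moreover have "no_dart_triangle Y L"
    using assms unfolding voltages_def no_dart_triangle_def by meson
  moreover have "no_dart_quad Y Y' L"
    using assms unfolding voltages_def no_dart_quad_def by meson
  ultimately show ?thesis unfolding voltages_def by blast
qed

locale voltage_graph =
  fixes m r k :: nat and L gen pent :: "(nat \<times> nat \<times> int) list"
  assumes m_pos: "m > 0"
    and voltages: "voltages ((dvd) (int m)) ((dvd) (int m)) r k L"
    and tree: "\<forall>i\<in>{1..<r}. \<exists>d \<in> set L. source d < i \<and> target d = i"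
    and gen: "dart_walk L 0 gen 0" "int m dvd voltage gen - 1"
    and pent: "dart_walk L 0 pent 0" "int m dvd voltage pent" "length pent = 5"
begin

definition verts :: "(nat \<times> int) set" where "verts = {..<r} \<times> {0..<int m}"

definition adj :: "nat \<times> int \<Rightarrow> nat \<times> int \<Rightarrow> bool" where
  "adj x y \<longleftrightarrow> x \<in> verts \<and> y \<in> verts \<and> (\<exists>s. (fst x, fst y, s) \<in> set L \<and> int m dvd snd x + s - snd y)"

lemma adj_iff: "adj (i, a) (j, b) \<longleftrightarrow> i < r \<and> j < r \<and> 0 \<le> a \<and> a < int m \<and> 0 \<le> b \<and> b < int m \<and>
   (\<exists>s. (i, j, s) \<in> set L \<and> int m dvd a + s - b)"
  by (auto simp: adj_def verts_def)

lemma residue_eqI: "int m dvd a - b \<Longrightarrow> 0 \<le> a \<Longrightarrow> a < int m \<Longrightarrow> 0 \<le> b \<Longrightarrow> b < int m \<Longrightarrow> a = b"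
  by (metis mod_eq_dvd_iff mod_pos_pos_trivial)

lemma card_verts: "card verts = r * m" by (simp add: verts_def)

lemma
  shows r_pos: "0 < r" and distinct_L: "distinct L" 
    and valency: "i < r \<Longrightarrow> length (filter (\<lambda>d. source d = i) L) = k"
    and index_L: "(i, j, s) \<in> set L \<Longrightarrow> i < r \<and> j < r \<and> \<not> (i = j \<and> int m dvd s)"
    and inverse: "(i, j, s) \<in> set L \<Longrightarrow> \<exists>t. (j, i, t) \<in> set L \<and> int m dvd s + t"
    and parallel: "(i, j, s) \<in> set L \<Longrightarrow> (i, j, t) \<in> set L \<Longrightarrow> int m dvd s - t \<Longrightarrow> s = t"
    and triangle: "(i, j, s) \<in> set L \<Longrightarrow> (j, l, t) \<in> set L \<Longrightarrow> (l, i, u) \<in> set L \<Longrightarrow> \<not> int m dvd s + t + u"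
    and quad: "(i, j, s) \<in> set L \<Longrightarrow> (j, l, t) \<in> set L \<Longrightarrow> (i, h, s') \<in> set L \<Longrightarrow> (h, l, t') \<in> set L \<Longrightarrow>
           int m dvd s + t - s' - t' \<Longrightarrow> (h = j \<and> s = s') \<or> (l = i \<and> int m dvd s + t)"
proof -
  have V: "regular_darts ((dvd) (int m)) ((dvd) (int m)) r k L" "no_dart_triangle ((dvd) (int m)) L"
      "no_dart_quad ((dvd) (int m)) ((dvd) (int m)) L"
    using voltages by (simp_all add: voltages_def)
  note R = V(1)[unfolded regular_darts_def]
  show "0 < r" "distinct L" using R by blast+
  show "length (filter (\<lambda>d. source d = i) L) = k" if "i < r" for i
    using R that by blast
  show "i < r \<and> j < r \<and> \<not> (i = j \<and> int m dvd s)" if "(i, j, s) \<in> set L" for i j s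
    using R that by force
  show "\<exists>t. (j, i, t) \<in> set L \<and> int m dvd s + t" if "(i, j, s) \<in> set L" for i j s
    using R that by force
  show "s = t" if "(i, j, s) \<in> set L" "(i, j, t) \<in> set L" "int m dvd s - t" for i j s t
    using R that by (metis fst_conv snd_conv)
  show "\<not> int m dvd s + t + u" if "(i, j, s) \<in> set L" "(j, l, t) \<in> set L" "(l, i, u) \<in> set L" for i j l s t u
    using V(2) that unfolding no_dart_triangle_def by (metis fst_conv snd_conv)
  show "(h = j \<and> s = s') \<or> (l = i \<and> int m dvd s + t)"
    if "(i, j, s) \<in> set L" "(j, l, t) \<in> set L" "(i, h, s') \<in> set L" "(h, l, t') \<in> set L"
       "int m dvd s + t - s' - t'" for i j l h s t s' t'
    using V(3) that unfolding no_dart_quad_def by (metis fst_conv snd_conv)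
qed

lemma dvd_diffI: "int m dvd a \<Longrightarrow> int m dvd b \<Longrightarrow> c = a - b \<Longrightarrow> int m dvd c" by simp

lemma adj_mod: "(i, j, s) \<in> set L \<Longrightarrow> adj (i, a mod int m) (j, (a + s) mod int m)"
  using index_L[of i j s] m_pos
  by (auto simp: adj_iff mod_eq_dvd_iff[symmetric] mod_simps intro!: exI[of _ s])

sublocale girth5 verts adj k
proof
  show "finite verts" by (simp add: verts_def)
  fix x y z w
  show sym: "adj y x" if xy: "adj x y" for x y
  proof -
    obtain i a j b where [simp]: "x = (i, a)" "y = (j, b)" by (metis surj_pair)
    from xy obtain s where s: "(i, j, s) \<in> set L" "int m dvd a + s - b" by (auto simp: adj_iff)
    from inverse[OF s(1)] obtain t where t: "(j, i, t) \<in> set L" "int m dvd s + t" by blast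
    have "int m dvd b + t - a" by (rule dvd_diffI[OF t(2) s(2)]) simp
    with xy t show ?thesis by (auto simp: adj_iff)
  qed
  show "adj x y \<Longrightarrow> x \<in> verts" by (simp add: adj_def)
  show "\<not> adj x x" using index_L by (cases x) (auto simp: adj_iff)
  show "card {y. adj x y} = k" if "x \<in> verts"
  proof -
    obtain i a where x: "x = (i, a)" "i < r" "0 \<le> a" "a < int m" using \<open>x \<in> verts\<close> by (auto simp: verts_def)
    define D where "D = set (filter (\<lambda>d. source d = i) L)"
    have D: "d \<in> D \<longleftrightarrow> (\<exists>j s. d = (i, j, s) \<and> (i, j, s) \<in> set L)" for d by (cases d) (auto simp: D_def)
    define f where "f = (\<lambda>(i' :: nat, j :: nat, s). (j, (a + s) mod int m))"
    have "{y. adj x y} = f ` D"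
    proof (intro set_eqI iffI)
      fix y assume "y \<in> {y. adj x y}"
      then obtain j b s where y: "y = (j, b)" "0 \<le> b" "b < int m" and s: "(i, j, s) \<in> set L" "int m dvd a + s - b"
        using x by (cases y) (auto simp: adj_iff)
      then have "(a + s) mod int m = b" by (metis mod_eq_dvd_iff mod_pos_pos_trivial)
      then have "y = f (i, j, s)" by (simp add: f_def y)
      moreover have "(i, j, s) \<in> D" using s(1) by (simp add: D)
      ultimately show "y \<in> f ` D" by (rule image_eqI)
    next
      fix y assume "y \<in> f ` D"
      then obtain d where "d \<in> D" "y = f d" by (rule imageE)
      then obtain j s where js: "(i, j, s) \<in> set L" "y = f (i, j, s)" unfolding D by blast
      then have "y = (j, (a + s) mod int m)" by (simp add: f_def)
      moreover have "x = (i, a mod int m)" using x by simp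
      ultimately have "adj x y" using adj_mod[OF js(1), of a] by metis
      then show "y \<in> {y. adj x y}" by simp
    qed
    moreover have "inj_on f D"
    proof (rule inj_onI)
      fix d d' assume "d \<in> D" "d' \<in> D" "f d = f d'"
      then obtain j s t where d: "d = (i, j, s)" "d' = (i, j, t)" "(i, j, s) \<in> set L" "(i, j, t) \<in> set L"
        "(a + s) mod int m = (a + t) mod int m" by (auto simp: D f_def)
      then have "int m dvd s - t" by (metis add_diff_cancel_left mod_eq_dvd_iff)
      with parallel d show "d = d'" by blast
    qed
    ultimately have "card {y. adj x y} = card D" by (simp add: card_image)
    also have "\<dots> = k" unfolding D_def using valency[OF x(2)] distinct_L by (simp add: distinct_card del: set_filter)
    finally show ?thesis .
  qed
  show "\<not> adj z x" if "adj x y" "adj y z"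
  proof
    assume "adj z x"
    obtain i a j b l c where [simp]: "x = (i, a)" "y = (j, b)" "z = (l, c)" by (metis surj_pair)
    from that \<open>adj z x\<close> obtain s t u where "(i, j, s) \<in> set L" "int m dvd a + s - b"
      "(j, l, t) \<in> set L" "int m dvd b + t - c" "(l, i, u) \<in> set L" "int m dvd c + u - a" by (auto simp: adj_iff)
    moreover from this have "int m dvd (a + s - b) + (b + t - c) + (c + u - a)" by (meson dvd_add)
    ultimately show False using triangle[of i j s l t u] by (simp add: algebra_simps)
  qed
  show "y = w" if H: "adj x y" "adj y z" "adj x w" "adj w z" "x \<noteq> z"
  proof -
    obtain i a j b l c h d where e [simp]: "x = (i, a)" "y = (j, b)" "z = (l, c)" "w = (h, d)" by (metis surj_pair)
    from H obtain s t s' t' where st: "(i, j, s) \<in> set L" "int m dvd a + s - b"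
      "(j, l, t) \<in> set L" "int m dvd b + t - c" "(i, h, s') \<in> set L" "int m dvd a + s' - d"
      "(h, l, t') \<in> set L" "int m dvd d + t' - c" by (auto simp: adj_iff)
    then have "int m dvd ((a + s - b) + (b + t - c)) - ((a + s' - d) + (d + t' - c))" by (meson dvd_add dvd_diff)
    then have "int m dvd s + t - s' - t'" by (simp add: algebra_simps)
    from quad[OF st(1,3,5,7) this] show ?thesis
    proof
      assume eq: "h = j \<and> s = s'"
      have "int m dvd b - d" by (rule dvd_diffI[OF st(6,2)]) (use eq in simp)
      then have "b = d" by (rule residue_eqI) (use H in \<open>auto simp: adj_iff\<close>)
      with eq show ?thesis by simp
    next
      assume eq: "l = i \<and> int m dvd s + t"
      have "int m dvd (s + t) - ((a + s - b) + (b + t - c))" using st eq by (meson dvd_add dvd_diff)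
      then have "int m dvd c - a" by (simp add: algebra_simps)
      then have "c = a" by (rule residue_eqI) (use H in \<open>auto simp: adj_iff\<close>)
      with eq H(5) show ?thesis by simp
    qed
  qed
qed

text \<open>
  A closed dart walk of voltage 1 at \<open>0\<close> allows to move from each \<open>(0, a)\<close> to \<open>(0, a + 1)\<close>; the
  darts from smaller to larger base vertices then lead to all other vertices.
\<close>
lemma reach_walk: "dart_walk L i ds j \<Longrightarrow> adj\<^sup>*\<^sup>* (i, a mod int m) (j, (a + voltage ds) mod int m)"
proof (induction ds arbitrary: i a)
  case (Cons d ds)
  obtain l s where d: "d = (i, l, s)" "(i, l, s) \<in> set L" "dart_walk L l ds j"
    using Cons.prems by (cases d) auto
  have "a + s + voltage ds = a + voltage (d # ds)" by (simp add: voltage_def d(1))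
  with Cons.IH[OF d(3), of "a + s"] adj_mod[OF d(2), of a] show ?case
    by (metis converse_rtranclp_into_rtranclp)
qed (simp add: voltage_def)

lemma reach: assumes "x \<in> verts" shows "adj\<^sup>*\<^sup>* (0, 0) x"
proof -
  have zero: "adj\<^sup>*\<^sup>* (0, 0) (0, int n mod int m)" for n
  proof (induction n)
    case (Suc n)
    have "(int n + voltage gen) mod int m = int (Suc n) mod int m"
      using gen(2) by (simp add: mod_eq_dvd_iff algebra_simps)
    with reach_walk[OF gen(1), of "int n"] Suc show ?case by (metis rtranclp_trans)
  qed simp
  have "i < r \<Longrightarrow> adj\<^sup>*\<^sup>* (0, 0) (i, b mod int m)" for i b
  proof (induction i arbitrary: b rule: less_induct)
    case (less i)
    show ?case
    proof (cases "i = 0")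
      case True
      have "b mod int m = int (nat (b mod int m)) mod int m" using m_pos by simp
      with zero True show ?thesis by metis
    next
      case False
      then have "i \<in> {1..<r}" using less(2) by simp
      with tree have "\<exists>d \<in> set L. source d < i \<and> target d = i" by (rule bspec)
      then obtain j s where j: "(j, i, s) \<in> set L" "j < i" by auto
      then have "adj\<^sup>*\<^sup>* (0, 0) (j, (b - s) mod int m)" using less by simp
      moreover have "adj (j, (b - s) mod int m) (i, b mod int m)" using adj_mod[OF j(1), of "b - s"] by simp
      ultimately show ?thesis by (rule rtranclp.rtrancl_into_rtrancl)
    qed
  qed
  moreover obtain i b where "x = (i, b)" "i < r" "b mod int m = b" using assms by (auto simp: verts_def)
  ultimately show ?thesis by metis
qed

theorem in_kg_spectrum: "r * m \<in> kg_spectrum k 5"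
proof -
  obtain d1 d2 d3 d4 d5 where "pent = [d1,d2,d3,d4,d5]"
    using pent(3) by (auto simp: length_Suc_conv eval_nat_numeral)
  then obtain j1 j2 j3 j4 s1 s2 s3 s4 s5 where 
    d: "(0, j1, s1) \<in> set L" "(j1, j2, s2) \<in> set L" "(j2, j3, s3) \<in> set L" "(j3, j4, s4) \<in> set L" "(j4, 0, s5) \<in> set L" 
    and "voltage pent = s1 + s2 + s3 + s4 + s5"
    using pent(1) by (cases d1; cases d2; cases d3; cases d4; cases d5) (auto simp: voltage_def)
  then have z: "(s1 + s2 + s3 + s4 + s5) mod int m = 0 mod int m" using pent(2) by auto
  have sym: "symp adj" using E_sym by (rule sympI)
  have "inj_on to_nat verts" by (simp add: inj_on_def)
  moreover have "adj\<^sup>*\<^sup>* x y" if "x \<in> verts" "y \<in> verts" for x y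
    using reach[OF that(1)] reach[OF that(2)] sym by (meson rtranclp_trans symp_rtranclp sympD)
  ultimately have "card verts \<in> kg_spectrum k 5"
    using adj_mod[OF d(1), of 0] adj_mod[OF d(2), of s1] adj_mod[OF d(3), of "s1 + s2"] 
      adj_mod[OF d(4), of "s1 + s2 + s3"] adj_mod[OF d(5), of "s1 + s2 + s3 + s4"] z
    by (intro in_spectrum) auto
  then show ?thesis by (simp add: card_verts)
qed

end

section \<open>Graphs of order 30, 32, and at least 36\<close>

lemma spectrum_30: "30 \<in> kg_spectrum 5 5"
proof -
  define L :: "(nat \<times> nat \<times> int) list" where
    "L = [(0,0,6), (0,0,-6), (1,1,3), (1,1,-3),
          (0,1,0), (0,1,4), (0,1,5), (1,0,0), (1,0,-4), (1,0,-5)]"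
  have "voltages ((dvd) 15) ((dvd) 15) 2 5 L" unfolding L_def by code_simp
  moreover have "\<forall>i\<in>{1..<2}. \<exists>d \<in> set L. source d < i \<and> target d = i" unfolding L_def by code_simp
  ultimately interpret voltage_graph 15 2 5 L "[(0,1,5), (1,0,-4)]" "[(0,0,6), (0,0,6), (0,0,6), (0,0,6), (0,0,6)]"
    by unfold_locales (simp_all add: L_def voltage_def)
  show ?thesis using in_kg_spectrum by simp
qed

lemma spectrum_32: "32 \<in> kg_spectrum 5 5"
proof -
  define L :: "(nat \<times> nat \<times> int) list" where
    "L = [(0,0,4), (0,1,1), (0,1,3), (0,1,4), (0,3,5), (1,2,4), (1,3,7), (2,2,4), (2,3,1), (2,3,2), (2,3,4),
          (1,0,-1), (1,0,-3), (1,0,-4), (3,0,-5), (2,1,-4), (3,1,-7), (3,2,-1), (3,2,-2), (3,2,-4)]"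
  have "voltages ((dvd) 8) ((dvd) 8) 4 5 L" unfolding L_def by code_simp
  moreover have "\<forall>i\<in>{1..<4}. \<exists>d \<in> set L. source d < i \<and> target d = i" unfolding L_def by code_simp
  ultimately interpret voltage_graph 8 4 5 L "[(0,1,4), (1,0,-3)]" "[(0,0,4), (0,1,1), (1,2,4), (2,3,4), (3,0,-5)]"
    by unfold_locales (simp_all add: L_def voltage_def)
  show ?thesis using in_kg_spectrum by simp
qed

text \<open>
  Two copies of the integers modulo \<open>m\<close>, with steps \<open>\<plusminus>1\<close> in the first, steps \<open>\<plusminus>2\<close> in the second, and the
  differences \<open>0\<close>, \<open>p\<close> and \<open>-q\<close> between them. The girth is at least 5 if \<open>\<plusminus>p\<close>, \<open>\<plusminus>q\<close>, \<open>\<plusminus>(p + q)\<close> are six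
  distinct residues that avoid \<open>0, \<plusminus>1, \<plusminus>2, \<plusminus>3, \<plusminus>4\<close>, provided that \<open>m\<close> itself is not too small.
\<close>
definition bicirculant :: "int \<Rightarrow> int \<Rightarrow> (nat \<times> nat \<times> int) list" where
  "bicirculant p q = [(0,0,1), (0,0,-1), (1,1,2), (1,1,-2),
     (0,1,0), (0,1,p), (0,1,-q), (1,0,0), (1,0,-p), (1,0,q)]"

lemma bicirculant_spectrum:
  assumes "voltages ((dvd) (int m)) ((dvd) (int m)) 2 5 (bicirculant p q)" "m > 0"
  shows "2 * m \<in> kg_spectrum 5 5"
proof -
  interpret voltage_graph m 2 5 "bicirculant p q" "[(0,0,1)]" "[(0,0,1), (0,0,1), (0,1,0), (1,1,-2), (1,0,0)]"
    using assms by unfold_locales (simp_all add: bicirculant_def voltage_def atLeastLessThanSuc)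
  show ?thesis using in_kg_spectrum by simp
qed

lemma spectrum_even:
  assumes "even n" "n \<ge> 36"
  shows "n \<in> kg_spectrum 5 5"
proof -
  obtain m where n: "n = 2 * m" using \<open>even n\<close> by blast
  consider "m = 18" | "m = 19" | "m = 20" | "m = 21" | "m = 22" | "m \<ge> 23" using n assms by linarith
  then have "\<exists>p q. voltages ((dvd) (int m)) ((dvd) (int m)) 2 5 (bicirculant p q)"
  proof cases
    case 1
    have "voltages ((dvd) 18) ((dvd) 18) 2 5 (bicirculant 5 6)" by code_simp
    then show ?thesis using 1 by auto
  next
    case 2
    have "voltages ((dvd) 19) ((dvd) 19) 2 5 (bicirculant 5 6)" by code_simp
    then show ?thesis using 2 by auto
  next
    case 3
    have "voltages ((dvd) 20) ((dvd) 20) 2 5 (bicirculant 5 7)" by code_simp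
    then show ?thesis using 3 by auto
  next
    case 4
    have "voltages ((dvd) 21) ((dvd) 21) 2 5 (bicirculant 6 7)" by code_simp
    then show ?thesis using 4 by auto
  next
    case 5
    have "voltages ((dvd) 22) ((dvd) 22) 2 5 (bicirculant 5 7)" by code_simp
    then show ?thesis using 5 by auto
  next
    case 6
    \<comment> \<open>A multiple of \<open>m \<ge> 23\<close> is 0 or exceeds 22 in absolute value, a condition without \<open>m\<close>.\<close>
    have "voltages (\<lambda>d. d = 0 \<or> 22 < \<bar>d\<bar>) (\<lambda>d. d = 0) 2 5 (bicirculant 5 6)" by code_simp
    then have "voltages ((dvd) (int m)) ((dvd) (int m)) 2 5 (bicirculant 5 6)"
    proof (rule voltages_mono)
      show "d = 0 \<or> 22 < \<bar>d\<bar>" if "int m dvd d" for d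
        using dvd_imp_le_int[OF _ that] 6 by force
    qed simp
    then show ?thesis by blast
  qed
  then show ?thesis using bicirculant_spectrum n assms by force
qed

section \<open>Vertices at distance greater than 2, and the order 26\<close>

lemma even_card_involution:
  assumes "finite A" "\<And>x. x \<in> A \<Longrightarrow> f x \<in> A \<and> f (f x) = x \<and> f x \<noteq> x"
  shows "even (card A)"
proof (rule equiv_imp_dvd_card)
  define r where "r = {(x, y). x \<in> A \<and> (y = x \<or> y = f x)}"
  show "equiv A r"
    by (rule equivI) (use assms(2) in \<open>auto simp: r_def refl_on_def sym_def trans_def\<close>)
  fix X assume "X \<in> A // r"
  then obtain x where "x \<in> A" "X = {x, f x}" by (auto simp: quotient_def r_def)
  with assms(2)[of x] show "2 dvd card X" by auto
qed fact

lemma even_card_matching: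
  assumes "finite A" "\<And>x. x \<in> A \<Longrightarrow> \<exists>y\<in>A. R x y" "\<And>x y. R x y \<Longrightarrow> R y x" "\<And>x. \<not> R x x"
    "\<And>x y z. R x y \<Longrightarrow> R x z \<Longrightarrow> y = z"
  shows "even (card A)"
proof (rule even_card_involution)
  fix x assume "x \<in> A"
  then obtain y where y: "y \<in> A" "R x y" using assms(2) by blast
  have "(THE y. R x y) = y" "(THE z. R y z) = x" using y assms(3,5) by blast+
  then show "(THE y. R x y) \<in> A \<and> (THE z. R (THE y. R x y) z) = x \<and> (THE y. R x y) \<noteq> x"
    using y assms(4) by auto
qed fact

lemma rotate_mult_id: "rotate d xs = xs \<Longrightarrow> rotate (d * t) xs = xs"
proof (induction t)
  case (Suc t)
  have "rotate (d * Suc t) xs = rotate d (rotate (d * t) xs)" by (simp add: rotate_rotate)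
  with Suc show ?case by simp
qed simp

text \<open>
  The classes of lists up to rotation have \<open>p\<close> elements each: if two of the first \<open>p\<close> rotations
  agreed, then, \<open>p\<close> being prime, the rotation by one position would fix the list, too.
\<close>
lemma prime_dvd_card_rotation:
  assumes "prime p" "finite W" "\<And>xs. xs \<in> W \<Longrightarrow> length xs = p \<and> rotate1 xs \<in> W \<and> rotate1 xs \<noteq> xs"
  shows "p dvd card W"
proof (rule equiv_imp_dvd_card)
  have p: "p > 0" using \<open>prime p\<close> prime_gt_0_nat by blast
  have rot: "rotate n xs \<in> W" if "xs \<in> W" for n xs
    by (induction n) (use that assms(3) in auto)
  define r where "r = {(xs, ys). xs \<in> W \<and> (\<exists>n. ys = rotate n xs)}"
  show "equiv W r"
  proof (rule equivI)
    show "r \<subseteq> W \<times> W" using rot by (auto simp: r_def)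
    show "refl_on W r" by (auto simp: r_def refl_on_def intro: exI[of _ 0])
    show "trans r" by (auto simp: r_def trans_def rot rotate_rotate)
    have "\<exists>m. xs = rotate m (rotate n xs)" if "xs \<in> W" for n xs
    proof (intro exI)
      have "p - n mod p + n = p + p * (n div p)"
        using mod_less_divisor[OF p, of n] mult_div_mod_eq[of p n] by linarith
      then have "(p - n mod p + n) mod p = 0" by simp
      then show "xs = rotate (p - n mod p) (rotate n xs)"
        using assms(3)[OF that] by (simp add: rotate_rotate rotate_id)
    qed
    then show "sym r" by (auto simp: r_def sym_def rot)
  qed
  fix X assume "X \<in> W // r"
  then obtain xs where xs: "xs \<in> W" "X = {ys. \<exists>n. ys = rotate n xs}" by (auto simp: quotient_def r_def)
  have len: "length xs = p" using assms(3) xs(1) by blast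
  have "X = (\<lambda>n. rotate n xs) ` {..<p}"
  proof (intro set_eqI iffI)
    fix ys assume "ys \<in> X"
    then obtain n where "ys = rotate n xs" using xs by blast
    then have "ys = rotate (n mod p) xs" using len rotate_conv_mod by metis
    then show "ys \<in> (\<lambda>n. rotate n xs) ` {..<p}" using p by (intro image_eqI[of _ _ "n mod p"]) auto
  qed (use xs in auto)
  moreover have "inj_on (\<lambda>n. rotate n xs) {..<p}"
  proof (rule linorder_inj_onI)
    fix i j assume ij: "i < j" "i \<in> {..<p}" "j \<in> {..<p}"
    show "rotate i xs \<noteq> rotate j xs"
    proof
      assume eq: "rotate i xs = rotate j xs"
      have "rotate (p - i) (rotate i xs) = xs" using ij len by (simp add: rotate_rotate rotate_id)
      moreover have "rotate (p - i) (rotate j xs) = rotate (j - i) xs"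
      proof -
        have "p - i + j = (j - i) + p" using ij by auto
        then have "rotate (p - i) (rotate j xs) = rotate ((j - i) + p) xs" by (simp add: rotate_rotate)
        also have "\<dots> = rotate (j - i) xs" using len by (metis mod_add_self2 rotate_conv_mod)
        finally show ?thesis .
      qed
      ultimately have fix_xs: "rotate (j - i) xs = xs" using eq by simp
      have "\<not> p dvd (j - i)" using ij by (auto dest: dvd_imp_le)
      then have "coprime (j - i) p" using \<open>prime p\<close> by (simp add: prime_imp_coprime coprime_commute)
      then obtain t where "[(j - i) * t = Suc 0] (mod p)" using cong_solve_coprime_nat by blast
      then have "((j - i) * t) mod p = 1" using \<open>prime p\<close> prime_gt_1_nat by (auto simp: cong_def)
      then have "rotate 1 xs = xs"
        using rotate_mult_id[OF fix_xs, of t] len by (metis rotate_conv_mod)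
      then show False using assms(3)[OF xs(1)] by simp
    qed
  qed auto
  ultimately show "p dvd card X" by (simp add: card_image)
qed fact

context girth5
begin

abbreviation nbrs :: "'a \<Rightarrow> 'a set" where "nbrs x \<equiv> {y. E x y}"

definition adjacency :: "'a \<Rightarrow> 'a \<Rightarrow> int" where "adjacency x y = of_bool (E x y)"

definition codegree :: "'a \<Rightarrow> 'a \<Rightarrow> int" where "codegree x y = int (card {z. E x z \<and> E z y})"

definition far :: "'a \<Rightarrow> 'a \<Rightarrow> bool" where
  "far x y \<longleftrightarrow> x \<in> V \<and> y \<in> V \<and> x \<noteq> y \<and> \<not> E x y \<and> (\<forall>z. \<not> (E x z \<and> E z y))"

lemma E_V2: "E x y \<Longrightarrow> y \<in> V" using E_sym E_V by blast

lemma E_comm: "E x y \<longleftrightarrow> E y x" using E_sym by blast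

lemma finite_nbrs: "finite (nbrs x)"
proof -
  have "nbrs x \<subseteq> V" using E_V2 by blast
  then show ?thesis using finite_V by (rule finite_subset)
qed

lemma far_sym: "far x y \<Longrightarrow> far y x" unfolding far_def using E_comm by blast

lemma codegree_eq: "codegree x y = (\<Sum>z\<in>nbrs x. adjacency z y)"
proof -
  have "(\<Sum>z\<in>nbrs x. adjacency z y) = int (card {z \<in> nbrs x. E z y})"
    unfolding adjacency_def using finite_nbrs by (simp add: Int_def)
  then show ?thesis by (simp add: codegree_def)
qed

lemma sum_nbrs: "(\<Sum>z\<in>nbrs x. f z) = (\<Sum>z\<in>V. adjacency x z * f z)"
proof -
  have "(\<Sum>z\<in>V. adjacency x z * f z) = (\<Sum>z\<in>nbrs x. adjacency x z * f z)"
    by (rule sum.mono_neutral_right) (use finite_V E_V2 in \<open>auto simp: adjacency_def\<close>)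
  then show ?thesis by (simp add: adjacency_def)
qed

text \<open>
  With \<open>A\<close> the adjacency matrix and \<open>D\<close> the matrix of the relation \<open>far\<close>, this is the identity
  \<open>A + A\<^sup>2 + D = J + (k - 1) I\<close>, where \<open>J\<close> is the all-ones matrix.
\<close>
lemma decomposition:
  assumes "x \<in> V" "y \<in> V"
  shows "adjacency x y + codegree x y + of_bool (far x y) = 1 + (int k - 1) * of_bool (x = y)"
proof (cases "x = y")
  case True
  then have "{z. E x z \<and> E z y} = nbrs x" using E_comm by blast
  then show ?thesis using True assms degree no_loop by (simp add: adjacency_def codegree_def far_def)
next
  case False
  have "codegree x y = of_bool (\<exists>z. E x z \<and> E z y)"
  proof (cases "\<exists>z. E x z \<and> E z y")
    case True
    then obtain z where "E x z" "E z y" by blast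
    then have "{z. E x z \<and> E z y} = {z}" using no_quad[of x _ y] False by blast
    then show ?thesis using True by (simp add: codegree_def)
  next
    case False
    then have e: "{z. E x z \<and> E z y} = {}" by blast
    have "codegree x y = 0" unfolding codegree_def e by simp
    then show ?thesis using False by simp
  qed
  moreover have "\<not> (E x y \<and> (\<exists>z. E x z \<and> E z y))" using no_triangle[of x _ y] E_sym[of x y] by blast
  ultimately show ?thesis using False assms by (auto simp: adjacency_def far_def)
qed

lemma sum_a:
  assumes "x \<in> V" shows "(\<Sum>y\<in>V. adjacency x y) = int k"
proof -
  have "(\<Sum>y\<in>V. adjacency x y * 1) = (\<Sum>y\<in>nbrs x. 1)" by (rule sum_nbrs[symmetric])
  then show ?thesis using degree[OF assms] by simp
qed

lemma sum_c: "x \<in> V \<Longrightarrow> (\<Sum>y\<in>V. codegree x y) = int k * int k"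
proof -
  assume x: "x \<in> V"
  have "(\<Sum>y\<in>V. codegree x y) = (\<Sum>z\<in>nbrs x. \<Sum>y\<in>V. adjacency z y)" unfolding codegree_eq by (rule sum.swap)
  also have "\<dots> = (\<Sum>z\<in>nbrs x. int k)" using sum_a E_V2 by (intro sum.cong) auto
  finally show ?thesis using degree[OF x] by simp
qed

lemma card_far: "x \<in> V \<Longrightarrow> int (card {y. far x y}) = int (card V) - int k * int k - 1"
proof -
  assume x: "x \<in> V"
  have "(\<Sum>y\<in>V. adjacency x y + codegree x y + of_bool (far x y)) = (\<Sum>y\<in>V. 1 + (int k - 1) * of_bool (x = y))"
    using decomposition x by (intro sum.cong) auto
  moreover have "(\<Sum>y\<in>V. of_bool (far x y)) = int (card {y. far x y})"
  proof -
    have "V \<inter> Collect (far x) = Collect (far x)" by (auto simp: far_def)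
    then show ?thesis using finite_V by simp
  qed
  moreover have "(\<Sum>y\<in>V. (int k - 1) * of_bool (x = y)) = int k - 1"
    using x finite_V by (simp add: of_bool_def sum_distrib_left[symmetric] sum.delta)
  ultimately show ?thesis using sum_a[OF x] sum_c[OF x] by (simp add: sum.distrib)
qed

lemma moore_bound: "V \<noteq> {} \<Longrightarrow> k * k + 1 \<le> card V"
proof -
  assume "V \<noteq> {}"
  then obtain x where "x \<in> V" by blast
  from card_far[OF this] have "int (k * k + 1) \<le> int (card V)" by simp
  then show ?thesis by linarith
qed

lemma even_order: "odd k \<Longrightarrow> even (card V)"
proof -
  assume "odd k"
  have "even (card (SIGMA x:V. nbrs x))"
  proof (rule even_card_involution[where f = prod.swap])
    show "finite (SIGMA x:V. nbrs x)" using finite_V finite_nbrs by blast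
    fix e assume "e \<in> (SIGMA x:V. nbrs x)"
    then obtain x y where e: "e = (x, y)" "E x y" by blast
    then have "E y x" "y \<in> V" "x \<noteq> y" using E_sym E_V2 no_loop by blast+
    with e show "prod.swap e \<in> (SIGMA x:V. nbrs x) \<and> prod.swap (prod.swap e) = e \<and> prod.swap e \<noteq> e"
      by simp
  qed
  also have "card (SIGMA x:V. nbrs x) = card V * k"
    using finite_V finite_nbrs degree by simp
  finally show ?thesis using \<open>odd k\<close> by simp
qed

text \<open>
  A walk is the list of its vertices without the last one. In this form the closed walks of a fixed
  length are closed under rotation.
\<close>
fun walks :: "nat \<Rightarrow> 'a \<Rightarrow> 'a \<Rightarrow> 'a list set" where
  "walks 0 x y = (if x = y then {[]} else {})"
| "walks (Suc n) x y = (\<Union>z\<in>nbrs x. (#) x ` walks n z y)"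

lemma walks_iff: "xs \<in> walks n x y \<longleftrightarrow> length xs = n \<and> successively E (xs @ [y]) \<and> hd (xs @ [y]) = x"
proof (induction n arbitrary: x xs)
  case (Suc n)
  show ?case
  proof (cases xs)
    case (Cons z zs)
    have "xs \<in> walks (Suc n) x y \<longleftrightarrow> z = x \<and> (\<exists>w. E x w \<and> zs \<in> walks n w y)" using Cons by auto
    also have "\<dots> \<longleftrightarrow> z = x \<and> E x (hd (zs @ [y])) \<and> length zs = n \<and> successively E (zs @ [y])"
      unfolding Suc.IH by auto
    also have "\<dots> \<longleftrightarrow> length xs = Suc n \<and> successively E (xs @ [y]) \<and> hd (xs @ [y]) = x"
      using Cons by (auto simp: successively_Cons)
    finally show ?thesis .
  qed auto
qed auto

lemma finite_walks: "finite (walks n x y)"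
proof (induction n arbitrary: x)
  case (Suc n)
  show ?case unfolding walks.simps by (intro finite_UN_I finite_nbrs finite_imageI Suc.IH)
qed simp

lemma card_walks_Suc: "int (card (walks (Suc n) x y)) = (\<Sum>z\<in>nbrs x. int (card (walks n z y)))"
proof -
  have "walks n z y \<inter> walks n w y = {}" if "z \<noteq> w" for z w
    using that by (auto simp: walks_iff)
  then have "card (walks (Suc n) x y) = (\<Sum>z\<in>nbrs x. card ((#) x ` walks n z y))"
    unfolding walks.simps by (intro card_UN_disjoint) (auto simp: finite_nbrs finite_walks)
  then show ?thesis by (simp add: card_image)
qed

lemma closed_walks_dvd:
  assumes "prime p"
  shows "int p dvd (\<Sum>x\<in>V. int (card (walks p x x)))"
proof -
  define W where "W = (\<Union>x\<in>V. walks p x x)"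
  have p: "p > 1" using assms prime_gt_1_nat by blast
  have W: "xs \<in> W \<longleftrightarrow> length xs = p \<and> successively E (xs @ [hd xs])" for xs
  proof (cases xs)
    case (Cons x ys)
    have "x \<in> V" if "successively E (xs @ [hd xs])"
      using that Cons E_V by (cases ys) auto
    then show ?thesis using Cons by (auto simp: W_def walks_iff)
  qed (use p in \<open>auto simp: W_def walks_iff\<close>)
  have "p dvd card W"
  proof (rule prime_dvd_card_rotation[OF assms])
    show "finite W" unfolding W_def using finite_V finite_walks by blast
    fix xs assume "xs \<in> W"
    then have xs: "length xs = p" "successively E (xs @ [hd xs])" by (auto simp: W)
    then obtain x y ys where xs_eq: "xs = x # y # ys" using p by (cases xs; cases "tl xs") auto
    have "successively E (rotate1 xs @ [hd (rotate1 xs)])"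
      using xs(2) by (cases ys) (auto simp: xs_eq hd_append successively_append_iff successively_Cons)
    then have "rotate1 xs \<in> W" using xs(1) by (simp add: W)
    moreover have "rotate1 xs \<noteq> xs"
    proof
      assume "rotate1 xs = xs"
      then have "y = x" using xs_eq by simp
      then show False using xs(2) no_loop by (simp add: xs_eq)
    qed
    ultimately show "length xs = p \<and> rotate1 xs \<in> W \<and> rotate1 xs \<noteq> xs" using xs(1) by blast
  qed
  also have "card W = (\<Sum>x\<in>V. card (walks p x x))"
    unfolding W_def
  proof (rule card_UN_disjoint)
    have "x = y" if "xs \<in> walks p x x" "xs \<in> walks p y y" for x y xs
      using that p by (cases xs) (auto simp: walks_iff)
    then show "\<forall>x\<in>V. \<forall>y\<in>V. x \<noteq> y \<longrightarrow> walks p x x \<inter> walks p y y = {}" by blast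
  qed (use finite_V finite_walks in blast)+
  finally show ?thesis by (metis int_dvd_int_iff of_nat_sum)
qed

text \<open>
  If no two vertices are far, then \<open>A\<^sup>2 = 4I - A + J\<close>, so all powers of \<open>A\<close> are combinations of \<open>I\<close>,
  \<open>A\<close> and \<open>J\<close>. From \<open>A\<^sup>7 = -260 I + 181 A + 2980 J\<close> one reads off \<open>26 \<sqdot> 2720\<close> closed walks of
  length 7, which is not a multiple of 7.
\<close>
lemma no_moore_graph_5:
  assumes "k = 5" shows "card V \<noteq> 26"
proof
  assume "card V = 26"
  have not_far: "\<not> far x y" for x y
  proof
    assume f: "far x y"
    then have "x \<in> V" by (simp add: far_def)
    from card_far[OF this] \<open>k = 5\<close> \<open>card V = 26\<close> have "card {y. far x y} = 0" by simp
    moreover have "finite {y. far x y}" by (rule finite_subset[OF _ finite_V]) (auto simp: far_def)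
    ultimately show False using f by simp
  qed
  define good where "good n \<alpha> \<beta> \<gamma> \<longleftrightarrow>
    (\<forall>x\<in>V. \<forall>y\<in>V. int (card (walks n x y)) = \<alpha> * of_bool (x = y) + \<beta> * adjacency x y + \<gamma>)" for n and \<alpha> \<beta> \<gamma> :: int
  have step: "good (Suc n) (4 * \<beta>) (\<alpha> - \<beta>) (\<beta> + 5 * \<gamma>)" if "good n \<alpha> \<beta> \<gamma>" for n \<alpha> \<beta> \<gamma>
    unfolding good_def
  proof (intro ballI)
    fix x y assume xy: "x \<in> V" "y \<in> V"
    have "int (card (walks (Suc n) x y)) = (\<Sum>z\<in>nbrs x. \<alpha> * of_bool (z = y) + \<beta> * adjacency z y + \<gamma>)"
      unfolding card_walks_Suc using that xy E_V2 by (intro sum.cong) (auto simp: good_def)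
    also have "\<dots> = \<alpha> * adjacency x y + \<beta> * codegree x y + 5 * \<gamma>"
    proof -
      have "(\<Sum>z\<in>nbrs x. of_bool (z = y)) = adjacency x y"
        using finite_nbrs by (simp add: of_bool_def adjacency_def)
      then show ?thesis
        using degree[OF xy(1)] \<open>k = 5\<close> by (simp add: sum.distrib codegree_eq sum_distrib_left[symmetric])
    qed
    also have "codegree x y = 1 + 4 * of_bool (x = y) - adjacency x y"
      using decomposition[OF xy] not_far \<open>k = 5\<close> by simp
    finally show "int (card (walks (Suc n) x y)) = 4 * \<beta> * of_bool (x = y) + (\<alpha> - \<beta>) * adjacency x y + (\<beta> + 5 * \<gamma>)"
      by (simp add: algebra_simps)
  qed
  have "good 0 1 0 0" by (simp add: good_def)
  from step[OF step[OF step[OF step[OF step[OF step[OF step[OF this]]]]]]]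
  have "good 7 (-260) 181 2980" by (simp add: eval_nat_numeral)
  then have "(\<Sum>x\<in>V. int (card (walks 7 x x))) = (\<Sum>x\<in>V. 2720)"
    using no_loop by (intro sum.cong) (auto simp: good_def adjacency_def)
  moreover have "prime (7::nat)" by simp
  ultimately have "(7::int) dvd 70720"
    using closed_walks_dvd[of 7] \<open>card V = 26\<close> by simp
  then show False by simp
qed

end

section \<open>Two vertices at distance greater than 2: lines and orbits\<close>

text \<open>
  The matrix \<open>D = J + (k - 1) I - A - A\<^sup>2\<close> commutes with \<open>A\<close>, because \<open>J\<close> does by regularity.
\<close>
lemma (in girth5) far_commute:
  assumes "x \<in> V" "y \<in> V"
  shows "(\<Sum>z\<in>V. adjacency x z * of_bool (far z y)) = (\<Sum>z\<in>V. of_bool (far x z) * adjacency z y)"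
proof -
  have a_comm: "adjacency u v = adjacency v u" for u v by (simp add: adjacency_def E_comm[of u v])
  have c_sum: "codegree u v = (\<Sum>w\<in>V. adjacency u w * adjacency w v)" for u v
    unfolding codegree_eq by (rule sum_nbrs)
  have far_z: "of_bool (far u v) = 1 + (int k - 1) * of_bool (u = v) - adjacency u v - codegree u v"
    if "u \<in> V" "v \<in> V" for u v using decomposition[OF that] by linarith
  have ring: "p * (1 + q * r - s - t) = p + q * (p * r) - p * s - p * t"
    and ring': "p + q * (r * p) - s * p - t * p = (1 + q * r - s - t) * p" for p q r s t :: int
    by (simp_all add: algebra_simps)
  have assoc: "(\<Sum>z\<in>V. adjacency x z * codegree z y) = (\<Sum>z\<in>V. codegree x z * adjacency z y)"
  proof -
    have "(\<Sum>z\<in>V. adjacency x z * codegree z y) = (\<Sum>z\<in>V. \<Sum>w\<in>V. adjacency x z * adjacency z w * adjacency w y)"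
      by (simp add: c_sum sum_distrib_left mult.assoc)
    also have "\<dots> = (\<Sum>w\<in>V. \<Sum>z\<in>V. adjacency x z * adjacency z w * adjacency w y)" by (rule sum.swap)
    also have "\<dots> = (\<Sum>z\<in>V. codegree x z * adjacency z y)" by (simp add: c_sum sum_distrib_right)
    finally show ?thesis .
  qed
  have delta: "(\<Sum>z\<in>V. adjacency x z * of_bool (z = y)) = adjacency x y" "(\<Sum>z\<in>V. of_bool (x = z) * adjacency z y) = adjacency x y"
    using assms finite_V by (simp_all add: of_bool_def sum.delta if_distrib if_distribR cong: if_cong)
  have sum_a': "(\<Sum>z\<in>V. adjacency z y) = int k" using sum_a[OF assms(2)] a_comm by simp
  have "(\<Sum>z\<in>V. adjacency x z * of_bool (far z y))
      = (\<Sum>z\<in>V. adjacency x z + (int k - 1) * (adjacency x z * of_bool (z = y)) - adjacency x z * adjacency z y - adjacency x z * codegree z y)"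
  proof (rule sum.cong[OF refl])
    fix z assume z: "z \<in> V"
    show "adjacency x z * of_bool (far z y) = adjacency x z + (int k - 1) * (adjacency x z * of_bool (z = y))
        - adjacency x z * adjacency z y - adjacency x z * codegree z y"
      unfolding far_z[OF z assms(2)] by (rule ring)
  qed
  also have "\<dots> = (\<Sum>z\<in>V. adjacency x z) + (int k - 1) * (\<Sum>z\<in>V. adjacency x z * of_bool (z = y))
       - (\<Sum>z\<in>V. adjacency x z * adjacency z y) - (\<Sum>z\<in>V. adjacency x z * codegree z y)"
    by (simp only: sum.distrib sum_subtractf sum_distrib_left)
  also have "\<dots> = (\<Sum>z\<in>V. adjacency z y) + (int k - 1) * (\<Sum>z\<in>V. of_bool (x = z) * adjacency z y)
       - (\<Sum>z\<in>V. adjacency x z * adjacency z y) - (\<Sum>z\<in>V. codegree x z * adjacency z y)"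
    using sum_a[OF assms(1)] sum_a' delta assoc by simp
  also have "\<dots> = (\<Sum>z\<in>V. adjacency z y + (int k - 1) * (of_bool (x = z) * adjacency z y) - adjacency x z * adjacency z y - codegree x z * adjacency z y)"
    by (simp only: sum.distrib sum_subtractf sum_distrib_left)
  also have "\<dots> = (\<Sum>z\<in>V. of_bool (far x z) * adjacency z y)"
  proof (rule sum.cong[OF refl])
    fix z assume z: "z \<in> V"
    show "adjacency z y + (int k - 1) * (of_bool (x = z) * adjacency z y) - adjacency x z * adjacency z y
        - codegree x z * adjacency z y = of_bool (far x z) * adjacency z y"
      unfolding far_z[OF assms(1) z] by (rule ring')
  qed
  finally show ?thesis .
qed

locale excess_two = girth5 +
  assumes order: "card V = k * k + 3"
begin

lemma far_V: "far x y \<Longrightarrow> x \<in> V" "far x y \<Longrightarrow> y \<in> V" "far x y \<Longrightarrow> x \<noteq> y" "far x y \<Longrightarrow> \<not> E x y"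
  by (auto simp: far_def)

lemma card_far_2: "x \<in> V \<Longrightarrow> card {y. far x y} = 2"
  using card_far[of x] order by simp

text \<open>
  Every vertex of \<open>excess_two\<close> has two far vertices, so the relation \<open>far\<close> is a disjoint union of
  cycles. A line runs along such a cycle; indexing it by all integers makes the length of the cycle
  a period and avoids modular arithmetic on indices.
\<close>
definition far_line :: "(int \<Rightarrow> 'a) \<Rightarrow> bool" where
  "far_line \<phi> \<longleftrightarrow> (\<forall>i. {y. far (\<phi> i) y} = {\<phi> (i - 1), \<phi> (i + 1)} \<and> \<phi> (i - 1) \<noteq> \<phi> (i + 1))"

lemma far_line_V: "far_line \<phi> \<Longrightarrow> \<phi> i \<in> V"
  unfolding far_line_def using far_V by blast

lemma far_line_far: "far_line \<phi> \<Longrightarrow> far (\<phi> i) y \<longleftrightarrow> y = \<phi> (i - 1) \<or> y = \<phi> (i + 1)"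
  unfolding far_line_def by blast

lemma far_line_neq: "far_line \<phi> \<Longrightarrow> \<phi> (i - 1) \<noteq> \<phi> (i + 1)"
  unfolding far_line_def by blast

lemma far_line_shift:
  assumes "far_line \<phi>" shows "far_line (\<lambda>i. \<phi> (s + i))"
  unfolding far_line_def
proof
  fix i
  have "s + (i - 1) = s + i - 1" "s + (i + 1) = s + i + 1" by auto
  then show "{y. far (\<phi> (s + i)) y} = {\<phi> (s + (i - 1)), \<phi> (s + (i + 1))} \<and> \<phi> (s + (i - 1)) \<noteq> \<phi> (s + (i + 1))"
    using assms unfolding far_line_def by presburger
qed

lemma far_line_reflect:
  assumes "far_line \<phi>" shows "far_line (\<lambda>i. \<phi> (s - i))"
  unfolding far_line_def
proof
  fix i
  have "s - (i - 1) = s - i + 1" "s - (i + 1) = s - i - 1" by auto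
  moreover have "{y. far (\<phi> (s - i)) y} = {\<phi> (s - i - 1), \<phi> (s - i + 1)}" "\<phi> (s - i - 1) \<noteq> \<phi> (s - i + 1)"
    using assms unfolding far_line_def by blast+
  ultimately show "{y. far (\<phi> (s - i)) y} = {\<phi> (s - (i - 1)), \<phi> (s - (i + 1))} \<and> \<phi> (s - (i - 1)) \<noteq> \<phi> (s - (i + 1))"
    by (metis insert_commute)
qed

definition far_next :: "'a \<times> 'a \<Rightarrow> 'a \<times> 'a" where
  "far_next = (\<lambda>(u, v). (v, SOME w. far v w \<and> w \<noteq> u))"

lemma far_next: 
  assumes "far u v" obtains w where "far_next (u, v) = (v, w)" "{y. far v y} = {u, w}" "u \<noteq> w" "far v w"
proof -
  have v: "far v u" "v \<in> V" using assms far_sym far_V by blast+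
  then obtain p q where pq: "{y. far v y} = {p, q}" "p \<noteq> q"
    using card_far_2 by (metis card_2_iff)
  define w where "w = (SOME w. far v w \<and> w \<noteq> u)"
  have "\<exists>w. far v w \<and> w \<noteq> u" using pq by blast
  then have "far v w \<and> w \<noteq> u" unfolding w_def by (rule someI_ex)
  moreover have "{y. far v y} = {u, w}"
  proof -
    have "u \<in> {p, q}" "w \<in> {p, q}" unfolding pq(1)[symmetric] using v \<open>far v w \<and> w \<noteq> u\<close> by simp_all
    then show ?thesis using pq \<open>far v w \<and> w \<noteq> u\<close> by auto
  qed
  ultimately show thesis using that[of w] by (auto simp: far_next_def w_def)
qed

lemma far_line_exists:
  assumes "x \<in> V" obtains \<phi> where "far_line \<phi>" "\<phi> 0 = x"
proof -
  obtain p q where pq: "{y. far x y} = {p, q}" "p \<noteq> q" using card_far_2[OF assms] by (metis card_2_iff)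
  have xp: "far x p" and xq: "far x q" using pq(1) by blast+
  define f where "f u n = fst ((far_next ^^ n) (x, u))" for u n
  have far_step: "far (fst e) (snd e) \<Longrightarrow> far (fst (far_next e)) (snd (far_next e))" for e
    using far_next by (metis fst_conv snd_conv prod.collapse)
  have arc: "far (fst ((far_next ^^ n) (x, u))) (snd ((far_next ^^ n) (x, u)))" if "far x u" for u n
    by (induction n) (use that far_step in simp_all)
  have snd_f: "snd ((far_next ^^ n) (x, u)) = f u (Suc n)" for u n
    by (simp add: f_def far_next_def split_beta)
  have f: "{y. far (f u (Suc n)) y} = {f u n, f u (Suc (Suc n))} \<and> f u n \<noteq> f u (Suc (Suc n))" if "far x u" for u n
  proof -
    have ar: "far (f u n) (f u (Suc n))" using arc[OF that, of n] snd_f by (simp add: f_def)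
    obtain w where w: "far_next (f u n, f u (Suc n)) = (f u (Suc n), w)"
        "{y. far (f u (Suc n)) y} = {f u n, w}" "f u n \<noteq> w" using far_next[OF ar] by metis
    have "(far_next ^^ n) (x, u) = (f u n, f u (Suc n))" using snd_f by (simp add: f_def prod_eq_iff)
    then have "(far_next ^^ Suc n) (x, u) = (f u (Suc n), w)" using w by simp
    then have "w = f u (Suc (Suc n))" using snd_f by (metis snd_conv)
    with w show ?thesis by simp
  qed
  have f01: "f u 0 = x" "f u (Suc 0) = u" for u by (simp_all add: f_def far_next_def)
  define \<phi> where "\<phi> i = (if i \<ge> 0 then f p (nat i) else f q (nat (- i)))" for i
  have "{y. far (\<phi> i) y} = {\<phi> (i - 1), \<phi> (i + 1)} \<and> \<phi> (i - 1) \<noteq> \<phi> (i + 1)" for i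
  proof (cases i "0 :: int" rule: linorder_cases)
    case less
    then obtain n where i: "i = - int (Suc n)" by (metis negD minus_minus)
    have nonpos: "\<phi> (- int j) = f q j" for j by (cases j) (simp_all add: \<phi>_def f01 nat_add_distrib)
    have "i + 1 = - int n" "i - 1 = - int (Suc (Suc n))" using i by simp_all
    then have "\<phi> i = f q (Suc n)" "\<phi> (i + 1) = f q n" "\<phi> (i - 1) = f q (Suc (Suc n))"
      unfolding i using nonpos by metis+
    then show ?thesis using f[OF xq, of n] by auto
  next
    case equal
    then show ?thesis using pq by (auto simp: \<phi>_def f01)
  next
    case greater
    then obtain n where i: "i = int (Suc n)" by (metis gr0_conv_Suc zero_less_imp_eq_int)
    have nonneg: "\<phi> (int j) = f p j" for j by (simp add: \<phi>_def)
    have "i - 1 = int n" "i + 1 = int (Suc (Suc n))" using i by simp_all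
    then have "\<phi> i = f p (Suc n)" "\<phi> (i - 1) = f p n" "\<phi> (i + 1) = f p (Suc (Suc n))"
      unfolding i using nonneg by metis+
    then show ?thesis using f[OF xp, of n] by auto
  qed
  then have "far_line \<phi>" by (simp add: far_line_def)
  moreover have "\<phi> 0 = x" by (simp add: \<phi>_def f01)
  ultimately show thesis by (rule that)
qed

lemma far_line_unique:
  assumes "far_line \<phi>" "far_line \<psi>" "\<phi> 0 = \<psi> 0" "\<phi> 1 = \<psi> 1"
  shows "\<phi> i = \<psi> i"
proof -
  have up: "\<phi> (int n) = \<psi> (int n) \<and> \<phi> (int n + 1) = \<psi> (int n + 1)" 
    if "far_line \<phi>" "far_line \<psi>" "\<phi> 0 = \<psi> 0" "\<phi> 1 = \<psi> 1" for \<phi> \<psi> n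
  proof (induction n)
    case (Suc n)
    have "{\<phi> (int n), \<phi> (int n + 2)} = {\<psi> (int n), \<psi> (int n + 2)}" 
      "\<phi> (int n) \<noteq> \<phi> (int n + 2)" "\<psi> (int n) \<noteq> \<psi> (int n + 2)"
      using that(1,2) Suc unfolding far_line_def by (metis add_diff_cancel_right' add.assoc one_add_one)+
    then have "\<phi> (int n + 2) = \<psi> (int n + 2)" using Suc by (metis doubleton_eq_iff)
    then show ?case using Suc by (simp add: algebra_simps)
  qed (use that in simp)
  have "\<phi> (-1) = \<psi> (-1)"
    using assms far_line_far[of \<phi> 0 "\<phi> (-1)"] far_line_far[of \<psi> 0 "\<phi> (-1)"] far_line_neq[of \<phi> 0] by auto
  then have "\<phi> (- int n) = \<psi> (- int n)" for n
    using up[OF far_line_reflect[OF assms(1), of 0] far_line_reflect[OF assms(2), of 0], of n] assms by simp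
  moreover have "\<phi> (int n) = \<psi> (int n)" for n using up[OF assms] by blast
  ultimately show ?thesis by (metis int_cases2)
qed

text \<open>
  Two visits of a line to the same vertex happen in the same direction. If the directions were opposite,
  the line would be symmetric about the middle of the two indices, where either the two far vertices of a
  vertex coincide or a vertex is far from itself.
\<close>
lemma far_line_period:
  assumes "far_line \<phi>" "\<phi> i = \<phi> j"
  shows "\<phi> (i + t) = \<phi> (j + t)"
proof -
  have "\<phi> (j + 1) = \<phi> (i - 1) \<or> \<phi> (j + 1) = \<phi> (i + 1)"
    using assms far_line_far by metis
  then show ?thesis
  proof
    assume "\<phi> (j + 1) = \<phi> (i + 1)"
    then show ?thesis
      using far_line_unique[of "\<lambda>n. \<phi> (i + n)" "\<lambda>n. \<phi> (j + n)" t] assms far_line_shift by simp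
  next
    assume "\<phi> (j + 1) = \<phi> (i - 1)"
    then have refl: "\<phi> (i - n) = \<phi> (j + n)" for n
      using far_line_unique[of "\<lambda>n. \<phi> (i - n)" "\<lambda>n. \<phi> (j + n)" n] assms far_line_shift far_line_reflect by simp
    define n where "n = (i - j) div 2"
    have "i - j = 2 * n \<or> i - j = 2 * n + 1" unfolding n_def by presburger
    then show ?thesis
    proof
      assume "i - j = 2 * n"
      then have "i - (n + 1) = (j + n) - 1" by simp
      then have "\<phi> ((j + n) - 1) = \<phi> ((j + n) + 1)" using refl[of "n + 1"] by (simp add: algebra_simps)
      then show ?thesis using far_line_neq assms(1) by blast
    next
      assume "i - j = 2 * n + 1"
      then have "i - n = (j + n) + 1" by simp
      then have "\<phi> (j + n) = \<phi> ((j + n) + 1)" using refl[of n] by metis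
      moreover have "far (\<phi> (j + n)) (\<phi> ((j + n) + 1))" using far_line_far[OF assms(1)] by blast
      ultimately show ?thesis using far_V(3) by blast
    qed
  qed
qed

definition closed_line :: "(int \<Rightarrow> 'a) \<Rightarrow> nat \<Rightarrow> bool" where
  "closed_line \<phi> m \<longleftrightarrow> far_line \<phi> \<and> 3 \<le> m \<and> (\<forall>i j. \<phi> i = \<phi> j \<longleftrightarrow> int m dvd i - j)"

lemma closed_line_exists:
  assumes "x \<in> V" obtains \<phi> m where "closed_line \<phi> m" "\<phi> 0 = x"
proof -
  obtain \<phi> where \<phi>: "far_line \<phi>" "\<phi> 0 = x" using far_line_exists[OF assms] .
  have "\<not> inj (\<lambda>n. \<phi> (int n))"
  proof
    assume "inj (\<lambda>n. \<phi> (int n))"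
    then have "infinite (range (\<lambda>n. \<phi> (int n)))" using finite_imageD by blast
    moreover have "range (\<lambda>n. \<phi> (int n)) \<subseteq> V" using far_line_V[OF \<phi>(1)] by blast
    ultimately show False using finite_V finite_subset by blast
  qed
  then obtain i j where ij: "\<phi> (int i) = \<phi> (int j)" "i < j" by (metis injI linorder_neqE_nat)
  have "\<phi> (int (j - i)) = \<phi> 0"
    using far_line_period[OF \<phi>(1) ij(1), of "- int i"] ij(2) by (simp add: of_nat_diff)
  moreover have "0 < j - i" using ij by simp
  ultimately have ex: "\<exists>m. 0 < m \<and> \<phi> (int m) = \<phi> 0" by blast
  define m where "m = (LEAST m. 0 < m \<and> \<phi> (int m) = \<phi> 0)"
  have m: "0 < m" "\<phi> (int m) = \<phi> 0" unfolding m_def using LeastI_ex[OF ex] by blast+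
  have least: "\<phi> (int n) \<noteq> \<phi> 0" if "0 < n" "n < m" for n using not_less_Least that unfolding m_def by blast
  have step: "\<phi> (int m + t) = \<phi> t" for t using far_line_period[OF \<phi>(1) m(2), of t] by simp
  have mult: "\<phi> (int m * int n + t) = \<phi> t" for n t
  proof (induction n arbitrary: t)
    case (Suc n)
    have "\<phi> (int m * int (Suc n) + t) = \<phi> (int m * int n + (int m + t))" by (simp add: algebra_simps)
    then show ?case using Suc step by simp
  qed simp
  have mult_int: "\<phi> (int m * s + t) = \<phi> t" for s t
  proof (cases "s \<ge> 0")
    case False
    have "\<phi> (int m * int (nat (- s)) + (int m * s + t)) = \<phi> (int m * s + t)" by (rule mult)
    then show ?thesis using False by (simp add: algebra_simps)
  qed (use mult[of "nat s" t] in simp)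
  have eq: "\<phi> i = \<phi> j \<longleftrightarrow> int m dvd i - j" for i j
  proof
    assume "int m dvd i - j"
    then obtain s where "i - j = int m * s" by blast
    then have "i = int m * s + j" by simp
    then show "\<phi> i = \<phi> j" using mult_int by metis
  next
    assume "\<phi> i = \<phi> j"
    then have "\<phi> (i - j) = \<phi> 0" using far_line_period[OF \<phi>(1), of i j "- j"] by simp
    then have "\<phi> ((i - j) mod int m) = \<phi> 0" using mult_int[of "(i - j) div int m" "(i - j) mod int m"] by simp
    moreover have "(i - j) mod int m = int (nat ((i - j) mod int m))" "nat ((i - j) mod int m) < m" 
      using m(1) by (simp_all add: nat_less_iff)
    ultimately have "nat ((i - j) mod int m) = 0" using least by (metis neq0_conv)
    then show "int m dvd i - j" using m(1) by (simp add: dvd_eq_mod_eq_0) (metis Euclidean_Rings.pos_mod_sign nat_0_iff of_nat_0_less_iff order_antisym)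
  qed
  have "\<phi> 0 \<noteq> \<phi> 1" using far_line_far[OF \<phi>(1), of 0 "\<phi> 1"] far_V(3) by auto
  moreover have "\<phi> 1 \<noteq> \<phi> (-1)" using far_line_neq[OF \<phi>(1), of 0] by simp
  ultimately have "m \<noteq> 1" "m \<noteq> 2" using eq[of 0 1] eq[of 1 "-1"] by auto
  then have "closed_line \<phi> m" using \<phi>(1) m(1) eq by (simp add: closed_line_def)
  then show thesis using \<phi>(2) that by blast
qed


definition orbit :: "'a \<Rightarrow> 'a set" where "orbit x = {y. far\<^sup>*\<^sup>* x y}"

lemma orbit_self: "x \<in> orbit x" by (simp add: orbit_def)

lemma orbit_eq: "y \<in> orbit x \<Longrightarrow> orbit y = orbit x"
proof -
  assume "y \<in> orbit x"
  then have "far\<^sup>*\<^sup>* x y" by (simp add: orbit_def)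
  moreover have "symp far" using far_sym by (auto intro: sympI)
  ultimately have "far\<^sup>*\<^sup>* y x" by (metis symp_rtranclp sympD)
  with \<open>far\<^sup>*\<^sup>* x y\<close> show ?thesis unfolding orbit_def by (blast intro: rtranclp_trans)
qed

lemma orbit_disjoint: "orbit x \<noteq> orbit y \<Longrightarrow> orbit x \<inter> orbit y = {}"
  using orbit_eq by blast

lemma orbit_far: "far x y \<Longrightarrow> y \<in> orbit x" by (auto simp: orbit_def)

lemma orbit_V: "x \<in> V \<Longrightarrow> orbit x \<subseteq> V"
proof
  fix y assume "x \<in> V" "y \<in> orbit x"
  then have "far\<^sup>*\<^sup>* x y" by (simp add: orbit_def)
  then show "y \<in> V" using \<open>x \<in> V\<close> far_V(2) by (induction) auto
qed

lemma finite_orbit: "x \<in> V \<Longrightarrow> finite (orbit x)"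
  using orbit_V finite_V finite_subset by blast

lemma closed_line_far_line: "closed_line \<phi> m \<Longrightarrow> far_line \<phi>" by (simp add: closed_line_def)

lemma closed_line_eq: "closed_line \<phi> m \<Longrightarrow> \<phi> i = \<phi> j \<longleftrightarrow> int m dvd i - j" by (simp add: closed_line_def)

lemma closed_line_ge: "closed_line \<phi> m \<Longrightarrow> 3 \<le> m" by (simp add: closed_line_def)

lemma closed_line_shift: "closed_line \<phi> m \<Longrightarrow> closed_line (\<lambda>i. \<phi> (s + i)) m"
  unfolding closed_line_def using far_line_shift by simp

lemma closed_line_range:
  assumes "closed_line \<phi> m" shows "range \<phi> = orbit (\<phi> i)"
proof
  note fl = closed_line_far_line[OF assms]
  have step: "\<phi> (j + 1) \<in> orbit (\<phi> j)" "\<phi> (j - 1) \<in> orbit (\<phi> j)" for j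
    using far_line_far[OF fl] orbit_far by blast+
  have "\<phi> (i + int n) \<in> orbit (\<phi> i)" for n
  proof (induction n)
    case (Suc n)
    then show ?case using step(1)[of "i + int n"] orbit_eq by (metis add.assoc int_Suc add.commute)
  qed (simp add: orbit_self)
  moreover have "\<phi> (i - int n) \<in> orbit (\<phi> i)" for n
  proof (induction n)
    case (Suc n)
    have "i - int (Suc n) = i - int n - 1" by simp
    then show ?case using Suc step(2)[of "i - int n"] orbit_eq by metis
  qed (simp add: orbit_self)
  moreover have "\<exists>n. j = i + int n \<or> j = i - int n" for j by presburger
  ultimately show "range \<phi> \<subseteq> orbit (\<phi> i)" by (metis image_subsetI)
  show "orbit (\<phi> i) \<subseteq> range \<phi>"
  proof
    fix y assume "y \<in> orbit (\<phi> i)"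
    then have "far\<^sup>*\<^sup>* (\<phi> i) y" by (simp add: orbit_def)
    then show "y \<in> range \<phi>"
      by induction (use far_line_far[OF fl] in auto)
  qed
qed

lemma closed_line_bij:
  assumes "closed_line \<phi> m" shows "bij_betw \<phi> {0..<int m} (orbit (\<phi> i))"
proof -
  have m: "0 < int m" using closed_line_ge[OF assms] by simp
  have "inj_on \<phi> {0..<int m}"
  proof (rule inj_onI)
    fix a b assume "a \<in> {0..<int m}" "b \<in> {0..<int m}" "\<phi> a = \<phi> b"
    then show "a = b" using closed_line_eq[OF assms] by (metis atLeastLessThan_iff mod_eq_dvd_iff mod_pos_pos_trivial)
  qed
  moreover have "\<phi> ` {0..<int m} = range \<phi>"
  proof (intro equalityI subsetI)
    fix y assume "y \<in> range \<phi>"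
    then obtain j where "y = \<phi> j" by blast
    moreover have "\<phi> j = \<phi> (j mod int m)" using closed_line_eq[OF assms] by (metis mod_eq_dvd_iff mod_mod_trivial)
    ultimately show "y \<in> \<phi> ` {0..<int m}" using m by auto
  qed auto
  ultimately show ?thesis unfolding bij_betw_def closed_line_range[OF assms, symmetric] by blast
qed

lemma closed_line_card: "closed_line \<phi> m \<Longrightarrow> card (orbit (\<phi> i)) = m"
  using bij_betw_same_card[OF closed_line_bij, of \<phi> m i] by simp

lemma closed_line_at:
  assumes "x \<in> V" obtains \<phi> where "closed_line \<phi> (card (orbit x))" "\<phi> 0 = x"
  using closed_line_exists[OF assms] closed_line_card by metis

lemma closed_line_mem: "closed_line \<phi> m \<Longrightarrow> y \<in> orbit (\<phi> i) \<Longrightarrow> \<exists>j. y = \<phi> j"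
  using closed_line_range by blast

lemma card_orbit_ge: "x \<in> V \<Longrightarrow> 3 \<le> card (orbit x)"
  by (metis closed_line_at closed_line_ge)

lemma adjacency_comm: "adjacency x y = adjacency y x"
  by (simp add: adjacency_def E_comm[of x y])

lemma adjacency_1 [simp]: "adjacency x y = 1 \<longleftrightarrow> E x y" by (simp add: adjacency_def)

lemma sum_far_line:
  assumes "far_line \<phi>"
  shows "(\<Sum>z\<in>V. of_bool (far (\<phi> i) z) * f z) = f (\<phi> (i - 1)) + (f (\<phi> (i + 1)) :: int)"
proof -
  have "(\<Sum>z\<in>V. of_bool (far (\<phi> i) z) * f z) = (\<Sum>z\<in>{\<phi> (i - 1), \<phi> (i + 1)}. of_bool (far (\<phi> i) z) * f z)"
    by (rule sum.mono_neutral_right) (use far_line_far[OF assms] far_line_V[OF assms] finite_V in auto)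
  also have "\<dots> = f (\<phi> (i - 1)) + f (\<phi> (i + 1))"
    using far_line_neq[OF assms] far_line_far[OF assms] by simp
  finally show ?thesis .
qed

text \<open>
  The commutation of adjacency and \<open>far\<close>, written in coordinates along two lines, is a discrete wave
  equation.
\<close>
lemma wave:
  assumes "far_line \<phi>" "far_line \<psi>"
  shows "adjacency (\<phi> (i + 1)) (\<psi> j) + adjacency (\<phi> (i - 1)) (\<psi> j)
       = adjacency (\<phi> i) (\<psi> (j + 1)) + adjacency (\<phi> i) (\<psi> (j - 1))"
proof -
  have far_comm: "far u v = far v u" for u v using far_sym by blast
  have "(\<Sum>z\<in>V. adjacency (\<phi> i) z * of_bool (far z (\<psi> j))) = (\<Sum>z\<in>V. of_bool (far (\<psi> j) z) * adjacency (\<phi> i) z)"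
    by (simp add: far_comm[of _ "\<psi> j"] mult.commute)
  then show ?thesis
    using far_commute[of "\<phi> i" "\<psi> j"] sum_far_line[OF assms(1), of i "\<lambda>z. adjacency z (\<psi> j)"]
      sum_far_line[OF assms(2), of j "adjacency (\<phi> i)"] far_line_V assms by simp
qed

lemma wave_nat:
  assumes "far_line \<phi>" "far_line \<psi>"
  shows "adjacency (\<phi> (i + int n)) (\<psi> j) + adjacency (\<phi> (i - int n)) (\<psi> j)
       = adjacency (\<phi> i) (\<psi> (j + int n)) + adjacency (\<phi> i) (\<psi> (j - int n))"
proof (induction n arbitrary: i j rule: less_induct)
  case (less n)
  let ?a = "\<lambda>i j. adjacency (\<phi> i) (\<psi> j)"
  consider "n = 0" | "n = 1" | t where "n = Suc (Suc t)" by (metis One_nat_def old.nat.exhaust)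
  then show ?case
  proof cases
    case 2
    then show ?thesis using wave[OF assms] by simp
  next
    case 3
    define s where "s = int t + 1"
    have n: "int n = s + 1" using 3 by (simp add: s_def)
    have "?a (i + s + 1) j + ?a (i + s - 1) j = ?a (i + s) (j + 1) + ?a (i + s) (j - 1)"
      "?a (i - s + 1) j + ?a (i - s - 1) j = ?a (i - s) (j + 1) + ?a (i - s) (j - 1)"
      using wave[OF assms] by blast+
    moreover have "?a (i + s) (j + 1) + ?a (i - s) (j + 1) = ?a i (j + 1 + s) + ?a i (j + 1 - s)"
      "?a (i + s) (j - 1) + ?a (i - s) (j - 1) = ?a i (j - 1 + s) + ?a i (j - 1 - s)"
      using less[of "Suc t"] 3 by (simp_all add: s_def add.commute)
    moreover have "?a (i + (s - 1)) j + ?a (i - (s - 1)) j = ?a i (j + (s - 1)) + ?a i (j - (s - 1))"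
      using less[of t] 3 by (simp add: s_def)
    ultimately show ?thesis unfolding n by (simp add: algebra_simps)
  qed simp
qed

text \<open>
  When \<open>\<psi>\<close> has period \<open>l\<close>, the wave equation with step \<open>l\<close> says that an entry is the mean of the two
  entries at distance \<open>l\<close> in the direction of \<open>\<phi>\<close>. For entries 0 and 1 this forces equality.
\<close>
lemma period:
  assumes "closed_line \<phi> m" "closed_line \<psi> l" "E (\<phi> i) (\<psi> j)"
  shows "E (\<phi> (i + int l * s)) (\<psi> j)"
proof -
  have step: "E (\<phi> (i + int l)) (\<psi> j) \<and> E (\<phi> (i - int l)) (\<psi> j)" if "E (\<phi> i) (\<psi> j)" for i
  proof -
    have "\<psi> (j + int l) = \<psi> j" "\<psi> (j - int l) = \<psi> j" using closed_line_eq[OF assms(2)] by simp_all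
    then have "adjacency (\<phi> (i + int l)) (\<psi> j) + adjacency (\<phi> (i - int l)) (\<psi> j) = 2"
      using wave_nat[of \<phi> \<psi> i l j] assms(1,2) closed_line_far_line that by (simp add: adjacency_def)
    then show ?thesis by (auto simp: adjacency_def of_bool_def split: if_splits)
  qed
  have "E (\<phi> (i + int l * int n)) (\<psi> j) \<and> E (\<phi> (i - int l * int n)) (\<psi> j)" for n
  proof (induction n)
    case (Suc n)
    have "i + int l * int (Suc n) = (i + int l * int n) + int l" "i - int l * int (Suc n) = (i - int l * int n) - int l"
      by (simp_all add: algebra_simps)
    then show ?case using Suc step by metis
  qed (use assms(3) in simp)
  moreover have "\<exists>n. s = int n \<or> s = - int n" by presburger
  ultimately show ?thesis by (metis mult_minus_right uminus_add_conv_diff add.commute)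
qed

text \<open>
  Shifting \<open>x\<close> along its orbit by the least common multiple keeps both neighbours, and two vertices
  have at most one common neighbour.
\<close>
lemma dvd_lcm_orbits:
  assumes "E x y" "E x z" "y \<noteq> z"
  shows "card (orbit x) dvd lcm (card (orbit y)) (card (orbit z))"
proof -
  have V: "x \<in> V" "y \<in> V" "z \<in> V" using assms E_V E_V2 by blast+
  obtain \<phi> where \<phi>: "closed_line \<phi> (card (orbit x))" "\<phi> 0 = x" using closed_line_at V(1) .
  obtain \<psi> where \<psi>: "closed_line \<psi> (card (orbit y))" "\<psi> 0 = y" using closed_line_at V(2) .
  obtain \<chi> where \<chi>: "closed_line \<chi> (card (orbit z))" "\<chi> 0 = z" using closed_line_at V(3) .
  define t where "t = lcm (card (orbit y)) (card (orbit z))"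
  obtain s s' where s: "t = card (orbit y) * s" "t = card (orbit z) * s'" unfolding t_def
    by (meson dvd_lcm1 dvd_lcm2 dvdE)
  have "E (\<phi> (0 + int (card (orbit y)) * int s)) (\<psi> 0)" "E (\<phi> (0 + int (card (orbit z)) * int s')) (\<chi> 0)"
    using period[OF \<phi>(1) \<psi>(1)] period[OF \<phi>(1) \<chi>(1)] \<phi>(2) \<psi>(2) \<chi>(2) assms(1,2) by blast+
  then have "E (\<phi> (int t)) y" "E (\<phi> (int t)) z" using s \<psi>(2) \<chi>(2) by (metis add_0 of_nat_mult)+
  then have "\<phi> (int t) = x"
    using no_quad[of x y "\<phi> (int t)" z] assms E_sym by metis
  then have "int (card (orbit x)) dvd int t - 0" using closed_line_eq[OF \<phi>(1), of "int t" 0] \<phi>(2) by simp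
  then show ?thesis unfolding t_def[symmetric] by simp
qed

text \<open>
  By induction on the distance in the orbit: the wave equation passes invariance under translation from
  distance \<open>n\<close> to distance \<open>n + 2\<close>, and at distances 0 and 1 there are no edges.
\<close>
lemma circulant:
  assumes "closed_line \<phi> m" shows "E (\<phi> i) (\<phi> (i + s)) \<longleftrightarrow> E (\<phi> 0) (\<phi> s)"
proof -
  note fl = closed_line_far_line[OF assms]
  let ?a = "\<lambda>i j. adjacency (\<phi> i) (\<phi> j)"
  have step: "?a x (x + int n) = ?a (x - 1) (x - 1 + int n)" for n x
  proof (induction n arbitrary: x rule: less_induct)
    case (less n)
    consider "n = 0" | "n = 1" | t where "n = Suc (Suc t)" by (metis One_nat_def old.nat.exhaust)
    then show ?case
    proof cases
      case 1
      then show ?thesis using no_loop by (simp add: adjacency_def)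
    next
      case 2
      have "\<not> E (\<phi> x) (\<phi> (x + 1))" for x using far_line_far[OF fl] far_V(4) by blast
      from this[of x] this[of "x - 1"] show ?thesis using 2 by (simp add: adjacency_def)
    next
      case 3
      have "?a (x + 1) (x + 1 + int t) + ?a (x - 1) (x + 1 + int t) = ?a x (x + 1 + int t + 1) + ?a x (x + 1 + int t - 1)"
        by (rule wave[OF fl fl])
      moreover have "?a (x + 1) (x + 1 + int t) = ?a x (x + int t)" using less[of t "x + 1"] 3 by simp
      ultimately show ?thesis using 3 by (simp add: algebra_simps)
    qed
  qed
  have up: "?a x (x + int n) = ?a 0 (int n)" for n x
  proof -
    have "?a (int j) (int j + int n) = ?a 0 (int n)" for j
      by (induction j) (use step[of "int (Suc _)" n] in simp_all)
    moreover have "?a (- int j) (- int j + int n) = ?a 0 (int n)" for j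
    proof (induction j)
      case (Suc j)
      have eq: "- int (Suc j) = - int j - 1" by simp
      show ?case unfolding eq using Suc step by metis
    qed simp
    ultimately show ?thesis by (metis int_cases2)
  qed
  have "?a i (i + s) = ?a 0 s"
  proof (cases "s \<ge> 0")
    case True
    then show ?thesis using up[of i "nat s"] by simp
  next
    case False
    then have "?a (i + s) i = ?a 0 (- s)" "?a s 0 = ?a 0 (- s)"
      using up[of "i + s" "nat (- s)"] up[of s "nat (- s)"] by simp_all
    then show ?thesis using adjacency_comm by metis
  qed
  then show ?thesis by (metis adjacency_1)
qed

end

section \<open>Counting neighbours in orbits\<close>

context excess_two begin

definition deg_in :: "'a \<Rightarrow> 'a set \<Rightarrow> nat" where "deg_in x S = card (nbrs x \<inter> S)"

lemma deg_in_sum: "finite S \<Longrightarrow> int (deg_in x S) = (\<Sum>y\<in>S. adjacency x y)"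
  by (simp add: deg_in_def adjacency_def Int_commute)

text \<open>
  Summing the wave equation over an orbit shows that the number of neighbours in it is a linear function
  along every line. Being periodic, it is constant.
\<close>
lemma deg_in_far:
  assumes "far x x'" "z \<in> V" shows "deg_in x' (orbit z) = deg_in x (orbit z)"
proof -
  have "x \<in> V" using assms far_V by blast
  obtain \<phi> where \<phi>: "closed_line \<phi> (card (orbit x))" "\<phi> 0 = x" using closed_line_at[OF \<open>x \<in> V\<close>] .
  obtain \<psi> where \<psi>: "closed_line \<psi> (card (orbit z))" "\<psi> 0 = z" using closed_line_at[OF assms(2)] .
  note fl = closed_line_far_line[OF \<phi>(1)] closed_line_far_line[OF \<psi>(1)]
  define S where "S i = int (deg_in (\<phi> i) (orbit z))" for i
  have shift: "(\<Sum>j\<in>{0..<int (card (orbit z))}. adjacency (\<phi> i) (\<psi> (s + j))) = S i" for i s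
  proof -
    have "orbit (\<psi> (s + 0)) = orbit z" using closed_line_range[OF \<psi>(1)] \<psi>(2) by (metis)
    then have "bij_betw (\<lambda>j. \<psi> (s + j)) {0..<int (card (orbit z))} (orbit z)"
      using closed_line_bij[OF closed_line_shift[OF \<psi>(1)], of s 0] by simp
    from sum.reindex_bij_betw[OF this, of "adjacency (\<phi> i)"] show ?thesis
      unfolding S_def using deg_in_sum finite_orbit[OF assms(2)] by simp
  qed
  have harmonic: "S (i + 1) + S (i - 1) = 2 * S i" for i
  proof -
    have "(\<Sum>j\<in>{0..<int (card (orbit z))}. adjacency (\<phi> (i + 1)) (\<psi> (0 + j)) + adjacency (\<phi> (i - 1)) (\<psi> (0 + j)))
      = (\<Sum>j\<in>{0..<int (card (orbit z))}. adjacency (\<phi> i) (\<psi> (1 + j)) + adjacency (\<phi> i) (\<psi> (- 1 + j)))"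
    proof (rule sum.cong[OF refl])
      fix j :: int
      have "0 + j = j" "1 + j = j + 1" "- 1 + j = j - 1" by auto
      then show "adjacency (\<phi> (i + 1)) (\<psi> (0 + j)) + adjacency (\<phi> (i - 1)) (\<psi> (0 + j))
        = adjacency (\<phi> i) (\<psi> (1 + j)) + adjacency (\<phi> i) (\<psi> (- 1 + j))"
        using wave[OF fl, of i j] by presburger
    qed
    then show ?thesis unfolding sum.distrib shift by simp
  qed
  have linear: "S (int n) = S 0 + int n * (S 1 - S 0)" for n
  proof (induction n rule: less_induct)
    case (less n)
    consider "n = 0" | "n = 1" | t where "n = Suc (Suc t)" by (metis One_nat_def old.nat.exhaust)
    then show ?case
    proof cases
      case 3
      then show ?thesis using less[of t] less[of "Suc t"] harmonic[of "int (Suc t)"] by (simp add: algebra_simps)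
    qed simp_all
  qed
  have "\<phi> (int (card (orbit x))) = \<phi> 0" using closed_line_eq[OF \<phi>(1)] by simp
  then have "S (int (card (orbit x))) = S 0" by (simp add: S_def)
  then have "S 1 = S 0" using linear[of "card (orbit x)"] card_orbit_ge[OF \<open>x \<in> V\<close>] by auto
  moreover have "S (-1) = S 0" using harmonic[of 0] \<open>S 1 = S 0\<close> by simp
  moreover have "x' = \<phi> (0 - 1) \<or> x' = \<phi> (0 + 1)" using assms(1) far_line_far[OF fl(1), of 0] \<phi>(2) by blast
  ultimately show ?thesis using \<phi>(2) by (auto simp: S_def)
qed

lemma deg_in_orbit:
  assumes "x' \<in> orbit x" "z \<in> V" shows "deg_in x' (orbit z) = deg_in x (orbit z)"
proof -
  have "far\<^sup>*\<^sup>* x x'" using assms(1) by (simp add: orbit_def)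
  then show ?thesis by (induction) (use deg_in_far[OF _ assms(2)] in auto)
qed

lemma double_count:
  assumes "x \<in> V" "z \<in> V"
  shows "card (orbit x) * deg_in x (orbit z) = card (orbit z) * deg_in z (orbit x)"
proof -
  have half: "int (card (orbit u) * deg_in u (orbit v)) = (\<Sum>p\<in>orbit u. \<Sum>q\<in>orbit v. adjacency p q)"
    if "u \<in> V" "v \<in> V" for u v
  proof -
    have "(\<Sum>p\<in>orbit u. \<Sum>q\<in>orbit v. adjacency p q) = (\<Sum>p\<in>orbit u. int (deg_in p (orbit v)))"
      using deg_in_sum finite_orbit[OF that(2)] by simp
    also have "\<dots> = (\<Sum>p\<in>orbit u. int (deg_in u (orbit v)))"
      using deg_in_orbit that by simp
    finally show ?thesis by simp
  qed
  have "(\<Sum>p\<in>orbit x. \<Sum>q\<in>orbit z. adjacency p q) = (\<Sum>q\<in>orbit z. \<Sum>p\<in>orbit x. adjacency q p)"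
    by (subst sum.swap) (intro sum.cong refl adjacency_comm)
  then show ?thesis using half[of x z] half[of z x] assms by linarith
qed

text \<open>
  The sum of the matrix identity \<open>decomposition\<close> over the columns of an orbit.
\<close>
lemma orbit_count:
  assumes "x \<in> V" "z \<in> V"
  shows "(\<Sum>y\<in>nbrs x. int (deg_in y (orbit z))) + int (deg_in x (orbit z))
       = int (card (orbit z)) + (if x \<in> orbit z then int k - 3 else 0)"
proof -
  note fin = finite_orbit[OF assms(2)]
  have V: "v \<in> V" if "v \<in> orbit z" for v using that orbit_V[OF assms(2)] by blast
  have "(\<Sum>v\<in>orbit z. adjacency x v + codegree x v + of_bool (far x v))
      = (\<Sum>v\<in>orbit z. 1 + (int k - 1) * of_bool (x = v))"
    using decomposition[OF assms(1)] V by (intro sum.cong) auto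
  moreover have "(\<Sum>v\<in>orbit z. codegree x v) = (\<Sum>y\<in>nbrs x. int (deg_in y (orbit z)))"
    unfolding codegree_eq deg_in_sum[OF fin] by (rule sum.swap)
  moreover have "(\<Sum>v\<in>orbit z. of_bool (far x v)) = (if x \<in> orbit z then 2 else (0::int))"
  proof (cases "x \<in> orbit z")
    case True
    have "orbit z \<inter> Collect (far x) = Collect (far x)" using orbit_eq[OF True] orbit_far by blast
    then show ?thesis using True fin card_far_2[OF assms(1)] by simp
  next
    case False
    have "\<not> far x v" if "v \<in> orbit z" for v
      using False that orbit_far[of v x] far_sym orbit_eq by metis
    then show ?thesis using False by simp
  qed
  moreover have "(\<Sum>v\<in>orbit z. (int k - 1) * of_bool (x = v)) = (if x \<in> orbit z then int k - 1 else 0)"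
    using fin by (simp add: of_bool_def sum_distrib_left[symmetric] sum.delta)
  ultimately show ?thesis
    by (simp add: sum.distrib deg_in_sum[OF fin] split: if_splits)
qed

lemma deg_in_pos: "E x y \<Longrightarrow> y \<in> S \<Longrightarrow> 0 < deg_in x S"
  unfolding deg_in_def using finite_nbrs by (auto simp: card_gt_0_iff)

lemma short_orbit:
  assumes "E x y" "card (orbit y) < card (orbit x)"
  shows "deg_in x (orbit y) = 1" "card (orbit x) = card (orbit y) * deg_in y (orbit x)"
proof -
  have V: "x \<in> V" "y \<in> V" using assms E_V E_V2 by blast+
  have "z = y" if z: "E x z" "z \<in> orbit y" for z
  proof (rule ccontr)
    assume "z \<noteq> y"
    then have "card (orbit x) dvd card (orbit y)"
      using dvd_lcm_orbits[OF assms(1) z(1)] orbit_eq[OF z(2)] by simp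
    then show False using assms(2) card_orbit_ge[OF V(2)] dvd_imp_le by fastforce
  qed
  then have "nbrs x \<inter> orbit y = {y}" using assms(1) orbit_self by blast
  then show "deg_in x (orbit y) = 1" by (simp add: deg_in_def)
  then show "card (orbit x) = card (orbit y) * deg_in y (orbit x)" using double_count[OF V] by simp
qed

text \<open>
  Steps \<open>i\<close> and \<open>j\<close> in an orbit give the quadrilateral with corners \<open>0\<close>, \<open>i\<close>, \<open>i + j\<close>, \<open>j\<close>, which has to be
  degenerate.
\<close>
lemma line_nbrs:
  assumes "closed_line \<phi> m" "E (\<phi> 0) (\<phi> i)" "E (\<phi> 0) (\<phi> j)"
  shows "\<phi> j = \<phi> i \<or> \<phi> j = \<phi> (- i)"
proof (cases "\<phi> (i + j) = \<phi> 0")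
  case True
  then have "int m dvd j - - i" using closed_line_eq[OF assms(1)] by (simp add: add.commute)
  then show ?thesis using closed_line_eq[OF assms(1)] by blast
next
  case False
  have "E (\<phi> i) (\<phi> (i + j))" "E (\<phi> j) (\<phi> (j + i))" using circulant[OF assms(1)] assms by blast+
  then show ?thesis using no_quad[of "\<phi> 0" "\<phi> i" "\<phi> (i + j)" "\<phi> j"] False assms by (simp add: add.commute)
qed

lemma circulant_neg:
  assumes "closed_line \<phi> m" "E (\<phi> 0) (\<phi> i)" shows "E (\<phi> 0) (\<phi> (- i))"
proof -
  have "E (\<phi> (- i)) (\<phi> (- i + i))" using circulant[OF assms(1), of "- i" i] assms(2) by simp
  then show ?thesis using E_sym by simp
qed

lemma deg_in_self:
  assumes "x \<in> V" shows "deg_in x (orbit x) \<le> 2" "deg_in x (orbit x) + 3 \<le> card (orbit x)"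
proof -
  obtain \<phi> where \<phi>: "closed_line \<phi> (card (orbit x))" "\<phi> 0 = x" using closed_line_at[OF assms] .
  note fl = closed_line_far_line[OF \<phi>(1)]
  have fin: "finite (orbit x)" using finite_orbit[OF assms] .
  show "deg_in x (orbit x) \<le> 2"
  proof (cases "nbrs x \<inter> orbit x = {}")
    case False
    then obtain i where i: "E (\<phi> 0) (\<phi> i)" using \<phi> closed_line_mem[OF \<phi>(1), of _ 0] by fastforce
    have "nbrs x \<inter> orbit x \<subseteq> {\<phi> i, \<phi> (- i)}"
      using line_nbrs[OF \<phi>(1) i] \<phi>(2) closed_line_mem[OF \<phi>(1), of _ 0] by fastforce
    then have "deg_in x (orbit x) \<le> card {\<phi> i, \<phi> (- i)}" unfolding deg_in_def by (intro card_mono) auto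
    also have "\<dots> \<le> 2" by (simp add: card_insert_if)
    finally show ?thesis .
  qed (simp add: deg_in_def)
  define F where "F = insert x {y. far x y}"
  have F: "card F = 3" "F \<subseteq> orbit x"
    unfolding F_def using card_far_2[OF assms] far_V(3) orbit_self orbit_far
    by (auto simp: card_insert_if card_ge_0_finite)
  have "nbrs x \<inter> orbit x \<subseteq> orbit x - F" unfolding F_def using no_loop far_V(4) by blast
  then have "deg_in x (orbit x) \<le> card (orbit x - F)" unfolding deg_in_def using fin by (intro card_mono) auto
  also have "\<dots> = card (orbit x) - 3" using F fin by (simp add: card_Diff_subset finite_subset)
  finally show "deg_in x (orbit x) + 3 \<le> card (orbit x)"
    using card_mono[OF fin F(2)] F(1) by linarith
qed

text \<open>
  The wave equation with step \<open>s\<close> at \<open>(\<phi> s, \<psi> 0)\<close> joins \<open>\<phi> s\<close> to \<open>\<psi> s\<close> or \<open>\<psi> (- s)\<close>. Together with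
  \<open>\<phi> 0\<close> and \<open>\<psi> 0\<close> this closes a quadrilateral.
\<close>
lemma common_step:
  assumes "closed_line \<phi> m" "closed_line \<psi> l" "E (\<phi> 0) (\<psi> 0)" "E (\<phi> 0) (\<phi> (int s))" "E (\<psi> 0) (\<psi> (int s))"
  shows "orbit (\<phi> 0) = orbit (\<psi> 0)"
proof -
  note fl = closed_line_far_line[OF assms(1)] closed_line_far_line[OF assms(2)]
  have "adjacency (\<phi> (int s + int s)) (\<psi> 0) + adjacency (\<phi> (int s - int s)) (\<psi> 0)
      = adjacency (\<phi> (int s)) (\<psi> (0 + int s)) + adjacency (\<phi> (int s)) (\<psi> (0 - int s))"
    by (rule wave_nat[OF fl])
  then have "E (\<phi> (int s)) (\<psi> (int s)) \<or> E (\<phi> (int s)) (\<psi> (- int s))"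
    using assms(3) by (auto simp: adjacency_def of_bool_def split: if_splits)
  then obtain t where t: "E (\<phi> (int s)) (\<psi> t)" "E (\<psi> 0) (\<psi> t)"
    using assms(5) circulant_neg[OF assms(2,5)] by blast
  show ?thesis
  proof (cases "\<phi> 0 = \<psi> t")
    case True
    then show ?thesis using closed_line_range[OF assms(1)] closed_line_range[OF assms(2)] by metis
  next
    case False
    then have "\<phi> (int s) = \<psi> 0" using no_quad assms(3,4) t by blast
    then show ?thesis using closed_line_range[OF assms(1)] closed_line_range[OF assms(2)] by metis
  qed
qed

text \<open>
  If the two vertices far from \<open>x\<close> are neither adjacent nor far from each other, they have a unique
  common neighbour, the partner of \<open>x\<close>. By the wave equation this relation is symmetric, and
  parity arguments about it exclude the two distributions of orbit lengths that survive all counting.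
\<close>
definition partner :: "'a \<Rightarrow> 'a \<Rightarrow> bool" where
  "partner x z \<longleftrightarrow> x \<in> V \<and> z \<in> V \<and> (\<forall>y. far x y \<longrightarrow> E z y)"

lemma partner_line:
  assumes "far_line \<phi>" shows "partner (\<phi> i) z \<longleftrightarrow> z \<in> V \<and> E z (\<phi> (i - 1)) \<and> E z (\<phi> (i + 1))"
  unfolding partner_def using far_line_far[OF assms] far_line_V[OF assms] by auto

lemma partner_sym: "partner x z \<Longrightarrow> partner z x"
proof -
  assume xz: "partner x z"
  then have V: "x \<in> V" "z \<in> V" by (auto simp: partner_def)
  obtain \<phi> where \<phi>: "far_line \<phi>" "\<phi> 0 = x" using far_line_exists[OF V(1)] .
  obtain \<psi> where \<psi>: "far_line \<psi>" "\<psi> 0 = z" using far_line_exists[OF V(2)] .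
  have "E z (\<phi> (0 - 1))" "E z (\<phi> (0 + 1))" using xz partner_line[OF \<phi>(1), of 0 z] \<phi>(2) by auto
  then have "adjacency (\<phi> (0 + 1)) (\<psi> 0) = 1" "adjacency (\<phi> (0 - 1)) (\<psi> 0) = 1"
    using \<psi>(2) E_sym by (auto simp: adjacency_1)
  then have "adjacency (\<phi> 0) (\<psi> (0 + 1)) + adjacency (\<phi> 0) (\<psi> (0 - 1)) = 2"
    using wave[OF \<phi>(1) \<psi>(1), of 0 0] by linarith
  then have "E x (\<psi> (0 - 1)) \<and> E x (\<psi> (0 + 1))"
    using \<phi>(2) by (auto simp: adjacency_def of_bool_def split: if_splits)
  then show ?thesis using partner_line[OF \<psi>(1), of 0 x] \<psi>(2) V by simp
qed

lemma far_pair: assumes "x \<in> V" obtains p q where "far x p" "far x q" "p \<noteq> q"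
  using card_far_2[OF assms] by (auto simp: card_2_iff)

lemma partner_unique: "partner x z \<Longrightarrow> partner x z' \<Longrightarrow> z = z'"
proof -
  assume xz: "partner x z" "partner x z'"
  then have "x \<in> V" by (simp add: partner_def)
  then obtain p q where "far x p" "far x q" "p \<noteq> q" by (rule far_pair)
  with xz have "E z p" "E z q" "E z' p" "E z' q" by (auto simp: partner_def)
  then show ?thesis using no_quad[of p z q z'] E_sym \<open>p \<noteq> q\<close> by blast
qed

lemma partner_irrefl: "\<not> partner x x"
proof
  assume "partner x x"
  moreover from this have "x \<in> V" by (simp add: partner_def)
  then obtain p where "far x p" by (rule far_pair)
  ultimately show False using far_V(4) by (auto simp: partner_def)
qed

lemma partner_exists:
  assumes "x \<in> V" "4 \<le> card (orbit x)" "\<And>p q. far x p \<Longrightarrow> far x q \<Longrightarrow> \<not> E p q"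
  obtains z where "partner x z"
proof -
  obtain \<phi> where \<phi>: "closed_line \<phi> (card (orbit x))" "\<phi> 0 = x" using closed_line_at[OF assms(1)] .
  note fl = closed_line_far_line[OF \<phi>(1)]
  define p q where "p = \<phi> (0 - 1)" and "q = \<phi> (0 + 1)"
  have far: "far x p" "far x q" "p \<noteq> q"
    using far_line_far[OF fl, of 0] far_line_neq[OF fl, of 0] \<phi>(2) by (auto simp: p_def q_def)
  have "\<not> far p q"
  proof
    assume "far p q"
    then have "q = \<phi> (0 - 1 - 1) \<or> q = \<phi> (0 - 1 + 1)" using far_line_far[OF fl] unfolding p_def by blast
    then have "int (card (orbit x)) dvd 3 \<or> int (card (orbit x)) dvd 1"
      using closed_line_eq[OF \<phi>(1)] unfolding q_def by force
    then have "int (card (orbit x)) \<le> 3" using zdvd_imp_le[of _ 3] zdvd_imp_le[of _ 1] by fastforce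
    then show False using assms(2) by simp
  qed
  moreover have "\<not> E p q" using assms(3) far by blast
  ultimately obtain z where "E p z" "E z q" using far far_V(2) unfolding far_def[of p q] by blast
  then have "partner (\<phi> 0) z" unfolding partner_line[OF fl] using E_sym E_V2 by (auto simp: p_def q_def)
  then show thesis using that \<phi>(2) by simp
qed

end

section \<open>Arithmetic of the degree distributions\<close>

text \<open>
  The candidates for the numbers of neighbours of a vertex in the other orbits of maximal length, listed
  so that \<open>row_cases\<close> becomes a finite check.
\<close>
fun compositions :: "nat \<Rightarrow> nat list list" where
  "compositions 0 = [[]]"
| "compositions (Suc n) = concat (map (\<lambda>i. map ((#) (Suc i)) (compositions (n - i))) [0..<Suc n])"

lemma compositions_complete: "\<forall>w\<in>set ws. 1 \<le> w \<Longrightarrow> ws \<in> set (compositions (sum_list ws))"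
proof (induction ws)
  case (Cons w ws)
  then obtain i where i: "w = Suc i" by (metis list.set_intros(1) not_less_eq_eq old.nat.exhaust zero_le One_nat_def)
  have "ws \<in> set (compositions (i + sum_list ws - i))" using Cons by simp
  then have "Suc i # ws \<in> (#) (Suc i) ` set (compositions (i + sum_list ws - i))" by blast
  then have "w # ws \<in> set (compositions (Suc (i + sum_list ws)))"
    unfolding compositions.simps set_concat set_map image_image i by (rule UN_I[rotated]) (simp add: less_Suc_eq_le del: upt_Suc)
  moreover have "sum_list (w # ws) = Suc (i + sum_list ws)" by (simp add: i)
  ultimately show ?case by metis
qed simp

text \<open>
  Here \<open>m\<close> is the length of a longest orbit, \<open>b\<close> the number of neighbours that a vertex of it has in the
  same orbit, \<open>ws\<close> lists the numbers of its neighbours in the other orbits of length \<open>m\<close> that contain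
  any, and \<open>h\<close> is the number of its neighbours in shorter orbits, which have total length \<open>L\<close>.
\<close>
definition row_type :: "nat \<Rightarrow> nat \<Rightarrow> nat list \<Rightarrow> nat \<Rightarrow> nat \<Rightarrow> bool" where
  "row_type m b ws h L \<longleftrightarrow> m = 3 \<or> (m = 4 \<and> b = 1 \<and> ws \<noteq> []) \<or> (m = 5 \<and> h = 0 \<and> length ws = 4)
    \<or> (m = 6 \<and> h = 0 \<and> length ws = 3)
    \<or> (m = 7 \<and> h = 0 \<and> (b = 2 \<and> ws = [1, 1, 1] \<or> b = 0 \<and> ws \<in> {[1, 2, 2], [2, 1, 2], [2, 2, 1]}))
    \<or> (m = 8 \<and> (b = 1 \<and> ws = [2, 2] \<and> h = 0 \<or> b = 0 \<and> ws = [2, 2] \<and> h = 1 \<and> L = 4 \<or> b = 2 \<and> ws = [1, 1] \<and> h = 1 \<and> L = 4))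
    \<or> (m = 10 \<and> h = 1 \<and> L = 5 \<and> length ws = 1) \<or> (m = 12 \<and> h = 1 \<and> L = 4 \<and> length ws = 1)"

text \<open>
  The third hypothesis counts the neighbours of a vertex \<open>x\<close>, the fourth the walks of length 1 and 2
  from \<open>x\<close> to its own orbit. The fifth and the sixth say that these orbits fit into the graph, and that the remaining
  vertices are not one or two, as each orbit has at least three elements. \<open>T\<close> is the number of neighbours in the
  orbit of \<open>x\<close> of the only neighbour in a shorter orbit.
\<close>
lemma row_cases:
  fixes m b h T L :: nat and ws :: "nat list"
  assumes "b \<le> 2" "\<forall>w\<in>set ws. 1 \<le> w" "b + sum_list ws + h = 5"
    "m + 2 = b + b * b + sum_list (map (\<lambda>w. w * w) ws) + T"
    "m * (1 + length ws) + L \<le> 28"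
    "28 - (m * (1 + length ws) + L) \<notin> {1, 2}"
    "(h = 0 \<and> T = 0 \<and> L = 0) \<or> (h = 1 \<and> m = L * T \<and> 3 \<le> L \<and> T \<in> {2..5})"
  shows "row_type m b ws h L"
proof -
  have c: "ws \<in> set (compositions (sum_list ws))" using compositions_complete assms(2) by blast
  have comps: "compositions 1 = [[1]]" "compositions 2 = [[1,1],[2]]" "compositions 3 = [[1,1,1],[1,2],[2,1],[3]]"
    "compositions 4 = [[1,1,1,1],[1,1,2],[1,2,1],[1,3],[2,1,1],[2,2],[3,1],[4]]"
    "compositions 5 = [[1,1,1,1,1],[1,1,1,2],[1,1,2,1],[1,1,3],[1,2,1,1],[1,2,2],[1,3,1],[1,4],
        [2,1,1,1],[2,1,2],[2,2,1],[2,3],[3,1,1],[3,2],[4,1],[5]]"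
    by code_simp+
  have b: "b = 0 \<or> b = 1 \<or> b = 2" using assms(1) by linarith
  show ?thesis
  proof (cases "h = 0")
    case True
    then have "T = 0" "L = 0" using assms(7) by auto
    show ?thesis using b
    proof (elim disjE)
      assume b: "b = 0"
      then have "sum_list ws = 5" using assms(3) True by simp
      from c[unfolded this comps] show ?thesis
        using assms(4,5,6) \<open>T = 0\<close> \<open>L = 0\<close> True b by (simp, elim disjE; simp add: row_type_def)
    next
      assume b: "b = 1"
      then have "sum_list ws = 4" using assms(3) True by simp
      from c[unfolded this comps] show ?thesis
        using assms(4,5,6) \<open>T = 0\<close> \<open>L = 0\<close> True b by (simp, elim disjE; simp add: row_type_def)
    next
      assume b: "b = 2"
      then have "sum_list ws = 3" using assms(3) True by simp
      from c[unfolded this comps] show ?thesis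
        using assms(4,5,6) \<open>T = 0\<close> \<open>L = 0\<close> True b by (simp, elim disjE; simp add: row_type_def)
    qed
  next
    case False
    then have h: "h = 1" "m = L * T" "3 \<le> L" and "T \<in> {2..5}" using assms(7) by auto
    then have T: "T = 2 \<or> T = 3 \<or> T = 4 \<or> T = 5" by auto
    have "ws \<noteq> []" using assms(3) h b by auto
    then have "1 \<le> length ws" by (cases ws) auto
    then have "m * 2 \<le> m * (1 + length ws)" by simp
    then have "m * 2 + L \<le> 28" using assms(5) by linarith
    moreover have "2 * L \<le> m" using h(2) T by auto
    ultimately have L: "L = 3 \<or> L = 4 \<or> L = 5" using h(3) by linarith
    have LT: "(L, T) \<in> {(3,2), (3,3), (3,4), (4,2), (4,3), (5,2)}"
      using T L \<open>m * 2 + L \<le> 28\<close> unfolding h(2) by auto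
    define q where "q = sum_list (map (\<lambda>w. w * w) ws)"
    have m: "m = L * T" "L * T + 2 = b + b * b + q + T" using h(2) assms(4) by (simp_all add: q_def)
    have len: "L * T * (1 + length ws) + L \<le> 28" "28 - (L * T * (1 + length ws) + L) \<notin> {1, 2}"
      using assms(5,6) h(2) by simp_all
    have "sum_list ws = 4 - b" using assms(3) h by simp
    with b have "b = 0 \<and> ws \<in> set (compositions 4) \<or> b = 1 \<and> ws \<in> set (compositions 3)
        \<or> b = 2 \<and> ws \<in> set (compositions 2)" using c by auto
    then show ?thesis
    proof (elim disjE conjE)
      assume b: "b = 0" "ws \<in> set (compositions 4)"
      have "(length ws, q, ws) \<in> (\<lambda>v. (length v, sum_list (map (\<lambda>w. w * w) v), v)) ` set (compositions 4)"
        using b(2) by (simp add: q_def)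
      then have "(length ws, q, ws) \<in> set (map (\<lambda>v. (length v, sum_list (map (\<lambda>w. w * w) v), v)) (compositions 4))"
        by simp
      from this[unfolded comps] LT show ?thesis
        using m(2) len unfolding m(1) b(1) h(1) by (simp, elim disjE conjE; simp add: row_type_def)
    next
      assume b: "b = 1" "ws \<in> set (compositions 3)"
      have "(length ws, q, ws) \<in> (\<lambda>v. (length v, sum_list (map (\<lambda>w. w * w) v), v)) ` set (compositions 3)"
        using b(2) by (simp add: q_def)
      then have "(length ws, q, ws) \<in> set (map (\<lambda>v. (length v, sum_list (map (\<lambda>w. w * w) v), v)) (compositions 3))"
        by simp
      from this[unfolded comps] LT show ?thesis
        using m(2) len unfolding m(1) b(1) h(1) by (simp, elim disjE conjE; simp add: row_type_def)
    next
      assume b: "b = 2" "ws \<in> set (compositions 2)"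
      have "(length ws, q, ws) \<in> (\<lambda>v. (length v, sum_list (map (\<lambda>w. w * w) v), v)) ` set (compositions 2)"
        using b(2) by (simp add: q_def)
      then have "(length ws, q, ws) \<in> set (map (\<lambda>v. (length v, sum_list (map (\<lambda>w. w * w) v), v)) (compositions 2))"
        by simp
      from this[unfolded comps] LT show ?thesis
        using m(2) len unfolding m(1) b(1) h(1) by (simp, elim disjE conjE; simp add: row_type_def)
    qed
  qed
qed

lemma coprime_quotients:
  fixes m l l' t t' :: nat
  assumes "m = l * t" "m = l' * t'" "m dvd lcm l l'" "0 < m"
  shows "coprime t t'"
proof -
  define g where "g = gcd t t'"
  obtain s s' where s: "t = g * s" "t' = g * s'" unfolding g_def by (meson dvdE gcd_dvd1 gcd_dvd2)
  have g: "g \<noteq> 0" using assms s by auto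
  have "l * s = l' * s'" using assms(1,2) s g by (metis mult.left_commute mult_left_cancel)
  then have "lcm l l' dvd l * s" by (metis dvd_triv_left lcm_least)
  then have "g * (l * s) dvd l * s" using assms(1,3) s by (metis dvd_trans mult.left_commute)
  then have "g = 1" using assms(1,4) s by (metis dvd_imp_le le_square mult_0_right mult_eq_0_iff mult_le_cancel2 nat_mult_1 neq0_conv One_nat_def Suc_leI le_antisym)
  then show ?thesis by (simp add: g_def coprime_iff_gcd_eq_1)
qed

lemma no_two_divisors:
  fixes m l l' t t' :: nat
  assumes "m = l * t" "m = l' * t'" "coprime t t'" "t \<in> {2..5}" "t' \<in> {2..5}" "3 \<le> l" "3 \<le> l'"
    "2 * m + l + l' \<le> 28"
  shows False
proof -
  have t: "t = 2 \<or> t = 3 \<or> t = 4 \<or> t = 5" "t' = 2 \<or> t' = 3 \<or> t' = 4 \<or> t' = 5" using assms(4,5) by auto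
  have "l * 2 \<le> l * t" "l' * 2 \<le> l' * t'" using assms(4,5) by simp_all
  moreover have "m \<le> 11" using assms(6-8) by linarith
  ultimately have "l \<le> 5" "l' \<le> 5" using assms(1,2) by linarith+
  then have l: "l = 3 \<or> l = 4 \<or> l = 5" "l' = 3 \<or> l' = 4 \<or> l' = 5" using assms(6,7) by linarith+
  have "l * t = l' * t'" "l * t \<le> 11" using assms(1,2) \<open>m \<le> 11\<close> by simp_all
  with t l assms(3) show False by (elim disjE; simp)
qed

lemma no_three_divisors:
  fixes m l1 l2 l3 t1 t2 t3 :: nat
  assumes "m = l1 * t1" "m = l2 * t2" "m = l3 * t3" "coprime t1 t2" "coprime t1 t3" "coprime t2 t3"
    "t1 \<in> {2..5}" "t2 \<in> {2..5}" "t3 \<in> {2..5}" "m \<le> 28" "0 < m"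
  shows False
proof -
  have t: "t1 = 2 \<or> t1 = 3 \<or> t1 = 4 \<or> t1 = 5" "t2 = 2 \<or> t2 = 3 \<or> t2 = 4 \<or> t2 = 5"
    "t3 = 2 \<or> t3 = 3 \<or> t3 = 4 \<or> t3 = 5" using assms(7-9) by auto
  have "t1 dvd m" "t2 dvd m" "t3 dvd m" using assms(1-3) by (metis dvd_triv_right)+
  then have "t1 * t2 * t3 dvd m" using assms(4-6) by (intro divides_mult) auto
  then have "t1 * t2 * t3 \<le> 28" using dvd_imp_le[OF _ assms(11)] assms(10) le_trans by blast
  with t assms(4-6) show False by (elim disjE; simp)
qed

section \<open>The neighbours of a vertex in a longest orbit\<close>

locale quintic_28 = excess_two V E 5 for V :: "'a set" and E
begin

lemma card_V: "card V = 28" using order by simp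

lemma orbit_count_5:
  assumes "x \<in> V" "z \<in> V"
  shows "(\<Sum>y\<in>nbrs x. deg_in y (orbit z)) + deg_in x (orbit z)
       = card (orbit z) + (if x \<in> orbit z then 2 else 0)"
proof -
  have "int ((\<Sum>y\<in>nbrs x. deg_in y (orbit z)) + deg_in x (orbit z))
       = int (card (orbit z) + (if x \<in> orbit z then 2 else 0))"
    using orbit_count[OF assms] by simp
  then show ?thesis by (rule of_nat_eq_iff[THEN iffD1])
qed

lemma deg_in_le: "x \<in> V \<Longrightarrow> deg_in x S \<le> 5"
  unfolding deg_in_def using degree[of x] card_mono[OF finite_nbrs, of "nbrs x \<inter> S" x] by simp

lemma comparable: "E x y \<Longrightarrow> card (orbit x) dvd card (orbit y) \<or> card (orbit y) dvd card (orbit x)"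
  using short_orbit(2)[of x y] short_orbit(2)[of y x] E_sym
  by (metis dvd_refl dvd_triv_left linorder_neqE_nat)

definition longest :: "'a \<Rightarrow> bool" where
  "longest x \<longleftrightarrow> x \<in> V \<and> (\<forall>y\<in>V. card (orbit y) \<le> card (orbit x))"

definition equal_orbits :: "'a \<Rightarrow> 'a set set" where
  "equal_orbits x = {orbit y | y. E x y \<and> card (orbit y) = card (orbit x) \<and> y \<notin> orbit x}"

definition short_nbrs :: "'a \<Rightarrow> 'a set" where
  "short_nbrs x = {y. E x y \<and> card (orbit y) < card (orbit x)}"

definition cover :: "'a \<Rightarrow> 'a set" where
  "cover x = orbit x \<union> \<Union> (equal_orbits x) \<union> (\<Union>y\<in>short_nbrs x. orbit y)"

lemma equal_orbitsE:
  assumes "S \<in> equal_orbits x"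
  obtains y where "S = orbit y" "E x y" "card (orbit y) = card (orbit x)" "y \<notin> orbit x" "y \<in> V"
  using assms E_V2 unfolding equal_orbits_def by blast

lemma equal_orbits_mem:
  assumes "S \<in> equal_orbits x" "y \<in> S"
  shows "orbit y = S" "card (orbit y) = card (orbit x)" "y \<notin> orbit x"
proof -
  obtain z where z: "S = orbit z" "card (orbit z) = card (orbit x)" "z \<notin> orbit x" using equal_orbitsE[OF assms(1)] by metis
  show "orbit y = S" using assms(2) orbit_eq z(1) by blast
  then show "card (orbit y) = card (orbit x)" using z by simp
  show "y \<notin> orbit x"
  proof
    assume "y \<in> orbit x"
    then have "orbit z = orbit x" using \<open>orbit y = S\<close> z(1) orbit_eq by metis
    then show False using z(3) orbit_self by blast
  qed
qed

lemma short_nbrs_V: "y \<in> short_nbrs x \<Longrightarrow> y \<in> V" unfolding short_nbrs_def using E_V2 by blast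

lemma finite_equal: "finite (equal_orbits x)"
proof -
  have "equal_orbits x \<subseteq> orbit ` nbrs x" unfolding equal_orbits_def by blast
  then show ?thesis using finite_nbrs finite_surj by blast
qed

lemma finite_short: "finite (short_nbrs x)"
  unfolding short_nbrs_def using finite_nbrs[of x] by simp

lemma orbits_disjoint_family:
  assumes "\<And>S. S \<in> F \<Longrightarrow> \<exists>y. S = orbit y"
  shows "\<forall>A\<in>F. \<forall>B\<in>F. A \<noteq> B \<longrightarrow> A \<inter> B = {}"
  using assms orbit_disjoint by metis

lemma deg_in_equal:
  assumes "S \<in> equal_orbits x" "y \<in> S" "x \<in> V"
  shows "deg_in y (orbit x) = deg_in x S"
proof -
  obtain z where z: "S = orbit z" "card (orbit z) = card (orbit x)" "z \<in> V" using equal_orbitsE[OF assms(1)] by metis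
  have "y \<in> V" using assms(2) z orbit_V by blast
  then have "card (orbit x) * deg_in x (orbit y) = card (orbit y) * deg_in y (orbit x)" using double_count assms(3) by blast
  moreover have "orbit y = orbit z" using assms(2) z(1) orbit_eq by blast
  ultimately show ?thesis using z card_orbit_ge[OF assms(3)] by simp
qed

lemma sum_nbrs_split:
  assumes "longest x"
  shows "(\<Sum>y\<in>nbrs x. f y) = (\<Sum>y\<in>nbrs x \<inter> orbit x. f y) + (\<Sum>S\<in>equal_orbits x. \<Sum>y\<in>nbrs x \<inter> S. f y)
     + (\<Sum>y\<in>short_nbrs x. f y :: nat)"
proof -
  have max: "card (orbit y) \<le> card (orbit x)" if "y \<in> V" for y
    using assms that by (auto simp: longest_def)
  define M where "M = (\<Union>S\<in>equal_orbits x. nbrs x \<inter> S)"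
  define A where "A = nbrs x \<inter> orbit x"
  have N: "nbrs x = (A \<union> M) \<union> short_nbrs x"
  proof (intro equalityI subsetI)
    fix y assume y: "y \<in> nbrs x"
    then have le: "card (orbit y) \<le> card (orbit x)" using max E_V2 by blast
    show "y \<in> (A \<union> M) \<union> short_nbrs x"
    proof (cases "y \<in> orbit x \<or> y \<in> short_nbrs x")
      case True
      then show ?thesis using y by (auto simp: A_def)
    next
      case False
      then have "E x y" "card (orbit y) = card (orbit x)" "y \<notin> orbit x" using y le by (auto simp: short_nbrs_def)
      then have "orbit y \<in> equal_orbits x" unfolding equal_orbits_def by blast
      then show ?thesis using y orbit_self unfolding M_def by blast
    qed
  qed (auto simp: A_def M_def short_nbrs_def)
  have fin: "finite A" "finite M"
    unfolding A_def M_def using finite_nbrs finite_equal by blast+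
  have "card (orbit y) = card (orbit x)" if "y \<in> A \<union> M" for y
    using that orbit_eq[of y x] equal_orbits_mem(2) unfolding A_def M_def by auto
  then have disj: "(A \<union> M) \<inter> short_nbrs x = {}" by (force simp: short_nbrs_def)
  have "A \<inter> M = {}" unfolding A_def M_def using equal_orbits_mem(3) by blast
  then have "sum f (A \<union> M) = sum f A + sum f M" using fin by (simp add: sum.union_disjoint)
  moreover have "sum f (nbrs x) = sum f (A \<union> M) + sum f (short_nbrs x)"
    unfolding N using fin finite_short disj by (intro sum.union_disjoint) auto
  moreover have "sum f M = (\<Sum>S\<in>equal_orbits x. \<Sum>y\<in>nbrs x \<inter> S. f y)"
    unfolding M_def
  proof (rule sum.UNION_disjoint)
    have "\<forall>A\<in>equal_orbits x. \<forall>B\<in>equal_orbits x. A \<noteq> B \<longrightarrow> A \<inter> B = {}"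
      by (rule orbits_disjoint_family) (auto elim: equal_orbitsE)
    then show "\<forall>A\<in>equal_orbits x. \<forall>B\<in>equal_orbits x. A \<noteq> B \<longrightarrow> nbrs x \<inter> A \<inter> (nbrs x \<inter> B) = {}"
      by blast
  qed (use finite_equal finite_nbrs in auto)
  ultimately show ?thesis unfolding A_def by linarith
qed

lemma row_degree:
  assumes "longest x"
  shows "deg_in x (orbit x) + (\<Sum>S\<in>equal_orbits x. deg_in x S) + card (short_nbrs x) = 5"
proof -
  have "x \<in> V" using assms by (simp add: longest_def)
  then show ?thesis using sum_nbrs_split[OF assms, of "\<lambda>_. 1"] degree[of x] by (simp add: deg_in_def)
qed

lemma row_square:
  assumes "longest x"
  shows "card (orbit x) + 2 = deg_in x (orbit x) + deg_in x (orbit x) * deg_in x (orbit x)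
    + (\<Sum>S\<in>equal_orbits x. deg_in x S * deg_in x S) + (\<Sum>y\<in>short_nbrs x. deg_in y (orbit x))"
proof -
  have x: "x \<in> V" using assms by (simp add: longest_def)
  have "(\<Sum>y\<in>nbrs x \<inter> orbit x. deg_in y (orbit x)) = (\<Sum>y\<in>nbrs x \<inter> orbit x. deg_in x (orbit x))"
    using deg_in_orbit x by (intro sum.cong) auto
  then have a: "(\<Sum>y\<in>nbrs x \<inter> orbit x. deg_in y (orbit x)) = deg_in x (orbit x) * deg_in x (orbit x)"
    by (simp add: deg_in_def)
  have b: "(\<Sum>y\<in>nbrs x \<inter> S. deg_in y (orbit x)) = deg_in x S * deg_in x S" if "S \<in> equal_orbits x" for S
  proof -
    have "(\<Sum>y\<in>nbrs x \<inter> S. deg_in y (orbit x)) = (\<Sum>y\<in>nbrs x \<inter> S. deg_in x S)"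
      using deg_in_equal[OF that _ x] by (intro sum.cong) auto
    then show ?thesis by (simp add: deg_in_def)
  qed
  show ?thesis
    using orbit_count_5[OF x x] sum_nbrs_split[OF assms, of "\<lambda>y. deg_in y (orbit x)"] a b orbit_self
    by simp
qed

lemma short_nbr:
  assumes "y \<in> short_nbrs x" "x \<in> V"
  shows "card (orbit x) = card (orbit y) * deg_in y (orbit x)" "deg_in y (orbit x) \<in> {2..5}" "3 \<le> card (orbit y)"
proof -
  have y: "E x y" "card (orbit y) < card (orbit x)" "y \<in> V" using assms E_V2 by (auto simp: short_nbrs_def)
  show eq: "card (orbit x) = card (orbit y) * deg_in y (orbit x)" using short_orbit(2) y by blast
  show "3 \<le> card (orbit y)" using card_orbit_ge y by blast
  have "deg_in y (orbit x) \<noteq> 0" "deg_in y (orbit x) \<noteq> 1" using eq y(2) by (metis mult_0_right not_less_zero, metis less_irrefl mult_1_right)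
  then show "deg_in y (orbit x) \<in> {2..5}" using deg_in_le[OF y(3)] by auto
qed

lemma short_inj:
  assumes "y \<in> short_nbrs x" "z \<in> short_nbrs x" "y \<noteq> z"
  shows "orbit y \<noteq> orbit z" "x \<in> V \<Longrightarrow> coprime (deg_in y (orbit x)) (deg_in z (orbit x))"
proof -
  have yz: "E x y" "E x z" "card (orbit y) < card (orbit x)" using assms by (auto simp: short_nbrs_def)
  show "orbit y \<noteq> orbit z"
  proof
    assume "orbit y = orbit z"
    then have "{y, z} \<subseteq> nbrs x \<inter> orbit y" using yz orbit_self by auto
    then have "card {y, z} \<le> deg_in x (orbit y)" unfolding deg_in_def using finite_nbrs by (intro card_mono) auto
    then show False using short_orbit(1)[OF yz(1,3)] assms(3) by simp
  qed
  assume x: "x \<in> V"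
  show "coprime (deg_in y (orbit x)) (deg_in z (orbit x))"
    using coprime_quotients[OF short_nbr(1)[OF assms(1) x] short_nbr(1)[OF assms(2) x] dvd_lcm_orbits[OF yz(1,2) assms(3)]]
      card_orbit_ge[OF x] by simp
qed

lemma cover_V: "x \<in> V \<Longrightarrow> cover x \<subseteq> V"
proof
  fix u assume "x \<in> V" "u \<in> cover x"
  then consider "u \<in> orbit x" | S where "S \<in> equal_orbits x" "u \<in> S" | y where "y \<in> short_nbrs x" "u \<in> orbit y"
    unfolding cover_def by blast
  then show "u \<in> V"
  proof cases
    case 2
    then show ?thesis using equal_orbitsE[OF 2(1)] orbit_V by blast
  qed (use orbit_V[OF \<open>x \<in> V\<close>] orbit_V short_nbrs_V in blast)+
qed

lemma card_cover:
  assumes "x \<in> V"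
  shows "card (cover x) = card (orbit x) * (1 + card (equal_orbits x)) + (\<Sum>y\<in>short_nbrs x. card (orbit y))"
proof -
  define F where "F = insert (orbit x) (equal_orbits x \<union> orbit ` short_nbrs x)"
  have F: "\<exists>y. S = orbit y \<and> y \<in> V" if "S \<in> F" for S
    using that assms short_nbrs_V unfolding F_def by (auto elim: equal_orbitsE)
  have "cover x = \<Union> F" unfolding F_def cover_def by blast
  also have "card (\<Union> F) = (\<Sum>S\<in>F. card S)"
  proof (rule card_Union_disjoint)
    show "pairwise disjnt F" unfolding pairwise_def disjnt_def
      using orbits_disjoint_family[of F] F by blast
    show "finite S" if "S \<in> F" for S using F[OF that] finite_orbit by blast
  qed
  also have "\<dots> = card (orbit x) + (\<Sum>S\<in>equal_orbits x. card S) + (\<Sum>S\<in>orbit ` short_nbrs x. card S)"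
  proof -
    have "orbit x \<notin> equal_orbits x" using equal_orbits_mem(3) orbit_self by blast
    moreover have "orbit x \<notin> orbit ` short_nbrs x" by (auto simp: short_nbrs_def)
    moreover have "orbit y \<notin> equal_orbits x" if "y \<in> short_nbrs x" for y
      using that equal_orbits_mem(2)[OF _ orbit_self] by (force simp: short_nbrs_def)
    then have "equal_orbits x \<inter> orbit ` short_nbrs x = {}" by blast
    ultimately show ?thesis unfolding F_def
      using finite_equal finite_short by (simp add: sum.union_disjoint)
  qed
  also have "(\<Sum>S\<in>orbit ` short_nbrs x. card S) = (\<Sum>y\<in>short_nbrs x. card (orbit y))"
    using short_inj(1) by (subst sum.reindex) (auto intro!: inj_onI)
  also have "(\<Sum>S\<in>equal_orbits x. card S) = (\<Sum>S\<in>equal_orbits x. card (orbit x))"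
    by (rule sum.cong) (auto elim: equal_orbitsE)
  finally show ?thesis by simp
qed

text \<open>
  A vertex outside the cover is neither adjacent to \<open>x\<close> nor far from \<open>x\<close>, hence at distance 2.
\<close>
lemma outside_cover:
  assumes "longest x" "v \<in> V - cover x"
  shows "orbit v \<subseteq> V - cover x" "3 \<le> card (orbit v)"
    "\<exists>y. E x y \<and> E y v \<and> (card (orbit y) = card (orbit x) \<or> y \<in> short_nbrs x)"
proof -
  have x: "x \<in> V" using assms(1) by (simp add: longest_def)
  have max: "card (orbit y) \<le> card (orbit x)" if "y \<in> V" for y
    using assms(1) that by (auto simp: longest_def)
  have v: "v \<in> V" "v \<notin> cover x" using assms(2) by auto
  have sat: "orbit u \<subseteq> cover x" if "u \<in> cover x" for u
    using that orbit_eq[of u] equal_orbits_mem(1)[of _ x u] unfolding cover_def by blast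
  show "orbit v \<subseteq> V - cover x"
  proof
    fix u assume u: "u \<in> orbit v"
    then have "v \<in> orbit u" using orbit_eq orbit_self by blast
    then show "u \<in> V - cover x" using sat v u orbit_V by blast
  qed
  show "3 \<le> card (orbit v)" using card_orbit_ge v(1) .
  have type: "card (orbit y) = card (orbit x) \<or> y \<in> short_nbrs x" if "E x y" for y
    using that max[OF E_V2[OF that]] by (auto simp: short_nbrs_def)
  have "v \<notin> orbit x" using v(2) by (simp add: cover_def)
  then have "x \<noteq> v" "\<not> far x v" using orbit_self orbit_far by auto
  moreover have "\<not> E x v"
  proof
    assume xv: "E x v"
    then have "v \<in> cover x"
      using type[OF xv] \<open>v \<notin> orbit x\<close> orbit_self[of v] unfolding cover_def equal_orbits_def by blast
    then show False using v(2) by blast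
  qed
  ultimately show "\<exists>y. E x y \<and> E y v \<and> (card (orbit y) = card (orbit x) \<or> y \<in> short_nbrs x)"
    using type x v(1) unfolding far_def by blast
qed

text \<open>
  The lengths of two shorter adjacent orbits are \<open>m / t\<close> and \<open>m / t'\<close> with coprime \<open>t\<close> and \<open>t'\<close> between
  2 and 5, so that \<open>m\<close> is a multiple of \<open>t t'\<close>. If there is another orbit of length \<open>m\<close>, all these orbits do
  not fit into 28 vertices. Otherwise there is a third shorter orbit, and \<open>m\<close> is a multiple of 30.
\<close>
lemma short_le_1:
  assumes "longest x" shows "card (short_nbrs x) \<le> 1"
proof (rule ccontr)
  have x: "x \<in> V" using assms(1) by (auto simp: longest_def)
  let ?m = "card (orbit x)"
  assume "\<not> card (short_nbrs x) \<le> 1"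
  then have "2 \<le> card (short_nbrs x)" by simp
  then obtain T where "T \<subseteq> short_nbrs x" "card T = 2" by (metis obtain_subset_with_card_n)
  then obtain y z where yz: "y \<in> short_nbrs x" "z \<in> short_nbrs x" "y \<noteq> z" by (auto simp: card_2_iff)
  have le28: "card (cover x) \<le> 28" using card_mono[OF finite_V cover_V[OF x]] card_V by simp
  show False
  proof (cases "equal_orbits x = {}")
    case False
    then have "1 \<le> card (equal_orbits x)" using finite_equal by (simp add: Suc_leI card_gt_0_iff)
    then have "?m * 2 \<le> ?m * (1 + card (equal_orbits x))" by simp
    moreover have "(\<Sum>u\<in>{y, z}. card (orbit u)) \<le> (\<Sum>u\<in>short_nbrs x. card (orbit u))"
      using yz finite_short by (intro sum_mono2) auto
    moreover have "(\<Sum>u\<in>{y, z}. card (orbit u)) = card (orbit y) + card (orbit z)" using yz(3) by simp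
    ultimately have "2 * ?m + card (orbit y) + card (orbit z) \<le> 28"
      using card_cover[OF x] le28 by linarith
    with no_two_divisors[OF short_nbr(1)[OF yz(1) x] short_nbr(1)[OF yz(2) x] short_inj(2)[OF yz x]
        short_nbr(2)[OF yz(1) x] short_nbr(2)[OF yz(2) x] short_nbr(3)[OF yz(1) x] short_nbr(3)[OF yz(2) x]]
    show False by blast
  next
    case True
    then have "3 \<le> card (short_nbrs x)" using row_degree[OF assms] deg_in_self(1)[OF x] by simp
    moreover have "card {y, z} < 3" using yz by simp
    ultimately have "\<not> short_nbrs x \<subseteq> {y, z}" using card_mono[of "{y, z}" "short_nbrs x"] by auto
    then obtain w where w: "w \<in> short_nbrs x" "w \<noteq> y" "w \<noteq> z" by blast
    have "?m \<le> 28" using card_mono[OF finite_V orbit_V[OF x]] card_V by simp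
    moreover have "0 < ?m" using card_orbit_ge[OF x] by simp
    ultimately show False
      using no_three_divisors[OF short_nbr(1)[OF yz(1) x] short_nbr(1)[OF yz(2) x] short_nbr(1)[OF w(1) x]
        short_inj(2)[OF yz x] short_inj(2)[OF yz(1) w(1) _ x] short_inj(2)[OF yz(2) w(1) _ x]
        short_nbr(2)[OF yz(1) x] short_nbr(2)[OF yz(2) x] short_nbr(2)[OF w(1) x]] w by blast
  qed
qed

lemma longest_row:
  assumes "longest x"
  obtains Ss h L where "distinct Ss" "set Ss = equal_orbits x" "h = card (short_nbrs x)"
    "L = (\<Sum>y\<in>short_nbrs x. card (orbit y))" "card (cover x) = card (orbit x) * (1 + length Ss) + L"
    "row_type (card (orbit x)) (deg_in x (orbit x)) (map (deg_in x) Ss) h L"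
proof -
  have x: "x \<in> V" using assms(1) by (auto simp: longest_def)
  obtain Ss where Ss: "set Ss = equal_orbits x" "distinct Ss" using finite_distinct_list[OF finite_equal] by blast
  define h L T where "h = card (short_nbrs x)" and "L = (\<Sum>y\<in>short_nbrs x. card (orbit y))"
    and "T = (\<Sum>y\<in>short_nbrs x. deg_in y (orbit x))"
  have len: "length Ss = card (equal_orbits x)" using Ss distinct_card by metis
  have cover: "card (cover x) = card (orbit x) * (1 + length Ss) + L"
    using card_cover[OF x] by (simp add: len L_def)
  have sums: "(\<Sum>S\<in>equal_orbits x. f S) = sum_list (map f Ss)" for f :: "'a set \<Rightarrow> nat"
    using sum_list_distinct_conv_sum_set[OF Ss(2), of f] Ss(1) by simp
  have "28 - card (cover x) \<notin> {1, 2}"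
  proof (cases "V - cover x = {}")
    case True
    then have "cover x = V" using cover_V[OF x] by blast
    then show ?thesis using card_V by simp
  next
    case False
    then obtain v where v: "v \<in> V - cover x" by blast
    have "card (orbit v) \<le> card (V - cover x)" using outside_cover(1)[OF assms v] finite_V by (intro card_mono) auto
    also have "\<dots> = 28 - card (cover x)" using cover_V[OF x] finite_V card_V by (simp add: card_Diff_subset finite_subset)
    finally show ?thesis using outside_cover(2)[OF assms v] by auto
  qed
  moreover have "card (cover x) \<le> 28" using card_mono[OF finite_V cover_V[OF x]] card_V by simp
  moreover have "\<forall>w\<in>set (map (deg_in x) Ss). 1 \<le> w"
    using Ss(1) deg_in_pos orbit_self by (fastforce elim!: equal_orbitsE simp: Suc_le_eq)
  moreover have "(h = 0 \<and> T = 0 \<and> L = 0) \<or> (h = 1 \<and> card (orbit x) = L * T \<and> 3 \<le> L \<and> T \<in> {2..5})"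
  proof (cases "short_nbrs x = {}")
    case False
    then have "card (short_nbrs x) = 1" using short_le_1[OF assms] finite_short by (metis card_0_eq le_antisym One_nat_def Suc_leI neq0_conv)
    then obtain y where y: "short_nbrs x = {y}" by (auto simp: card_1_singleton_iff)
    then show ?thesis using short_nbr[of y x] x by (simp add: h_def T_def L_def)
  qed (simp add: h_def T_def L_def)
  ultimately have "row_type (card (orbit x)) (deg_in x (orbit x)) (map (deg_in x) Ss) h L"
    by (intro row_cases[where T = T])
      (use deg_in_self(1)[OF x] row_degree[OF assms] row_square[OF assms] cover in
        \<open>simp_all add: sums h_def T_def o_def\<close>)
  then show thesis using that Ss cover h_def L_def by blast
qed

end

section \<open>Excluding the order 28\<close>

context quintic_28 begin

lemma longest_exists: obtains x where "longest x"
proof -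
  have "V \<noteq> {}" using card_V by auto
  then have "Max ((\<lambda>x. card (orbit x)) ` V) \<in> (\<lambda>x. card (orbit x)) ` V" using finite_V by (intro Max_in) auto
  then obtain x where "x \<in> V" "card (orbit x) = Max ((\<lambda>x. card (orbit x)) ` V)" by auto
  then have "longest x" unfolding longest_def using finite_V by simp
  then show thesis by (rule that)
qed

lemma longest_V: "longest x \<Longrightarrow> x \<in> V" by (simp add: longest_def)

lemma longest_eq: "longest x \<Longrightarrow> y \<in> V \<Longrightarrow> card (orbit y) = card (orbit x) \<Longrightarrow> longest y"
  by (simp add: longest_def)

lemma outside_card:
  assumes "longest x" "v \<in> V - cover x"
  shows "card (orbit v) \<le> 28 - card (cover x)" "card (orbit v) < 28 - card (cover x) \<Longrightarrow> card (orbit v) + 3 \<le> 28 - card (cover x)"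
proof -
  have x: "x \<in> V" using longest_V assms(1) .
  have card_out: "card (V - cover x) = 28 - card (cover x)"
    using cover_V[OF x] finite_V card_V by (simp add: card_Diff_subset finite_subset)
  have sub: "orbit v \<subseteq> V - cover x" using outside_cover(1)[OF assms] .
  then show "card (orbit v) \<le> 28 - card (cover x)"
    using card_mono[OF _ sub] finite_V card_out by simp
  assume less: "card (orbit v) < 28 - card (cover x)"
  then have "orbit v \<noteq> V - cover x" using card_out by auto
  then obtain u where u: "u \<in> V - cover x" "u \<notin> orbit v" using sub by blast
  have "orbit u \<inter> orbit v = {}" using u(2) orbit_disjoint orbit_self by metis
  moreover have "orbit u \<subseteq> V - cover x" using outside_cover(1)[OF assms(1) u(1)] .
  ultimately have "card (orbit u) + card (orbit v) \<le> card (V - cover x)"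
    using sub finite_V by (subst card_Un_disjoint[symmetric]) (auto intro: card_mono finite_subset)
  then show "card (orbit v) + 3 \<le> 28 - card (cover x)"
    using outside_cover(2)[OF assms(1) u(1)] card_out by simp
qed

lemma degree_partition:
  assumes "finite F" "\<And>S. S \<in> F \<Longrightarrow> \<exists>y. S = orbit y" "V \<subseteq> \<Union> F" "q \<in> V"
  shows "(\<Sum>S\<in>F. deg_in q S) = 5"
proof -
  have "nbrs q = (\<Union>S\<in>F. nbrs q \<inter> S)" using assms(3) E_V2 by blast
  then have "card (nbrs q) = card (\<Union>S\<in>F. nbrs q \<inter> S)" by (rule arg_cong)
  also have "\<dots> = (\<Sum>S\<in>F. card (nbrs q \<inter> S))"
  proof (rule card_UN_disjoint)
    show "\<forall>A\<in>F. \<forall>B\<in>F. A \<noteq> B \<longrightarrow> nbrs q \<inter> A \<inter> (nbrs q \<inter> B) = {}"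
    proof -
      have "\<forall>A\<in>F. \<forall>B\<in>F. A \<noteq> B \<longrightarrow> A \<inter> B = {}"
        by (rule orbits_disjoint_family) (rule assms(2))
      then show ?thesis by blast
    qed
  qed (use assms(1) finite_nbrs in auto)
  finally show ?thesis using degree[OF assms(4)] by (simp add: deg_in_def)
qed

lemma deg_in_zero_iff: "deg_in x S = 0 \<longleftrightarrow> nbrs x \<inter> S = {}"
  unfolding deg_in_def using finite_nbrs by simp

lemma deg_in_nonzero: "deg_in x S \<noteq> 0 \<longleftrightarrow> (\<exists>u\<in>S. E x u)"
  unfolding deg_in_zero_iff by auto

lemma deg_in_longer:
  assumes "card (orbit q) < card (orbit u)"
  shows "deg_in q (orbit u) = 0 \<or> card (orbit u) = card (orbit q) * deg_in q (orbit u)"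
proof (cases "nbrs q \<inter> orbit u = {}")
  case True
  then show ?thesis using deg_in_zero_iff by blast
next
  case False
  then obtain w where w: "E q w" "w \<in> orbit u" by blast
  have "orbit w = orbit u" using orbit_eq[OF w(2)] .
  then show ?thesis using short_orbit(2)[of w q] E_sym[OF w(1)] assms by simp
qed

text \<open>
  The step 3 is impossible in an orbit of length 7: two such steps lead to a vertex that is far
  from the start.
\<close>
lemma two_steps:
  assumes "closed_line \<phi> m" "m = 4 \<or> m = 7" "deg_in (\<phi> 0) (orbit (\<phi> 0)) \<noteq> 0"
  shows "E (\<phi> 0) (\<phi> 2)"
proof -
  note fl = closed_line_far_line[OF assms(1)]
  have "nbrs (\<phi> 0) \<inter> orbit (\<phi> 0) \<noteq> {}" using assms(3) deg_in_zero_iff by simp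
  then obtain y where y: "E (\<phi> 0) y" "y \<in> orbit (\<phi> 0)" by blast
  then obtain j where j: "E (\<phi> 0) (\<phi> j)" using closed_line_mem[OF assms(1)] by metis
  define r where "r = j mod int m"
  have "\<phi> j = \<phi> r" using closed_line_eq[OF assms(1)] by (simp add: r_def mod_eq_dvd_iff[symmetric])
  with j have r: "E (\<phi> 0) (\<phi> r)" by simp
  have "0 \<le> r" "r < int m" using assms(2) by (auto simp: r_def)
  have not_far: "\<not> far (\<phi> 0) (\<phi> r)" using r far_V(4) by blast
  have "\<phi> r \<noteq> \<phi> 0" using r no_loop by metis
  then have "r \<noteq> 0" by metis
  moreover have "r \<noteq> 1" using not_far far_line_far[OF fl, of 0 "\<phi> 1"] by auto
  moreover have "r \<noteq> int m - 1"
  proof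
    assume "r = int m - 1"
    then have "\<phi> r = \<phi> (0 - 1)" using closed_line_eq[OF assms(1)] by simp
    then show False using not_far far_line_far[OF fl, of 0 "\<phi> r"] by auto
  qed
  ultimately consider "r = 2" | "m = 7" "r = 3" | "m = 7" "r = 4" | "m = 7" "r = 5"
    using assms(2) \<open>0 \<le> r\<close> \<open>r < int m\<close> by fastforce
  moreover have False if "m = 7" "E (\<phi> 0) (\<phi> 3)"
  proof -
    have "E (\<phi> 3) (\<phi> (3 + 3))" using circulant[OF assms(1), of 3 3] that by blast
    moreover have "\<phi> (3 + 3) = \<phi> (0 - 1)" using closed_line_eq[OF assms(1)] that by simp
    then have "far (\<phi> 0) (\<phi> (3 + 3))" using far_line_far[OF fl] by metis
    ultimately show False using that unfolding far_def by blast
  qed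
  moreover have "\<phi> (- 4) = \<phi> 3" "\<phi> (- 5) = \<phi> 2" if "m = 7" using closed_line_eq[OF assms(1)] that by simp_all
  ultimately show ?thesis using r circulant_neg[OF assms(1) r] by cases metis+
qed

lemma inner_edges_separate:
  assumes "E x y" "y \<notin> orbit x" "card (orbit x) = card (orbit y)" "card (orbit x) = 4 \<or> card (orbit x) = 7"
    "deg_in x (orbit x) \<noteq> 0"
  shows "deg_in y (orbit y) = 0"
proof (rule ccontr)
  assume ne: "deg_in y (orbit y) \<noteq> 0"
  have V: "x \<in> V" "y \<in> V" using assms(1) E_V E_V2 by blast+
  obtain \<phi> where \<phi>: "closed_line \<phi> (card (orbit x))" "\<phi> 0 = x" using closed_line_at[OF V(1)] .
  obtain \<psi> where \<psi>: "closed_line \<psi> (card (orbit y))" "\<psi> 0 = y" using closed_line_at[OF V(2)] .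
  have "E (\<phi> 0) (\<phi> (int 2))" "E (\<psi> 0) (\<psi> (int 2))"
    using two_steps[OF \<phi>(1)] two_steps[OF \<psi>(1)] assms(3-5) ne \<phi>(2) \<psi>(2) by simp_all
  then have "orbit x = orbit y" using common_step[where s = 2, OF \<phi>(1) \<psi>(1)] assms(1) \<phi>(2) \<psi>(2) by simp
  then show False using assms(2) orbit_self by blast
qed

lemma far_nbrs_not_adjacent:
  assumes "x \<in> V" "far x p" "far x q" "E p q"
  obtains \<phi> where "closed_line \<phi> (card (orbit x))" "\<phi> 0 = x" "E (\<phi> 0) (\<phi> 2)"
proof -
  obtain \<phi> where \<phi>: "closed_line \<phi> (card (orbit x))" "\<phi> 0 = x" using closed_line_at[OF assms(1)] .
  note fl = closed_line_far_line[OF \<phi>(1)]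
  have "p \<noteq> q" using assms(4) no_loop by blast
  then have "{p, q} = {\<phi> (- 1), \<phi> 1}"
    using assms(2,3) \<phi>(2) far_line_far[OF fl, of 0] by auto
  then have "E (\<phi> (- 1)) (\<phi> (- 1 + 2))" using assms(4) E_sym by (auto simp: doubleton_eq_iff)
  then have "E (\<phi> 0) (\<phi> 2)" using circulant[OF \<phi>(1)] by blast
  with \<phi> show thesis by (rule that)
qed

lemma partner_deg_in:
  assumes "partner x z" shows "2 \<le> deg_in z (orbit x)"
proof -
  have "x \<in> V" using assms by (simp add: partner_def)
  then have "card {y. far x y} = 2" by (rule card_far_2)
  moreover have "{y. far x y} \<subseteq> nbrs z \<inter> orbit x" using assms orbit_far by (auto simp: partner_def)
  ultimately show ?thesis unfolding deg_in_def
    using card_mono[of "nbrs z \<inter> orbit x" "{y. far x y}"] finite_nbrs by simp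
qed

lemma not_3: assumes "longest x" shows "card (orbit x) \<noteq> 3"
proof
  assume x: "card (orbit x) = 3"
  have orb3: "card (orbit y) = 3" if "y \<in> V" for y
    using assms that x card_orbit_ge[OF that] unfolding longest_def by (metis le_antisym)
  have "3 dvd card V"
  proof (rule equiv_imp_dvd_card)
    show "equiv V {(x, y). x \<in> V \<and> y \<in> orbit x}"
    proof (rule equivI)
      show "sym {(x, y). x \<in> V \<and> y \<in> orbit x}" unfolding sym_def using orbit_eq orbit_self orbit_V by blast
      show "trans {(x, y). x \<in> V \<and> y \<in> orbit x}" unfolding trans_def using orbit_eq by blast
    qed (use orbit_V orbit_self in \<open>auto simp: refl_on_def\<close>)
    show "3 dvd card X" if "X \<in> V // {(x, y). x \<in> V \<and> y \<in> orbit x}" for X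
      using that orb3 by (auto simp: quotient_def Image_def)
  qed (rule finite_V)
  then show False using card_V by simp
qed

lemma not_4: assumes "longest x" shows "card (orbit x) \<noteq> 4"
proof
  assume m: "card (orbit x) = 4"
  have b: "deg_in y (orbit y) = 1 \<and> equal_orbits y \<noteq> {}" if y: "longest y" "card (orbit y) = 4" for y
  proof -
    obtain Ss h L where Ss: "set Ss = equal_orbits y"
      "row_type (card (orbit y)) (deg_in y (orbit y)) (map (deg_in y) Ss) h L"
      using longest_row[OF y(1)] by metis
    then have "deg_in y (orbit y) = 1" "Ss \<noteq> []" using y(2) by (auto simp: row_type_def)
    with Ss(1) show ?thesis by (metis set_empty)
  qed
  then obtain S where "S \<in> equal_orbits x" using assms m by blast
  then obtain y where y: "E x y" "card (orbit y) = card (orbit x)" "y \<notin> orbit x" "y \<in> V" by (metis equal_orbitsE)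
  then have "deg_in y (orbit y) = 1" "deg_in x (orbit x) = 1" using b m longest_eq[OF assms] assms by auto
  then show False using inner_edges_separate[of x y] y m by simp
qed

text \<open>
  Every orbit outside the cover is adjacent to an orbit of the cover, and the lengths of adjacent orbits
  divide one another.
\<close>
lemma not_leftover:
  assumes "longest x" "28 - card (cover x) \<noteq> 0"
   "\<And>v y. 3 \<le> card (orbit v) \<Longrightarrow> card (orbit v) \<le> 28 - card (cover x) \<Longrightarrow> 
      card (orbit v) < 28 - card (cover x) \<longrightarrow> card (orbit v) + 3 \<le> 28 - card (cover x) \<Longrightarrow>
      card (orbit y) = card (orbit x) \<or> y \<in> short_nbrs x \<Longrightarrow>
      card (orbit y) dvd card (orbit v) \<or> card (orbit v) dvd card (orbit y) \<Longrightarrow> False"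
  shows False
proof -
  have "cover x \<noteq> V"
  proof
    assume "cover x = V"
    then show False using assms(2) card_V by simp
  qed
  then obtain v where v: "v \<in> V - cover x" using cover_V[OF longest_V[OF assms(1)]] by blast
  from outside_cover(3)[OF assms(1) v] obtain y where
    y: "E y v" "card (orbit y) = card (orbit x) \<or> y \<in> short_nbrs x" by blast
  show False
    using assms(3)[of v y] outside_cover(2)[OF assms(1) v] outside_card[OF assms(1) v] y(2) comparable[OF y(1)] by blast
qed

text \<open>
  A neighbour \<open>q\<close> of \<open>x\<close> in the orbit of length 4 has 3 or 0 neighbours in each of the two orbits of
  length 12, and at most one in its own.
\<close>
lemma not_12:
  assumes "longest x" "card (orbit x) = 12" "card (short_nbrs x) = 1" 
    "(\<Sum>y\<in>short_nbrs x. card (orbit y)) = 4" "card (equal_orbits x) = 1"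
  shows False
proof -
  have x: "x \<in> V" using longest_V assms(1) .
  obtain q where q: "short_nbrs x = {q}" using assms(3) by (auto simp: card_1_singleton_iff)
  obtain S where S: "equal_orbits x = {S}" using assms(5) by (auto simp: card_1_singleton_iff)
  obtain s where s: "S = orbit s" "card (orbit s) = 12" "s \<notin> orbit x" using equal_orbitsE[of S x] S assms(2) by (metis insertI1)
  have Q: "q \<in> V" "card (orbit q) = 4" using q assms(4) short_nbrs_V by auto
  have "card (cover x) = 28" using card_cover[OF x] assms by simp
  then have "cover x = V" using card_subset_eq[OF finite_V cover_V[OF x]] card_V by simp
  then have "V \<subseteq> \<Union> {orbit x, S, orbit q}" unfolding cover_def S q by auto
  then have "(\<Sum>T\<in>{orbit x, S, orbit q}. deg_in q T) = 5"
    by (intro degree_partition) (use s Q in auto)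
  moreover have "orbit x \<noteq> S" "orbit x \<noteq> orbit q" "S \<noteq> orbit q" using s Q assms(2) orbit_self by auto
  ultimately have "deg_in q (orbit x) + deg_in q S + deg_in q (orbit q) = 5" by simp
  moreover have "deg_in q (orbit x) = 0 \<or> 12 = 4 * deg_in q (orbit x)" "deg_in q S = 0 \<or> 12 = 4 * deg_in q S"
    using deg_in_longer[of q x] deg_in_longer[of q s] Q s assms(2) by simp_all
  moreover have "deg_in q (orbit q) \<le> 1" using deg_in_self(2)[OF Q(1)] Q(2) by simp
  ultimately show False by auto
qed


lemma row_7:
  assumes "longest y" "card (orbit y) = 7"
  shows "short_nbrs y = {}" "cover y = V" "deg_in y (orbit y) = 0 \<or> deg_in y (orbit y) = 2"
    "deg_in y (orbit y) \<noteq> 0 \<Longrightarrow> S \<in> equal_orbits y \<Longrightarrow> deg_in y S = 1"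
    "deg_in y (orbit y) = 0 \<Longrightarrow> \<exists>T T' T''. equal_orbits y = {T, T', T''} \<and> distinct [T, T', T''] \<and>
       deg_in y T = 1 \<and> deg_in y T' = 2 \<and> deg_in y T'' = 2"
proof -
  obtain Ss h L where Ss: "distinct Ss" "set Ss = equal_orbits y" "h = card (short_nbrs y)"
    "L = (\<Sum>u\<in>short_nbrs y. card (orbit u))" "card (cover y) = card (orbit y) * (1 + length Ss) + L"
    "row_type (card (orbit y)) (deg_in y (orbit y)) (map (deg_in y) Ss) h L"
    by (rule longest_row[OF assms(1)])
  have R: "h = 0" "deg_in y (orbit y) = 2 \<and> map (deg_in y) Ss = [1, 1, 1] \<or>
      deg_in y (orbit y) = 0 \<and> map (deg_in y) Ss \<in> {[1, 2, 2], [2, 1, 2], [2, 2, 1]}"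
    using Ss(6) unfolding row_type_def assms(2) by simp_all
  have "length (map (deg_in y) Ss) = 3" using R(2) by (elim disjE conjE; auto)
  then have len: "length Ss = 3" by simp
  show short: "short_nbrs y = {}" using R(1) Ss(3) finite_short by simp
  then have "card (cover y) = 28" using Ss(4,5) assms(2) len by simp
  then show "cover y = V" using card_subset_eq[OF finite_V cover_V[OF longest_V[OF assms(1)]]] card_V by simp
  show "deg_in y (orbit y) = 0 \<or> deg_in y (orbit y) = 2" using R(2) by blast
  show "deg_in y S = 1" if "deg_in y (orbit y) \<noteq> 0" "S \<in> equal_orbits y"
  proof -
    have "map (deg_in y) Ss = [1, 1, 1]" using R(2) that(1) by blast
    moreover have "deg_in y S \<in> set (map (deg_in y) Ss)" using that(2) Ss(2) by simp
    ultimately show ?thesis by simp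
  qed
  show "\<exists>T T' T''. equal_orbits y = {T, T', T''} \<and> distinct [T, T', T''] \<and>
       deg_in y T = 1 \<and> deg_in y T' = 2 \<and> deg_in y T'' = 2" if "deg_in y (orbit y) = 0"
  proof -
    obtain S1 S2 S3 where S: "Ss = [S1, S2, S3]" using len by (auto simp: length_Suc_conv eval_nat_numeral)
    have "map (deg_in y) Ss \<in> {[1, 2, 2], [2, 1, 2], [2, 2, 1]}" using R(2) that by simp
    then consider "deg_in y S1 = 1" "deg_in y S2 = 2" "deg_in y S3 = 2" | "deg_in y S2 = 1" "deg_in y S1 = 2" "deg_in y S3 = 2"
      | "deg_in y S3 = 1" "deg_in y S1 = 2" "deg_in y S2 = 2" unfolding S by auto
    moreover have "equal_orbits y = {S1, S2, S3}" "distinct [S1, S2, S3]" using Ss(1,2) unfolding S by auto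
    moreover from this have "equal_orbits y = {S2, S1, S3}" "distinct [S2, S1, S3]"
      "equal_orbits y = {S3, S1, S2}" "distinct [S3, S1, S2]" by auto
    ultimately show ?thesis by cases metis+
  qed
qed

text \<open>
  All four orbits have length 7. Two orbits with inner edges cannot be adjacent, so at most one orbit has
  inner edges. If there is one, the partners match up the 21 remaining vertices, which is absurd. If there
  is none, some vertex has one neighbour in one of the other orbits and two in each of the remaining ones,
  which gives 9 walks of length at most 2 to 7 vertices.
\<close>
lemma not_7: assumes "longest x" shows "card (orbit x) \<noteq> 7"
proof
  assume m: "card (orbit x) = 7"
  have all: "longest y" "card (orbit y) = 7" if "y \<in> V" for y
  proof -
    have "y \<in> orbit x \<union> \<Union> (equal_orbits x)"
      using row_7(1,2)[OF assms m] that unfolding cover_def by auto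
    then show "card (orbit y) = 7"
      using m orbit_eq[of y x] equal_orbits_mem(2)[of _ x y] by auto
    then show "longest y" using longest_eq[OF assms that] m by simp
  qed
  have in_equal: "orbit y \<in> equal_orbits z" if "y \<in> V" "z \<in> V" "y \<notin> orbit z" for y z
  proof -
    have "y \<in> orbit z \<union> \<Union> (equal_orbits z)" 
      using row_7(1,2)[OF all[OF that(2)]] that(1) unfolding cover_def by auto
    then obtain S where S: "S \<in> equal_orbits z" "y \<in> S" using \<open>y \<notin> orbit z\<close> by blast
    then show ?thesis using equal_orbits_mem(1)[OF S] by simp
  qed
  show False
  proof (cases "\<exists>z\<in>V. deg_in z (orbit z) = 2")
    case True
    then obtain z where z: "z \<in> V" "deg_in z (orbit z) = 2" by blast
    have one: "deg_in z (orbit y) = 1" if y: "y \<in> V" "y \<notin> orbit z" for y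
      using row_7(4)[OF all[OF z(1)] _ in_equal[OF y(1) z(1) y(2)]] z(2) by simp
    have zero: "deg_in y (orbit y) = 0" if y: "y \<in> V" "y \<notin> orbit z" for y
    proof -
      have "deg_in z (orbit y) \<noteq> 0" using one[OF y] by simp
      then obtain u where u: "E z u" "u \<in> orbit y" unfolding deg_in_nonzero by (rule bexE)
      have u': "orbit u = orbit y" using orbit_eq u(2) .
      have "u \<notin> orbit z"
      proof
        assume "u \<in> orbit z"
        then have "orbit y = orbit z" using orbit_eq[of u z] u' by simp
        then show False using y(2) orbit_self[of y] by simp
      qed
      then have "deg_in u (orbit u) = 0"
        using inner_edges_separate[OF u(1)] all(2)[OF z(1)] all(2)[OF E_V2[OF u(1)]] z(2) by simp
      then show ?thesis using deg_in_orbit[OF u(2) y(1)] u' by simp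
    qed
    have "even (card (V - orbit z))"
    proof (rule even_card_matching[where R = partner])
      fix y assume "y \<in> V - orbit z"
      then have y: "y \<in> V" "y \<notin> orbit z" by blast+
      have "\<not> E p q" if pq: "far y p" "far y q" for p q
      proof
        assume "E p q"
        then obtain \<phi> where \<phi>: "closed_line \<phi> (card (orbit y))" "\<phi> 0 = y" "E (\<phi> 0) (\<phi> 2)"
          using far_nbrs_not_adjacent[OF y(1) pq] by blast
        then have "\<phi> 2 \<in> nbrs y \<inter> orbit y" using closed_line_range[OF \<phi>(1), of 0] by auto
        then have "deg_in y (orbit y) \<noteq> 0" unfolding deg_in_zero_iff by blast
        then show False using zero[OF y] by simp
      qed
      then obtain w where w: "partner y w" using partner_exists[OF y(1)] all(2)[OF y(1)] by auto
      have "w \<notin> orbit z"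
      proof
        assume "w \<in> orbit z"
        then have "deg_in w (orbit y) = 1" using deg_in_orbit[OF _ y(1)] one[OF y] by simp
        then show False using partner_deg_in[OF w] by simp
      qed
      then show "\<exists>w\<in>V - orbit z. partner y w" using w by (auto simp: partner_def)
    qed (use finite_V partner_sym partner_irrefl partner_unique in blast)+
    moreover have "card (V - orbit z) = 21"
      using card_Diff_subset[OF finite_orbit[OF z(1)] orbit_V[OF z(1)]] card_V all(2)[OF z(1)] by simp
    ultimately show False by simp
  next
    case False
    then have zero: "deg_in y (orbit y) = 0" if "y \<in> V" for y using row_7(3)[OF all[OF that]] that by blast
    note types = row_7(5)[OF all zero]
    have x: "x \<in> V" using longest_V[OF assms] .
    obtain T T' T'' where T: "equal_orbits x = {T, T', T''}" "T \<noteq> T'" "T \<noteq> T''" "T' \<noteq> T''"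
       "deg_in x T = 1" "deg_in x T' = 2" "deg_in x T'' = 2" using types[OF x x x] by auto
    obtain z where z: "T = orbit z" "z \<notin> orbit x" "z \<in> V" using equal_orbitsE[of T x] T(1) by (metis insertI1)
    have zx: "deg_in z (orbit x) = 1" using deg_in_equal[of T x z] T(1,5) z orbit_self x by simp
    have zz: "deg_in z (orbit z) = 0" using zero[OF z(3)] .
    have "x \<notin> orbit z" using z(2) orbit_eq orbit_self by metis
    then have xz: "orbit x \<in> equal_orbits z" using in_equal x z(3) by blast
    have two: "deg_in y (orbit z) = 2" if S: "S \<in> {T', T''}" "y \<in> S" for S y
    proof -
      obtain s where s: "S = orbit s" "s \<notin> orbit x" "s \<in> V" using equal_orbitsE[of S x] T(1) S(1) by (metis insert_iff)
      have "s \<notin> orbit z"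
      proof
        assume "s \<in> orbit z"
        then have "S = T" using orbit_eq[of s z] s(1) z(1) by simp
        then show False using S(1) T(2,3) by blast
      qed
      then have Sz: "S \<in> equal_orbits z" using in_equal[OF s(3) z(3)] s(1) by simp
      have "S \<noteq> orbit x" using s(1,2) orbit_self by metis
      obtain U U' U'' where U: "equal_orbits z = {U, U', U''}" "deg_in z U = 1" "deg_in z U' = 2" "deg_in z U'' = 2"
        using types[OF z(3) z(3) z(3)] by blast
      have "orbit x = U" using xz zx U by auto
      then have "deg_in z S = 2" using Sz U \<open>S \<noteq> orbit x\<close> by auto
      then show ?thesis using deg_in_equal[OF Sz S(2) z(3)] by simp
    qed
    have "nbrs x \<inter> orbit x = {}" using zero[OF x] deg_in_zero_iff by simp
    moreover have "(\<Sum>y\<in>nbrs x \<inter> T. deg_in y (orbit z)) = 0"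
      using deg_in_orbit[OF _ z(3)] zz unfolding z(1) by (auto intro!: sum.neutral)
    moreover have "(\<Sum>y\<in>nbrs x \<inter> T'. deg_in y (orbit z)) = (\<Sum>y\<in>nbrs x \<inter> T'. 2)"
      "(\<Sum>y\<in>nbrs x \<inter> T''. deg_in y (orbit z)) = (\<Sum>y\<in>nbrs x \<inter> T''. 2)"
      using two by (intro sum.cong; blast)+
    then have "(\<Sum>y\<in>nbrs x \<inter> T'. deg_in y (orbit z)) = 4" "(\<Sum>y\<in>nbrs x \<inter> T''. deg_in y (orbit z)) = 4"
      using T(6,7) unfolding deg_in_def[of x] by simp_all
    moreover have "short_nbrs x = {}" using row_7(1)[OF assms m] .
    ultimately have "(\<Sum>y\<in>nbrs x. deg_in y (orbit z)) = 8"
      using sum_nbrs_split[OF assms, of "\<lambda>y. deg_in y (orbit z)"] T(1-4) by simp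
    moreover have "(\<Sum>y\<in>nbrs x. deg_in y (orbit z)) + deg_in x (orbit z) = card (orbit z)"
      using orbit_count_5[OF x z(3)] \<open>x \<notin> orbit z\<close> by simp
    ultimately show False using all(2)[OF z(3)] by simp
  qed
qed

end

lemma (in excess_two) closed_line_reflect:
  assumes "closed_line \<phi> m" shows "closed_line (\<lambda>i. \<phi> (s - i)) m"
proof -
  have "int m dvd (s - i) - (s - j) \<longleftrightarrow> int m dvd i - j" for i j
    using dvd_minus_iff[of "int m" "i - j"] by simp
  then show ?thesis using assms far_line_reflect unfolding closed_line_def by simp
qed

text \<open>
  The wave equation at \<open>(\<phi> 0, \<psi> j)\<close> determines the second neighbour of \<open>\<phi> 1\<close> in the orbit of
  \<open>\<psi> 0\<close>, up to reflection, and shows that the partner moves along an orbit together with the vertex.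
\<close>
lemma (in excess_two) partner_next:
  assumes "closed_line \<phi> m" "closed_line \<psi> m" "4 < m" "partner (\<phi> 0) (\<psi> 0)"
    "deg_in (\<phi> 0) (orbit (\<psi> 0)) = 2" "deg_in (\<phi> 1) (orbit (\<psi> 0)) = 2"
  obtains j where "partner (\<phi> 1) (\<psi> j)"
proof -
  note fl = closed_line_far_line[OF assms(1)] closed_line_far_line[OF assms(2)]
  have mem: "\<psi> j \<in> orbit (\<psi> 0)" for j using closed_line_range[OF assms(2)] by blast
  have opposite: "E (\<phi> 0) (\<psi> (0 - 1))" "E (\<phi> 0) (\<psi> (0 + 1))"
    using partner_sym[OF assms(4)] partner_line[OF fl(2)] by blast+
  have "\<psi> (0 - 1) \<noteq> \<psi> (0 + 1)" using far_line_neq[OF fl(2)] .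
  then have row0: "nbrs (\<phi> 0) \<inter> orbit (\<psi> 0) = {\<psi> (0 - 1), \<psi> (0 + 1)}"
    using opposite mem assms(5) finite_nbrs unfolding deg_in_def by (intro card_subset_eq[symmetric]) auto
  have "E (\<psi> 0) (\<phi> (0 + 1))" using assms(4) partner_line[OF fl(1)] by blast
  then have one: "E (\<phi> 1) (\<psi> 0)" using E_sym by simp
  have "\<not> nbrs (\<phi> 1) \<inter> orbit (\<psi> 0) \<subseteq> {\<psi> 0}"
  proof
    assume "nbrs (\<phi> 1) \<inter> orbit (\<psi> 0) \<subseteq> {\<psi> 0}"
    then have "deg_in (\<phi> 1) (orbit (\<psi> 0)) \<le> card {\<psi> 0}" unfolding deg_in_def by (intro card_mono) auto
    then show False using assms(6) by simp
  qed
  then obtain j where j: "E (\<phi> 1) (\<psi> j)" "\<psi> j \<noteq> \<psi> 0" using closed_line_mem[OF assms(2)] by blast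
  have "adjacency (\<phi> (0 + 1)) (\<psi> j) + adjacency (\<phi> (0 - 1)) (\<psi> j) = adjacency (\<phi> 0) (\<psi> (j + 1)) + adjacency (\<phi> 0) (\<psi> (j - 1))"
    by (rule wave[OF fl])
  then have "E (\<phi> 0) (\<psi> (j + 1)) \<or> E (\<phi> 0) (\<psi> (j - 1))"
    using j(1) by (auto simp: adjacency_def of_bool_def split: if_splits)
  then have "\<psi> (j + 1) \<in> {\<psi> (0 - 1), \<psi> (0 + 1)} \<or> \<psi> (j - 1) \<in> {\<psi> (0 - 1), \<psi> (0 + 1)}"
    using row0 mem by blast
  then have "int m dvd j + 2 \<or> int m dvd j - 2"
    using closed_line_eq[OF assms(2)] j(2) by (auto simp: add.commute)
  then show thesis
  proof
    assume "int m dvd j + 2"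
    then have "\<psi> j = \<psi> (- 1 - 1)" using closed_line_eq[OF assms(2)] by simp
    then have "partner (\<psi> (- 1)) (\<phi> 1)" unfolding partner_line[OF fl(2)]
      using j(1) one far_line_V[OF fl(1)] by simp
    then show thesis using partner_sym that by blast
  next
    assume "int m dvd j - 2"
    then have "\<psi> j = \<psi> (1 + 1)" using closed_line_eq[OF assms(2)] by simp
    then have "partner (\<psi> 1) (\<phi> 1)" unfolding partner_line[OF fl(2)]
      using j(1) one far_line_V[OF fl(1)] by simp
    then show thesis using partner_sym that by blast
  qed
qed

context quintic_28 begin

lemma row_8:
  assumes "longest y" "card (orbit y) = 8"
  shows "card (equal_orbits y) = 2"
    "(deg_in y (orbit y) \<le> 1 \<and> (\<forall>S\<in>equal_orbits y. deg_in y S = 2)) \<or>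
     ((\<forall>S\<in>equal_orbits y. deg_in y S = 1) \<and> short_nbrs y \<noteq> {})"
    "(short_nbrs y = {} \<and> card (cover y) = 24) \<or> (\<exists>q. short_nbrs y = {q} \<and> card (orbit q) = 4 \<and> cover y = V)"
proof -
  obtain Ss h L where Ss: "distinct Ss" "set Ss = equal_orbits y" "h = card (short_nbrs y)"
    "L = (\<Sum>u\<in>short_nbrs y. card (orbit u))" "card (cover y) = card (orbit y) * (1 + length Ss) + L"
    "row_type (card (orbit y)) (deg_in y (orbit y)) (map (deg_in y) Ss) h L"
    by (rule longest_row[OF assms(1)])
  have R: "deg_in y (orbit y) = 1 \<and> map (deg_in y) Ss = [2, 2] \<and> h = 0 \<or>
       deg_in y (orbit y) = 0 \<and> map (deg_in y) Ss = [2, 2] \<and> h = 1 \<and> L = 4 \<or>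
       deg_in y (orbit y) = 2 \<and> map (deg_in y) Ss = [1, 1] \<and> h = 1 \<and> L = 4"
    using Ss(6) unfolding row_type_def assms(2) by simp
  then have "length (map (deg_in y) Ss) = 2" by (elim disjE conjE; simp)
  then have len: "length Ss = 2" by simp
  then show "card (equal_orbits y) = 2" using Ss(1,2) distinct_card by metis
  have image: "deg_in y ` equal_orbits y = set (map (deg_in y) Ss)" using Ss(2) by simp
  have h: "short_nbrs y = {} \<longleftrightarrow> h = 0" using Ss(3) finite_short by simp
  show "(deg_in y (orbit y) \<le> 1 \<and> (\<forall>S\<in>equal_orbits y. deg_in y S = 2)) \<or>
     ((\<forall>S\<in>equal_orbits y. deg_in y S = 1) \<and> short_nbrs y \<noteq> {})"
    using R
  proof (elim disjE conjE)
    assume "deg_in y (orbit y) = 1" "map (deg_in y) Ss = [2, 2]"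
    then have "deg_in y ` equal_orbits y = {2}" using image by simp
    then show ?thesis using \<open>deg_in y (orbit y) = 1\<close> by auto
  next
    assume "deg_in y (orbit y) = 0" "map (deg_in y) Ss = [2, 2]"
    then have "deg_in y ` equal_orbits y = {2}" using image by simp
    then show ?thesis using \<open>deg_in y (orbit y) = 0\<close> by auto
  next
    assume "map (deg_in y) Ss = [1, 1]" "h = 1"
    then have "deg_in y ` equal_orbits y = {1}" using image by simp
    then show ?thesis using h \<open>h = 1\<close> by auto
  qed
  show "(short_nbrs y = {} \<and> card (cover y) = 24) \<or> (\<exists>q. short_nbrs y = {q} \<and> card (orbit q) = 4 \<and> cover y = V)"
  proof (cases "h = 0")
    case True
    then have "short_nbrs y = {}" using h by simp
    then show ?thesis using Ss(4,5) len assms(2) by simp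
  next
    case False
    then have hL: "h = 1" "L = 4" using R by auto
    then obtain q where q: "short_nbrs y = {q}" using Ss(3) by (metis card_1_singletonE)
    then have "card (orbit q) = 4" using Ss(4) hL(2) by simp
    moreover have "card (cover y) = 28" using Ss(5) len assms(2) hL(2) by simp
    then have "cover y = V" using card_subset_eq[OF finite_V cover_V[OF longest_V[OF assms(1)]]] card_V by simp
    ultimately show ?thesis using q by blast
  qed
qed

text \<open>
  There are three orbits of length 8 and one of length 4. The degree of a vertex in the short
  orbit leaves one long orbit without neighbours there, which determines the remaining degrees: a
  vertex in a long orbit has two neighbours in each of the other long orbits and at most one in its own.
  So every vertex of a long orbit has its partner in another long orbit, which depends on the orbit of the
  vertex only. The partners thus match up three orbits, which is absurd.
\<close>
lemma not_8: assumes "longest x" shows "card (orbit x) \<noteq> 8"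
proof
  assume m: "card (orbit x) = 8"
  have x: "x \<in> V" using longest_V[OF assms] .
  obtain q where q: "q \<in> V" "card (orbit q) = 4" "V \<subseteq> orbit x \<union> \<Union> (equal_orbits x) \<union> orbit q"
  proof -
    from row_8(3)[OF assms m] show thesis
    proof (elim disjE exE conjE)
      fix q assume q: "short_nbrs x = {q}" "card (orbit q) = 4" "cover x = V"
      have "V \<subseteq> orbit x \<union> \<Union> (equal_orbits x) \<union> orbit q" using q(1,3) unfolding cover_def by auto
      moreover have "q \<in> V" using short_nbrs_V[of q x] q(1) by simp
      ultimately show thesis using that q(2) by metis
    next
      assume c: "short_nbrs x = {}" "card (cover x) = 24"
      have "cover x \<noteq> V"
      proof
        assume "cover x = V"
        then show False using c(2) card_V by simp
      qed
      then obtain v where v: "v \<in> V - cover x" using cover_V[OF x] by blast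
      have "card (orbit v) = 4" using outside_card[OF assms v] outside_cover(2)[OF assms v] c(2) by linarith
      moreover have sub: "orbit v \<subseteq> V - cover x" using outside_cover(1)[OF assms v] .
      moreover have fin: "finite (V - cover x)" "card (V - cover x) = 4"
        using finite_V cover_V[OF x] card_V c(2) by (simp_all add: card_Diff_subset finite_subset)
      ultimately have "orbit v = V - cover x" by (metis card_subset_eq)
      then have "V \<subseteq> orbit x \<union> \<Union> (equal_orbits x) \<union> orbit v"
        using cover_V[OF x] c(1) unfolding cover_def by blast
      moreover have "v \<in> V" using v by simp
      ultimately show thesis using that \<open>card (orbit v) = 4\<close> by metis
    qed
  qed
  define F where "F = insert (orbit x) (equal_orbits x)"
  have "orbit x \<notin> equal_orbits x" using equal_orbits_mem(3) orbit_self by blast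
  then have card_F: "card F = 3" unfolding F_def using row_8(1)[OF assms m] finite_equal by simp
  have fin_F: "finite F" unfolding F_def using finite_equal by simp
  define big where "big = V - orbit q"
  have small: "card (orbit y) = 4" if "y \<in> orbit q" for y using orbit_eq[OF that] q(2) by simp
  have big: "card (orbit y) = 8" "orbit y \<in> F" "longest y" "y \<in> V" if y: "y \<in> big" for y
  proof -
    show yV: "y \<in> V" using y by (simp add: big_def)
    have "y \<in> orbit x \<union> \<Union> (equal_orbits x)" using y q(3) by (auto simp: big_def)
    then show "orbit y \<in> F" "card (orbit y) = 8"
      using m orbit_eq[of y x] equal_orbits_mem(1,2)[of _ x y] unfolding F_def by auto
    then show "longest y" using longest_eq[OF assms yV] m by simp
  qed
  have bigI: "y \<in> big" if "y \<in> V" "card (orbit y) = 8" for y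
    using that small unfolding big_def by fastforce
  have rep: "\<exists>y\<in>big. S = orbit y" if S: "S \<in> F" for S
  proof (cases "S = orbit x")
    case True
    then show ?thesis using bigI[OF x m] by blast
  next
    case False
    then have "S \<in> equal_orbits x" using S by (simp add: F_def)
    then obtain y where "S = orbit y" "y \<in> V" "card (orbit y) = 8" using equal_orbitsE m by metis
    then show ?thesis using bigI by blast
  qed
  have equal: "equal_orbits y = F - {orbit y}" if y: "y \<in> big" for y
  proof (rule card_subset_eq)
    show "equal_orbits y \<subseteq> F - {orbit y}"
    proof
      fix S assume S: "S \<in> equal_orbits y"
      then obtain z where z: "S = orbit z" "card (orbit z) = card (orbit y)" "z \<notin> orbit y" "z \<in> V" by (metis equal_orbitsE)
      then have "z \<in> big" using bigI big(1)[OF y] by simp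
      then show "S \<in> F - {orbit y}" using big(2) z(1,3) orbit_self[of z] by auto
    qed
    show "card (equal_orbits y) = card (F - {orbit y})"
      using row_8(1)[OF big(3,1)[OF y]] card_F big(2)[OF y] by simp
  qed (use fin_F in simp)
  obtain z where z: "z \<in> big" "deg_in q (orbit z) = 0"
  proof (rule ccontr)
    assume "\<not> thesis"
    then have ne: "deg_in q (orbit y) \<noteq> 0" if "y \<in> big" for y using that \<open>\<And>z. z \<in> big \<Longrightarrow> deg_in q (orbit z) = 0 \<Longrightarrow> thesis\<close> by blast
    have two: "deg_in q S = 2" if S: "S \<in> F" for S
    proof -
      obtain y where y: "y \<in> big" "S = orbit y" using rep[OF S] by blast
      then show ?thesis using deg_in_longer[of q y] ne[OF y(1)] big(1)[OF y(1)] q(2) by simp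
    qed
    have "orbit q \<notin> F"
    proof
      assume "orbit q \<in> F"
      then obtain y where "y \<in> big" "orbit q = orbit y" using rep by blast
      then show False using orbit_self[of y] by (simp add: big_def)
    qed
    then have "(\<Sum>S\<in>insert (orbit q) F. deg_in q S) = deg_in q (orbit q) + (\<Sum>S\<in>F. deg_in q S)" using fin_F by simp
    also have "(\<Sum>S\<in>F. deg_in q S) = (\<Sum>S\<in>F. 2)" using two by (intro sum.cong) auto
    finally have "6 \<le> (\<Sum>S\<in>insert (orbit q) F. deg_in q S)" using card_F by simp
    moreover have "(\<Sum>S\<in>insert (orbit q) F. deg_in q S) = 5"
    proof (rule degree_partition)
      show "\<exists>y. S = orbit y" if "S \<in> insert (orbit q) F" for S using that rep by blast
      show "V \<subseteq> \<Union> (insert (orbit q) F)" unfolding F_def using q(3) by auto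
    qed (use fin_F q(1) in auto)
    ultimately show False by simp
  qed
  have row_z: "deg_in y (orbit y) \<le> 1" "\<And>S. S \<in> equal_orbits y \<Longrightarrow> deg_in y S = 2" if y: "y \<in> orbit z" for y
  proof -
    have oy: "orbit y = orbit z" using orbit_eq[OF y] .
    have yb: "y \<in> big"
      using bigI[of y] oy big(1)[OF z(1)] orbit_V[OF big(4)[OF z(1)]] y by auto
    have "short_nbrs y = {}"
    proof (rule ccontr)
      assume "short_nbrs y \<noteq> {}"
      then obtain u where u: "E y u" "card (orbit u) < 8" using big(1)[OF yb] by (auto simp: short_nbrs_def)
      then have uq: "u \<in> orbit q" using big(1)[of u] E_V2[OF u(1)] unfolding big_def by fastforce
      have "deg_in u (orbit z) = 0" using deg_in_orbit[OF uq big(4)[OF z(1)]] z(2) by simp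
      then show False using deg_in_pos[OF E_sym[OF u(1)] y] by simp
    qed
    with row_8(2)[OF big(3,1)[OF yb]]
    show "deg_in y (orbit y) \<le> 1" "\<And>S. S \<in> equal_orbits y \<Longrightarrow> deg_in y S = 2" by blast+
  qed
  have row: "deg_in y (orbit y) \<le> 1 \<and> (\<forall>S\<in>equal_orbits y. deg_in y S = 2)" if y: "y \<in> big" for y
  proof (cases "y \<in> orbit z")
    case True
    then show ?thesis using row_z by blast
  next
    case False
    have ne: "orbit y \<noteq> orbit z" using False orbit_self by metis
    have yz: "orbit y \<in> equal_orbits z" using equal[OF z(1)] big(2)[OF y] ne by simp
    have zy: "orbit z \<in> equal_orbits y" using equal[OF y] big(2)[OF z(1)] ne by simp
    have "deg_in y (orbit z) = 2"
      using deg_in_equal[OF yz orbit_self big(4)[OF z(1)]] row_z(2)[OF orbit_self yz] by simp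
    then have "\<not> (\<forall>S\<in>equal_orbits y. deg_in y S = 1)" using zy by force
    then show ?thesis using row_8(2)[OF big(3,1)[OF y]] by blast
  qed
  have two: "deg_in y (orbit w) = 2" if "y \<in> big" "w \<in> big" "orbit y \<noteq> orbit w" for y w
    using row[OF that(1)] equal[OF that(1)] big(2)[OF that(2)] that(3) by blast
  have partner_big: "w \<in> big" "orbit w \<noteq> orbit y" if y: "y \<in> big" "partner y w" for y w
  proof -
    have deg: "2 \<le> deg_in w (orbit y)" using partner_deg_in[OF y(2)] .
    have wV: "w \<in> V" using y(2) by (simp add: partner_def)
    show "orbit w \<noteq> orbit y"
    proof
      assume "orbit w = orbit y"
      then have "w \<in> orbit y" using orbit_self by metis
      then have "deg_in w (orbit y) = deg_in y (orbit y)" using deg_in_orbit big(4)[OF y(1)] by blast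
      then show False using row[OF y(1)] deg by simp
    qed
    show "w \<in> big"
    proof (rule ccontr)
      assume "w \<notin> big"
      then have w4: "card (orbit w) = 4" using wV small by (auto simp: big_def)
      obtain \<phi> where \<phi>: "closed_line \<phi> 8" "\<phi> 0 = y" using closed_line_at[OF big(4)[OF y(1)]] big(1)[OF y(1)] by metis
      obtain \<chi> where \<chi>: "closed_line \<chi> 4" "\<chi> 0 = w" using closed_line_at[OF wV] w4 by metis
      have adj: "E w (\<phi> (0 - 1))" "E w (\<phi> (0 + 1))"
        using y(2) partner_line[OF closed_line_far_line[OF \<phi>(1)], of 0 w] \<phi>(2) by auto
      have "E (\<phi> (0 + 1)) (\<chi> 0)" using adj(2) E_sym \<chi>(2) by blast
      from period[OF \<phi>(1) \<chi>(1) this, of 1] have "E w (\<phi> 5)" using E_sym \<chi>(2) by simp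
      moreover have "range \<phi> = orbit y" using closed_line_range[OF \<phi>(1), of 0] \<phi>(2) by simp
      ultimately have sub: "{\<phi> (- 1), \<phi> 1, \<phi> 5} \<subseteq> nbrs w \<inter> orbit y" using adj by auto
      have "card {\<phi> (- 1), \<phi> 1, \<phi> 5} = 3" using closed_line_eq[OF \<phi>(1)] by simp
      then have "3 \<le> deg_in w (orbit y)" unfolding deg_in_def
        using card_mono[OF _ sub] finite_nbrs by simp
      moreover have "deg_in w (orbit y) = 0 \<or> 8 = 4 * deg_in w (orbit y)"
        using deg_in_longer[of w y] w4 big(1)[OF y(1)] by simp
      ultimately show False by simp
    qed
  qed
  have partner_ex: "\<exists>w. partner y w" if y: "y \<in> big" for y
  proof -
    have "\<not> E p r" if pr: "far y p" "far y r" for p r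
    proof
      assume "E p r"
      then obtain \<phi> where \<phi>: "closed_line \<phi> (card (orbit y))" "\<phi> 0 = y" "E (\<phi> 0) (\<phi> 2)"
        using far_nbrs_not_adjacent[OF big(4)[OF y] pr] by blast
      have "E (\<phi> 0) (\<phi> (- 2))" using circulant_neg[OF \<phi>(1,3)] .
      moreover have "range \<phi> = orbit y" using closed_line_range[OF \<phi>(1), of 0] \<phi>(2) by simp
      ultimately have sub: "{\<phi> (- 2), \<phi> 2} \<subseteq> nbrs y \<inter> orbit y" using \<phi>(2,3) by auto
      have "card {\<phi> (- 2), \<phi> 2} = 2" using closed_line_eq[OF \<phi>(1)] big(1)[OF y] by simp
      then have "2 \<le> deg_in y (orbit y)" unfolding deg_in_def
        using card_mono[OF _ sub] finite_nbrs by simp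
      then show False using row[OF y] by simp
    qed
    moreover have "4 \<le> card (orbit y)" using big(1)[OF y] by simp
    ultimately show ?thesis using partner_exists[OF big(4)[OF y]] by metis

  qed
  have partner_step: "orbit w' = orbit w" if y: "y \<in> big" "far y y'" and w: "partner y w" "partner y' w'" for y y' w w'
  proof -
    have wb: "w \<in> big" "orbit w \<noteq> orbit y" using partner_big[OF y(1) w(1)] by blast+
    have oy: "orbit y' = orbit y" using orbit_eq[OF orbit_far[OF y(2)]] .
    have yb: "y' \<in> big" using bigI[of y'] oy big(1)[OF y(1)] far_V(2)[OF y(2)] by simp
    obtain \<phi>' where \<phi>': "closed_line \<phi>' 8" "\<phi>' 0 = y" using closed_line_at[OF big(4)[OF y(1)]] big(1)[OF y(1)] by metis
    have "y' = \<phi>' (0 - 1) \<or> y' = \<phi>' (0 + 1)"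
      using y(2) far_line_far[OF closed_line_far_line[OF \<phi>'(1)], of 0] \<phi>'(2) by simp
    then obtain \<phi> where \<phi>: "closed_line \<phi> 8" "\<phi> 0 = y" "\<phi> 1 = y'"
    proof
      assume "y' = \<phi>' (0 - 1)"
      then show thesis using that[of "\<lambda>i. \<phi>' (0 - i)"] closed_line_reflect[OF \<phi>'(1), of 0] \<phi>'(2) by simp
    next
      assume "y' = \<phi>' (0 + 1)"
      then show thesis using that[of \<phi>'] \<phi>' by simp
    qed
    obtain \<psi> where \<psi>: "closed_line \<psi> 8" "\<psi> 0 = w" using closed_line_at[OF big(4)[OF wb(1)]] big(1)[OF wb(1)] by metis
    have "deg_in y (orbit w) = 2" "deg_in y' (orbit w) = 2"
      using two[OF y(1) wb(1)] two[OF yb wb(1)] wb(2) oy by simp_all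
    then obtain j where "partner y' (\<psi> j)"
      using partner_next[OF \<phi>(1) \<psi>(1)] w(1) \<phi>(2,3) \<psi>(2) by auto
    then have "w' = \<psi> j" using partner_unique[OF w(2)] by blast
    then show ?thesis using closed_line_range[OF \<psi>(1)] \<psi>(2) by metis
  qed
  have partner_orbit: "orbit w' = orbit w" if y: "y \<in> big" "y' \<in> orbit y" and w: "partner y w" "partner y' w'" for y y' w w'
  proof -
    have "far\<^sup>*\<^sup>* y y'" using y(2) by (simp add: orbit_def)
    then have "\<forall>w'. partner y' w' \<longrightarrow> orbit w' = orbit w"
    proof induction
      case base
      then show ?case using partner_unique[OF w(1)] by blast
    next
      case (step u v)
      have "u \<in> orbit y" using step(1) by (simp add: orbit_def)
      then have ub: "u \<in> big" using bigI[of u] orbit_eq[of u y] big(1)[OF y(1)] far_V(1)[OF step(2)] by simp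
      obtain t where t: "partner u t" using partner_ex[OF ub] by blast
      then have "orbit t = orbit w" using step(3) by blast
      then show ?case using partner_step[OF ub step(2) t] by simp
    qed
    then show ?thesis using w(2) by blast
  qed
  \<comment> \<open>Being partners, as a relation between orbits.\<close>
  define R where "R S T \<longleftrightarrow> (\<exists>y w. y \<in> big \<and> w \<in> big \<and> partner y w \<and> S = orbit y \<and> T = orbit w)" for S T
  have "even (card F)"
  proof (rule even_card_matching[where R = R])
    show "\<exists>T\<in>F. R S T" if S: "S \<in> F" for S
    proof -
      obtain y where y: "y \<in> big" "S = orbit y" using rep[OF S] by blast
      obtain w where w: "partner y w" using partner_ex[OF y(1)] by blast
      have "w \<in> big" using partner_big[OF y(1) w] by blast
      then show ?thesis using y w big(2)[of w] unfolding R_def by blast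
    qed
    show "R T S" if "R S T" for S T using that partner_sym unfolding R_def by blast
    show "\<not> R S S" for S using partner_big(2) unfolding R_def by metis
    show "T = T'" if "R S T" "R S T'" for S T T'
    proof -
      obtain y w where yw: "y \<in> big" "partner y w" "S = orbit y" "T = orbit w" using \<open>R S T\<close> unfolding R_def by blast
      obtain y' w' where yw': "partner y' w'" "S = orbit y'" "T' = orbit w'" using \<open>R S T'\<close> unfolding R_def by blast
      have "y' \<in> orbit y" using yw(3) yw'(2) orbit_self by metis
      then show ?thesis using partner_orbit[OF yw(1) _ yw(2) yw'(1)] yw(4) yw'(3) by simp
    qed
  qed (rule fin_F)
  then show False using card_F by simp
qed

theorem no_quintic_28: False
proof -
  obtain x where x: "longest x" by (rule longest_exists)
  obtain Ss h L where Ss: "distinct Ss" "set Ss = equal_orbits x" "h = card (short_nbrs x)"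
    "L = (\<Sum>u\<in>short_nbrs x. card (orbit u))" "card (cover x) = card (orbit x) * (1 + length Ss) + L"
    "row_type (card (orbit x)) (deg_in x (orbit x)) (map (deg_in x) Ss) h L"
    by (rule longest_row[OF x])
  have len: "length Ss = card (equal_orbits x)" using Ss(1,2) distinct_card by metis
  have h0: "short_nbrs x = {} \<and> L = 0" if "h = 0" using that Ss(3,4) finite_short by auto
  have "card (orbit x) = 5 \<and> h = 0 \<and> length Ss = 4 \<or> card (orbit x) = 6 \<and> h = 0 \<and> length Ss = 3 \<or>
      card (orbit x) = 10 \<and> h = 1 \<and> L = 5 \<and> length Ss = 1 \<or> card (orbit x) = 12 \<and> h = 1 \<and> L = 4 \<and> length Ss = 1"
    using Ss(6) not_3[OF x] not_4[OF x] not_7[OF x] not_8[OF x] unfolding row_type_def length_map by blast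
  then show False
  proof (elim disjE conjE)
    assume a: "card (orbit x) = 5" "h = 0" "length Ss = 4"
    then have c: "card (cover x) = 25" using Ss(5) h0 by simp
    show False
    proof (rule not_leftover[OF x])
      fix v y assume "3 \<le> card (orbit v)" "card (orbit v) \<le> 28 - card (cover x)"
        "card (orbit y) = card (orbit x) \<or> y \<in> short_nbrs x"
        "card (orbit y) dvd card (orbit v) \<or> card (orbit v) dvd card (orbit y)"
      then have "card (orbit v) = 3" "card (orbit y) = 5" using a h0 c by auto
      then show False using \<open>card (orbit y) dvd card (orbit v) \<or> _\<close> by simp
    qed (use c in simp)
  next
    assume a: "card (orbit x) = 6" "h = 0" "length Ss = 3"
    then have c: "card (cover x) = 24" using Ss(5) h0 by simp
    show False
    proof (rule not_leftover[OF x])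
      fix v y assume "3 \<le> card (orbit v)" "card (orbit v) \<le> 28 - card (cover x)"
        "card (orbit v) < 28 - card (cover x) \<longrightarrow> card (orbit v) + 3 \<le> 28 - card (cover x)"
        "card (orbit y) = card (orbit x) \<or> y \<in> short_nbrs x"
        "card (orbit y) dvd card (orbit v) \<or> card (orbit v) dvd card (orbit y)"
      then have "card (orbit v) = 4" "card (orbit y) = 6" using a h0 c by auto
      then show False using \<open>card (orbit y) dvd card (orbit v) \<or> _\<close> by simp
    qed (use c in simp)
  next
    assume a: "card (orbit x) = 10" "h = 1" "L = 5" "length Ss = 1"
    then have c: "card (cover x) = 25" using Ss(5) by simp
    obtain s where s: "short_nbrs x = {s}" using a(2) Ss(3) by (metis card_1_singletonE)
    then have "card (orbit s) = 5" using a(3) Ss(4) by simp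
    show False
    proof (rule not_leftover[OF x])
      fix v y assume "3 \<le> card (orbit v)" "card (orbit v) \<le> 28 - card (cover x)"
        "card (orbit y) = card (orbit x) \<or> y \<in> short_nbrs x"
        "card (orbit y) dvd card (orbit v) \<or> card (orbit v) dvd card (orbit y)"
      then have "card (orbit v) = 3" "card (orbit y) = 10 \<or> card (orbit y) = 5" 
        using a s \<open>card (orbit s) = 5\<close> c by auto
      then show False using \<open>card (orbit y) dvd card (orbit v) \<or> _\<close> by auto
    qed (use c in simp)
  next
    assume "card (orbit x) = 12" "h = 1" "L = 4" "length Ss = 1"
    then show False using not_12[OF x] Ss(3,4) len by simp
  qed
qed

end

section \<open>The spectrum\<close>

lemma spectrum_5_5_lower:
  assumes "n \<in> kg_spectrum 5 5" shows "even n \<and> 30 \<le> n"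
proof -
  obtain V :: "nat set" and E where g: "girth5 V E 5" and n: "card V = n" "V \<noteq> {}"
    using spectrum_girth5[OF assms] by blast
  interpret girth5 V E 5 by (rule g)
  have "even n" using even_order n(1) by simp
  moreover have "26 \<le> n" using moore_bound[OF n(2)] n(1) by simp
  moreover have "n \<noteq> 26" using no_moore_graph_5 n(1) by simp
  moreover have "n \<noteq> 28"
  proof
    assume "n = 28"
    interpret quintic_28 V E by unfold_locales (use n(1) \<open>n = 28\<close> in simp)
    show False by (rule no_quintic_28)
  qed
  ultimately show ?thesis by presburger
qed

theorem mainTheorem16:
  fixes S A :: "nat set"
  assumes "S = kg_spectrum 5 5"
    and "A = {30, 32} \<union> {n. even n \<and> n \<ge> 36}"
  shows "A \<subseteq> S \<and> S \<subseteq> A \<union> {34} \<and> kg_N 5 5 \<le> 36"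
proof -
  have sub: "A \<subseteq> S" using assms spectrum_30 spectrum_32 spectrum_even by blast
  moreover have "n \<in> A \<union> {34}" if "n \<in> S" for n
  proof -
    have "even n" "30 \<le> n" using spectrum_5_5_lower that assms(1) by blast+
    then have "n = 30 \<or> n = 32 \<or> n = 34 \<or> 36 \<le> n" by presburger
    then show ?thesis using assms(2) \<open>even n\<close> by blast
  qed
  moreover have "kg_N 5 5 \<le> 36"
    unfolding kg_N_def using spectrum_even by (intro Least_le) simp
  ultimately show ?thesis by blast
qed

end
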